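(* Let $X_1,X_2,\dots$ be i.i.d. with density $p$ as described in the context, $h\in\mathfrak{R}$, and let $a_n\to\infty$. Fix $k\ge1$ and $y_1^k=(y_1,\dots,y_k)\in\mathbb{R}^k$. For $0\le i\le k$ put $s_1^i=y_1+\dots+y_i$ ($s_1^0=0$) and define $t_i$ (depending on $n$) by $$m(t_i)=m_i:=\frac{na_n-s_1^i}{n-i}.$$ Assume $$\lim_{n\to\infty}\frac{\psi(t_k)^2}{\sqrt{n\psi'(t_k)}}=0 .$$ Let $p_{a_n}(y_1^k)=p(X_1^k=y_1^k\mid S_1^n=na_n)$ be the conditional density of $X_1^k=(X_1,\dots,X_k)$ given $S_1^n=X_1+\dots+X_n=na_n$, evaluated at $y_1^k$. Then, as $n\to\infty$, $$p_{a_n}(y_1^k)=g_m(y_1^k)\,(1+o(1)),\qquad g_m(y_1^k)=\prod_{i=0}^{k-1}\pi^{m_i}(y_{i+1}).$$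
   Context: Density: $p$ is a uniformly bounded probability density, $p(x)=c\exp(-(g(x)-q(x)))$ for $x\in\mathbb{R}_+$ (and $p=0$ on negative reals), with $c>0$ a normalizing constant. The function $g$ is positive, $g(x)/x\to\infty$ as $x\to\infty$, and $h:=g'$. There is a constant $\vartheta>0$ such that for all large $x$, $\sup_{|v-x|<\vartheta x}|q(v)|\le 1/\sqrt{x h(x)}$. Regularity classes: $l\in R_0$ if $l(x)=\exp\left(\int_1^x\frac{\epsilon(u)}{u}du\right)$ for $x\ge1$, where $\epsilon$ is twice differentiable and $\epsilon(x)\to0$ as $x\to\infty$. For $\beta>0$, $h\in R_\beta$ if for $x$ large enough $h(x)=x^\beta l(x)$ with $l\in R_0$ whose function $\epsilon$ satisfies $\limsup_{x\to\infty}x|\epsilon'(x)|<\infty$ and $\limsup_{x\to\infty}x^2|\epsilon''(x)|<\infty$. A function $l\in R_0$ belongs to $\widetilde{R_0}$ if $l(x)\to\infty$ as $x\to\infty$, $\lim_{x\to\infty}\frac{x\epsilon'(x)}{\epsilon(x)}=0$, $\lim_{x\to\infty}\frac{x^2\epsilon''(x)}{\epsilon(x)}=0$, and $\liminf_{x\to\infty}x^\eta\epsilon(x)>0$ for some $\eta\in(0,1/4)$. $h\in R_\infty$ if $h$ is increasing and strictly monotone and its inverse $\psi$ belongs to $\widetilde{R_0}$. Here $\psi(u):=h^{\leftarrow}(u):=\inf\{x:h(x)\ge u\}$ (this notation is used for all $h$). $\mathfrak{R}:=R_\beta\cup R_\infty$ (any $\beta>0$). $\Phi(t)=\int_0^\infty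 e^{tx}p(x)\,dx$; $m(t)=\frac{d}{dt}\log\Phi(t)$. The tilted density is $\pi^{a}(x)=\frac{e^{tx}p(x)}{\Phi(t)}$ with $t$ the unique solution of $m(t)=a$.
   Formalization: The formal theorem also assumes h bounded above on every interval (0,b]; otherwise, e.g. for g=1+√x+x² (q=0), ψ(u)=inf{x: h(x)≥u} vanishes identically and the hypothesis on ψ(t_k)²/√(nψ'(t_k)) is 0/0. It is automatic for h in R_∞. *)

theory Defs
  imports "HOL-Probability.Probability"
begin

section \<open>Regularity classes\<close>

text \<open>For \<open>h = g'\<close> the infimum ranges over the open half-line because \<open>g\<close> need not be
  differentiable at \<open>0\<close>. If \<open>h\<close> were unbounded above near a finite point, \<open>gen_inverse h\<close> would
  stay bounded at infinity and say nothing about the growth of \<open>h\<close>; functions \<open>h\<close> are therefore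
  required to be bounded above on bounded sets. Members of \<open>R_infinity\<close> are so automatically;
  membership in \<open>R_beta\<close> only constrains \<open>h\<close> near infinity.\<close>

definition gen_inverse :: "(real \<Rightarrow> real) \<Rightarrow> real \<Rightarrow> real" where
  "gen_inverse h u = Inf {x. 0 < x \<and> u \<le> h x}"

text \<open>\<open>l \<in> R\<^sub>0\<close> with the function \<open>e\<close>; \<open>e'\<close> and \<open>e''\<close> are its first two derivatives on
  \<open>[1, \<infinity>)\<close>, one-sided at the endpoint.\<close>

definition R0_with ::
  "(real \<Rightarrow> real) \<Rightarrow> (real \<Rightarrow> real) \<Rightarrow> (real \<Rightarrow> real) \<Rightarrow> (real \<Rightarrow> real) \<Rightarrow> bool" where
  "R0_with l e e' e'' \<longleftrightarrow>
     (\<forall>x\<ge>1. (e has_real_derivative e' x) (at x within {1..})) \<and>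
     (\<forall>x\<ge>1. (e' has_real_derivative e'' x) (at x within {1..})) \<and>
     (e \<longlongrightarrow> 0) at_top \<and>
     (\<forall>x\<ge>1. l x = exp (integral {1..x} (\<lambda>u. e u / u)))"

definition R_beta :: "real \<Rightarrow> (real \<Rightarrow> real) set" where
  "R_beta \<beta> = {h. \<exists>l e e' e''. R0_with l e e' e'' \<and>
     (\<forall>\<^sub>F x in at_top. h x = x powr \<beta> * l x) \<and>
     Limsup at_top (\<lambda>x. ereal (x * \<bar>e' x\<bar>)) < \<infinity> \<and>
     Limsup at_top (\<lambda>x. ereal (x\<^sup>2 * \<bar>e'' x\<bar>)) < \<infinity>}"

definition R0_tilde :: "(real \<Rightarrow> real) set" where
  "R0_tilde = {l. \<exists>e e' e''. R0_with l e e' e'' \<and>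
     filterlim l at_top at_top \<and>
     ((\<lambda>x. x * e' x / e x) \<longlongrightarrow> 0) at_top \<and>
     ((\<lambda>x. x\<^sup>2 * e'' x / e x) \<longlongrightarrow> 0) at_top \<and>
     (\<exists>\<eta>\<in>{0<..<1/4}. Liminf at_top (\<lambda>x. ereal (x powr \<eta> * e x)) > 0)}"

definition R_infinity :: "(real \<Rightarrow> real) set" where
  "R_infinity = {h. strict_mono_on {0<..} h \<and> gen_inverse h \<in> R0_tilde}"

definition R_class :: "(real \<Rightarrow> real) set" where
  "R_class = (\<Union>\<beta>\<in>{0<..}. R_beta \<beta>) \<union> R_infinity"

section \<open>Tilted densities\<close>

definition mgf :: "(real \<Rightarrow> real) \<Rightarrow> real \<Rightarrow> real" where
  "mgf p t = (LINT x:{0..}|lborel. exp (t * x) * p x)"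

definition tilted_mean :: "(real \<Rightarrow> real) \<Rightarrow> real \<Rightarrow> real" where
  "tilted_mean p t = deriv (\<lambda>s. ln (mgf p s)) t"

definition tilt :: "(real \<Rightarrow> real) \<Rightarrow> real \<Rightarrow> real" where
  "tilt p a = (THE t. tilted_mean p t = a)"

definition tilted_density :: "(real \<Rightarrow> real) \<Rightarrow> real \<Rightarrow> real \<Rightarrow> real" where
  "tilted_density p a x = exp (tilt p a * x) * p x / mgf p (tilt p a)"

definition residual_mean :: "(nat \<Rightarrow> real) \<Rightarrow> (nat \<Rightarrow> real) \<Rightarrow> nat \<Rightarrow> nat \<Rightarrow> real" where
  "residual_mean a y n i = (real n * a n - (\<Sum>j=1..i. y j)) / (real n - real i)"

section \<open>Conditional density given the sum\<close>

text \<open>The continuous version of the Lebesgue density of a real random variable. Sums of at least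
  two independent variables with a common bounded density have such a version.\<close>

definition cont_density :: "'a measure \<Rightarrow> ('a \<Rightarrow> real) \<Rightarrow> real \<Rightarrow> real" where
  "cont_density M Y = (THE f. continuous_on UNIV f \<and> (\<forall>x. 0 \<le> f x) \<and>
     distributed M lborel Y (\<lambda>x. ennreal (f x)))"

text \<open>The version of the joint density of \<open>((X\<^sub>1, \<dots>, X\<^sub>k), S\<^sub>n)\<close> determined by the given version
  \<open>p\<close> of the density of the \<open>X\<^sub>i\<close> and the continuous version for \<open>X\<^sub>k\<^sub>+\<^sub>1 + \<dots> + X\<^sub>n\<close>; that it is
  a joint density is the lemma \<open>distributed_joint_density\<close> below. Fixing versions is necessary
  because the conditional density is evaluated at a single point, where \<open>p\<close> need not be
  continuous.\<close>

definition joint_density ::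
  "'a measure \<Rightarrow> (nat \<Rightarrow> 'a \<Rightarrow> real) \<Rightarrow> (real \<Rightarrow> real) \<Rightarrow> nat \<Rightarrow> nat \<Rightarrow> (nat \<Rightarrow> real) \<Rightarrow> real \<Rightarrow> real" where
  "joint_density M X p k n y s =
     (\<Prod>i=1..k. p (y i)) * cont_density M (\<lambda>\<omega>. \<Sum>i=k+1..n. X i \<omega>) (s - (\<Sum>i=1..k. y i))"

definition cond_density ::
  "'a measure \<Rightarrow> (nat \<Rightarrow> 'a \<Rightarrow> real) \<Rightarrow> (real \<Rightarrow> real) \<Rightarrow> nat \<Rightarrow> nat \<Rightarrow> (nat \<Rightarrow> real) \<Rightarrow> real \<Rightarrow> real" where
  "cond_density M X p k n y s =
     joint_density M X p k n y s / cont_density M (\<lambda>\<omega>. \<Sum>i=1..n. X i \<omega>) s"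

lemma cont_density_eq:
  assumes M: "prob_space M"
    and f: "continuous_on UNIV f" "\<And>x. 0 \<le> f x"
      "distributed M lborel Y (\<lambda>x. ennreal (f x))"
  shows "cont_density M Y = f"
  unfolding cont_density_def
proof (rule the_equality)
  show "continuous_on UNIV f \<and> (\<forall>x. 0 \<le> f x) \<and> distributed M lborel Y (\<lambda>x. ennreal (f x))"
    using f by blast
next
  interpret prob_space M by (rule M)
  fix g assume g: "continuous_on UNIV g \<and> (\<forall>x. 0 \<le> g x) \<and>
    distributed M lborel Y (\<lambda>x. ennreal (g x))"
  have "AE x in lborel. ennreal (g x) = ennreal (f x)"
    by (rule distributed_unique[of lborel Y]) (use f g in auto)
  then have "AE x in lborel. g x = f x"
    using f(2) g by (auto simp: ennreal_inj)
  then have "AE x in lebesgue. x \<notin> {x. g x - f x \<noteq> 0}"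
    by (simp add: AE_completion)
  moreover have op: "open {x. g x - f x \<noteq> 0}"
    by (intro open_Collect_neq continuous_on_diff) (use f g in auto)
  ultimately have "negligible {x. g x - f x \<noteq> 0}"
    using AE_iff_null_sets[of "{x. g x - f x \<noteq> 0}" lebesgue] negligible_iff_null_sets
    by (metis AE_completion borel_open sets_completionI_sets sets_lborel)
  then have "{x. g x - f x \<noteq> 0} = {}"
    using op open_not_negligible by blast
  then show "g = f" by auto
qed

lemma distributed_joint_density:
  assumes M: "prob_space M" and k: "1 \<le> k" "k \<le> n"
    and ind: "prob_space.indep_vars M (\<lambda>_. borel) X {1..}"
    and X: "\<And>i. 1 \<le> i \<Longrightarrow> distributed M lborel (X i) (\<lambda>x. ennreal (p x))"
    and p: "\<And>x. 0 \<le> p x"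
    and f: "continuous_on UNIV f" "\<And>x. 0 \<le> f x"
      "distributed M lborel (\<lambda>\<omega>. \<Sum>i=k+1..n. X i \<omega>) (\<lambda>x. ennreal (f x))"
  shows "distributed M (Pi\<^sub>M {1..k} (\<lambda>_. lborel) \<Otimes>\<^sub>M lborel)
    (\<lambda>\<omega>. (\<lambda>i\<in>{1..k}. X i \<omega>, \<Sum>i=1..n. X i \<omega>))
    (\<lambda>(y, s). ennreal (joint_density M X p k n y s))"
proof -
  interpret prob_space M by (rule M)
  interpret P: product_sigma_finite "\<lambda>_::nat. lborel :: real measure" ..
  interpret PF: finite_product_sigma_finite "\<lambda>_::nat. lborel :: real measure" "{1..k}"
    by standard simp
  let ?L = "Pi\<^sub>M {1..k} (\<lambda>_. lborel :: real measure)"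
  let ?V = "\<lambda>\<omega>. \<lambda>i\<in>{1..k}. X i \<omega>"
  let ?T = "\<lambda>\<omega>. \<Sum>i=k+1..n. X i \<omega>"
  let ?pp = "\<lambda>y. \<Prod>i=1..k. ennreal (p (y i))"
  let ?sh = "\<lambda>(y :: nat \<Rightarrow> real, t). (y, t + (\<Sum>i=1..k. y i))"
  have rv: "random_variable borel (X i)" if "1 \<le> i" for i
    using X[OF that] by (auto simp: distributed_def)
  have p_meas [measurable]: "(\<lambda>x. ennreal (p x)) \<in> borel_measurable borel"
    using X[of 1] by (auto simp: distributed_def)
  have f_meas [measurable]: "f \<in> borel_measurable borel"
    using f(1) by (rule borel_measurable_continuous_onI)
  have sets_L: "sets ?L = sets (Pi\<^sub>M {1..k} (\<lambda>_. borel))"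
    by (rule sets_PiM_cong) auto
  have V_meas: "?V \<in> measurable M ?L"
    by (rule measurable_restrict) (use rv in auto)
  have pp_meas [measurable]: "?pp \<in> borel_measurable ?L"
    by measurable
  have sum_meas [measurable]: "(\<lambda>y. \<Sum>i=1..k. y i) \<in> borel_measurable ?L"
    by measurable
  have dV: "distributed M ?L ?V ?pp"
  proof -
    have "indep_vars (\<lambda>_. borel) X {1..k}"
      by (rule indep_vars_subset[OF ind]) auto
    then have 1: "distr M (Pi\<^sub>M {1..k} (\<lambda>_. borel)) ?V = Pi\<^sub>M {1..k} (\<lambda>i. distr M borel (X i))"
      using k rv by (subst indep_vars_iff_distr_eq_PiM'[symmetric]) auto
    have "Pi\<^sub>M {1..k} (\<lambda>i. distr M borel (X i)) = Pi\<^sub>M {1..k} (\<lambda>_. density lborel (\<lambda>x. ennreal (p x)))"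
    proof (rule PiM_cong)
      fix i assume "i \<in> {1..k}"
      then have "distr M lborel (X i) = density lborel (\<lambda>x. ennreal (p x))"
        using X by (auto simp: distributed_def)
      then show "distr M borel (X i) = density lborel (\<lambda>x. ennreal (p x))"
        by (metis distr_cong sets_lborel)
    qed simp
    also have "\<dots> = density ?L ?pp"
    proof -
      have "prob_space (density lborel (\<lambda>x. ennreal (p x)))"
        using X[of 1] prob_space_distr[of "X 1" lborel] by (auto simp: distributed_def)
      then interpret D: product_prob_space "\<lambda>_::nat. density lborel (\<lambda>x. ennreal (p x))"
        by (unfold_locales) (auto simp: prob_space_def prob_space_axioms_def finite_measure_def
            finite_measure_axioms_def sigma_finite_measure_def)
      show ?thesis
      proof (rule D.PiM_eqI[symmetric])
        show "sets (density ?L ?pp) = sets (Pi\<^sub>M {1..k} (\<lambda>_. density lborel (\<lambda>x. ennreal (p x))))"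
          by (simp, rule sets_PiM_cong) auto
        fix A assume A: "\<And>i. i \<in> {1..k} \<Longrightarrow> A i \<in> sets (density lborel (\<lambda>x. ennreal (p x)))"
        then have A': "\<And>i. i \<in> {1..k} \<Longrightarrow> A i \<in> sets lborel" by simp
        have AE: "Pi\<^sub>E {1..k} A \<in> sets ?L"
          by (rule sets_PiM_I_finite) (use A' in auto)
        have ind_eq: "indicator (Pi\<^sub>E {1..k} A) y = (\<Prod>i=1..k. indicator (A i) (y i) :: ennreal)"
          if "y \<in> space ?L" for y
        proof (cases "\<forall>i\<in>{1..k}. y i \<in> A i")
          case True
          then show ?thesis using that by (auto simp: space_PiM indicator_def PiE_iff)
        next
          case False
          then show ?thesis by (auto simp: indicator_def PiE_iff intro!: prod_zero)
        qed
        have "emeasure (density ?L ?pp) (Pi\<^sub>E {1..k} A)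
            = (\<integral>\<^sup>+ y. ?pp y * indicator (Pi\<^sub>E {1..k} A) y \<partial>?L)"
          by (rule emeasure_density[OF pp_meas AE])
        also have "\<dots> = (\<integral>\<^sup>+ y. (\<Prod>i=1..k. ennreal (p (y i)) * indicator (A i) (y i)) \<partial>?L)"
          by (rule nn_integral_cong) (simp only: ind_eq prod.distrib)
        also have "\<dots> = (\<Prod>i=1..k. \<integral>\<^sup>+ x. ennreal (p x) * indicator (A i) x \<partial>lborel)"
          by (rule P.product_nn_integral_prod) (use A' in auto)
        also have "\<dots> = (\<Prod>i=1..k. emeasure (density lborel (\<lambda>x. ennreal (p x))) (A i))"
          by (rule prod.cong[OF refl]) (use A' in \<open>auto simp: emeasure_density\<close>)
        finally show "emeasure (density ?L ?pp) (Pi\<^sub>E {1..k} A)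
            = (\<Prod>i=1..k. emeasure (density lborel (\<lambda>x. ennreal (p x))) (A i))" .
      qed simp
    qed
    finally have "distr M ?L ?V = density ?L ?pp"
      using 1 sets_L by (metis distr_cong)
    then show ?thesis
      using V_meas pp_meas by (auto simp: distributed_def)
  qed
  let ?W = "\<lambda>\<omega>. \<lambda>i\<in>{k+1..n}. X i \<omega>"
  let ?B = "\<lambda>I :: nat set. Pi\<^sub>M I (\<lambda>_. borel :: real measure)"
  have W_meas [measurable]: "?W \<in> measurable M (?B {k+1..n})"
    by (rule measurable_restrict) (use rv in auto)
  have V_meas' [measurable]: "?V \<in> measurable M (?B {1..k})"
    by (rule measurable_restrict) (use rv in auto)
  have T_meas: "?T \<in> measurable M lborel"
    using f(3) by (auto simp: distributed_def)
  have idL [measurable]: "(\<lambda>v. v) \<in> measurable (?B {1..k}) ?L"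
    by (rule measurable_ident_sets) (use sets_L in simp)
  have sumW [measurable]: "(\<lambda>w. \<Sum>i=k+1..n. w i) \<in> measurable (?B {k+1..n}) lborel"
    by (auto intro!: borel_measurable_sum measurable_component_singleton)
  have "distr M (?B {1..k}) ?V \<Otimes>\<^sub>M distr M (?B {k+1..n}) ?W
      = distr M (?B {1..k} \<Otimes>\<^sub>M ?B {k+1..n}) (\<lambda>\<omega>. (?V \<omega>, ?W \<omega>))"
  proof -
    have "indep_var (?B {1..k}) ?V (?B {k+1..n}) ?W"
      by (rule indep_var_restrict[OF ind]) auto
    then show ?thesis by (simp add: indep_var_distribution_eq)
  qed
  moreover have dT: "distr M lborel ?T = distr (distr M (?B {k+1..n}) ?W) lborel (\<lambda>w. \<Sum>i=k+1..n. w i)"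
    by (subst distr_distr[OF sumW W_meas]) (simp add: comp_def)
  moreover have "distr M ?L ?V = distr (distr M (?B {1..k}) ?V) ?L (\<lambda>v. v)"
    by (subst distr_distr[OF idL V_meas']) (simp add: comp_def)
  moreover have "sigma_finite_measure (distr M lborel ?T)"
    using prob_space_distr[OF T_meas] by (simp add: prob_space_imp_sigma_finite)
  ultimately have "distr M ?L ?V \<Otimes>\<^sub>M distr M lborel ?T
      = distr (distr M (?B {1..k} \<Otimes>\<^sub>M ?B {k+1..n}) (\<lambda>\<omega>. (?V \<omega>, ?W \<omega>))) (?L \<Otimes>\<^sub>M lborel)
          (\<lambda>(v, w). (v, \<Sum>i=k+1..n. w i))"
    using pair_measure_distr[of "\<lambda>v. v" "distr M (?B {1..k}) ?V" ?L
        "\<lambda>w. \<Sum>i=k+1..n. w i" "distr M (?B {k+1..n}) ?W" lborel] idL sumW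
    by (simp add: measurable_def)
  also have "\<dots> = distr M (?L \<Otimes>\<^sub>M lborel) (\<lambda>\<omega>. (?V \<omega>, ?T \<omega>))"
  proof -
    have "(\<lambda>(v, w). (v, \<Sum>i=k+1..n. w i)) \<in>
        measurable (?B {1..k} \<Otimes>\<^sub>M ?B {k+1..n}) (?L \<Otimes>\<^sub>M lborel)"
      unfolding split_beta'
      by (intro measurable_Pair measurable_compose[OF measurable_fst idL]
          measurable_compose[OF measurable_snd sumW])
    moreover have "(\<lambda>\<omega>. (?V \<omega>, ?W \<omega>)) \<in> measurable M (?B {1..k} \<Otimes>\<^sub>M ?B {k+1..n})"
      by (rule measurable_Pair[OF V_meas' W_meas])
    ultimately show ?thesis by (subst distr_distr) (auto simp: comp_def)
  qed
  finally have dVT: "distributed M (?L \<Otimes>\<^sub>M lborel) (\<lambda>\<omega>. (?V \<omega>, ?T \<omega>)) (\<lambda>(y, t). ?pp y * ennreal (f t))"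
    by (rule distributed_joint_indep'[OF PF.sigma_finite_measure_axioms
          lborel.sigma_finite_measure_axioms dV f(3)])
  have jd: "ennreal (joint_density M X p k n y s) = ?pp y * ennreal (f (s - (\<Sum>i=1..k. y i)))" for y s
    unfolding joint_density_def cont_density_eq[OF M f]
    by (simp add: ennreal_mult prod_nonneg p f(2) prod_ennreal)
  have sum_fst [measurable]:
    "(\<lambda>z. \<Sum>i=1..k. fst z i) \<in> borel_measurable (?L \<Otimes>\<^sub>M (lborel :: real measure))"
    by (rule measurable_compose[OF measurable_fst sum_meas])
  have pp_fst [measurable]: "(\<lambda>z. ?pp (fst z)) \<in> borel_measurable (?L \<Otimes>\<^sub>M (lborel :: real measure))"
    by (rule measurable_compose[OF measurable_fst pp_meas])
  have "(\<lambda>z. snd z + (\<Sum>i=1..k. fst z i)) \<in> borel_measurable (?L \<Otimes>\<^sub>M (lborel :: real measure))"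
    by (rule borel_measurable_add[OF _ sum_fst]) simp
  then have sh_meas [measurable]: "?sh \<in> measurable (?L \<Otimes>\<^sub>M lborel) (?L \<Otimes>\<^sub>M lborel)"
    unfolding split_beta' by (intro measurable_Pair measurable_fst) simp
  have VS: "(\<lambda>\<omega>. (?V \<omega>, \<Sum>i=1..n. X i \<omega>)) = ?sh \<circ> (\<lambda>\<omega>. (?V \<omega>, ?T \<omega>))"
  proof
    fix \<omega>
    have "(\<Sum>i=1..n. X i \<omega>) = (\<Sum>i=1..k. X i \<omega>) + (\<Sum>i=k+1..n. X i \<omega>)"
      using k sum.ub_add_nat[of 1 k "\<lambda>i. X i \<omega>" "n - k"] by simp
    then show "(?V \<omega>, \<Sum>i=1..n. X i \<omega>) = (?sh \<circ> (\<lambda>\<omega>. (?V \<omega>, ?T \<omega>))) \<omega>" by simp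
  qed
  have VT_meas: "(\<lambda>\<omega>. (?V \<omega>, ?T \<omega>)) \<in> measurable M (?L \<Otimes>\<^sub>M lborel)"
    by (rule distributed_measurable[OF dVT])
  show ?thesis
    unfolding distributed_def
  proof (intro conjI)
    show VS_meas: "(\<lambda>\<omega>. (?V \<omega>, \<Sum>i=1..n. X i \<omega>)) \<in> measurable M (?L \<Otimes>\<^sub>M lborel)"
      unfolding VS by (rule measurable_comp[OF VT_meas sh_meas])
    show jm: "(\<lambda>(y, s). ennreal (joint_density M X p k n y s)) \<in> borel_measurable (?L \<Otimes>\<^sub>M lborel)"
    proof -
      have "(\<lambda>z. f (snd z - (\<Sum>i=1..k. fst z i))) \<in> borel_measurable (?L \<Otimes>\<^sub>M lborel)"
        by (intro measurable_compose[OF _ f_meas] borel_measurable_diff sum_fst) simp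
      then have "(\<lambda>z. ennreal (f (snd z - (\<Sum>i=1..k. fst z i)))) \<in> borel_measurable (?L \<Otimes>\<^sub>M lborel)"
        by (rule measurable_compose[OF _ measurable_ennreal])
      then show ?thesis
        unfolding jd split_beta' by (rule borel_measurable_times_ennreal[OF pp_fst])
    qed
    have "distr M (?L \<Otimes>\<^sub>M lborel) (\<lambda>\<omega>. (?V \<omega>, \<Sum>i=1..n. X i \<omega>))
        = distr (density (?L \<Otimes>\<^sub>M lborel) (\<lambda>(y, t). ?pp y * ennreal (f t))) (?L \<Otimes>\<^sub>M lborel) ?sh"
      unfolding VS distr_distr[OF sh_meas VT_meas, symmetric]
      by (simp only: distributed_distr_eq_density[OF dVT])
    also have "\<dots> = density (?L \<Otimes>\<^sub>M lborel) (\<lambda>(y, s). ennreal (joint_density M X p k n y s))"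
      (is "?D1 = ?D2")
    proof (rule measure_eqI)
      fix A assume "A \<in> sets ?D1"
      then have A [measurable]: "A \<in> sets (?L \<Otimes>\<^sub>M lborel)" by simp
      let ?I = "indicator A :: _ \<Rightarrow> ennreal"
      have F_meas: "(\<lambda>(y, t). ?pp y * ennreal (f t)) \<in> borel_measurable (?L \<Otimes>\<^sub>M lborel)"
        by (rule distributed_borel_measurable[OF dVT])
      have Ish: "(\<lambda>z. ?I (?sh z)) \<in> borel_measurable (?L \<Otimes>\<^sub>M lborel)"
        by (rule measurable_compose[OF sh_meas borel_measurable_indicator[OF A]])
      have JI: "(\<lambda>z. (case z of (y, s) \<Rightarrow> ennreal (joint_density M X p k n y s)) * ?I z)
          \<in> borel_measurable (?L \<Otimes>\<^sub>M lborel)"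
        by (rule borel_measurable_times_ennreal[OF jm borel_measurable_indicator[OF A]])
      have "emeasure ?D1 A = (\<integral>\<^sup>+ z. ?I z \<partial>?D1)"
        using A by simp
      also have "\<dots> = (\<integral>\<^sup>+ z. ?I (?sh z) \<partial>density (?L \<Otimes>\<^sub>M lborel) (\<lambda>(y, t). ?pp y * ennreal (f t)))"
        by (rule nn_integral_distr)
          (simp_all only: measurable_density_eq1 sh_meas measurable_distr_eq1 borel_measurable_indicator[OF A])
      also have "\<dots> = (\<integral>\<^sup>+ z. (case z of (y, t) \<Rightarrow> ?pp y * ennreal (f t)) * ?I (?sh z) \<partial>(?L \<Otimes>\<^sub>M lborel))"
        by (rule nn_integral_density[OF F_meas Ish])
      also have "\<dots> = (\<integral>\<^sup>+ y. \<integral>\<^sup>+ t. (case (y, t) of (y, t) \<Rightarrow> ?pp y * ennreal (f t)) * ?I (?sh (y, t)) \<partial>lborel \<partial>?L)"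
        by (rule lborel.nn_integral_fst[symmetric])
          (rule borel_measurable_times_ennreal[OF F_meas Ish])
      also have "\<dots> = (\<integral>\<^sup>+ y. \<integral>\<^sup>+ s. (case (y, s) of (y, s) \<Rightarrow> ennreal (joint_density M X p k n y s)) * ?I (y, s) \<partial>lborel \<partial>?L)"
      proof (rule nn_integral_cong)
        fix y assume y: "y \<in> space ?L"
        let ?G = "\<lambda>s. (case (y, s) of (y, s) \<Rightarrow> ennreal (joint_density M X p k n y s)) * ?I (y, s)"
        have "?G \<in> borel_measurable lborel"
          by (rule measurable_compose[OF measurable_Pair1'[OF y] JI])
        then have "(\<integral>\<^sup>+ s. ?G s \<partial>lborel) = (\<integral>\<^sup>+ t. ?G ((\<Sum>i=1..k. y i) + t) \<partial>lborel)"
          by (subst nn_integral_real_affine[of _ 1 "\<Sum>i=1..k. y i"]) simp_all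
        also have "\<dots> = (\<integral>\<^sup>+ t. (case (y, t) of (y, t) \<Rightarrow> ?pp y * ennreal (f t)) * ?I (?sh (y, t)) \<partial>lborel)"
          by (simp only: prod.case jd add_diff_cancel_left' add_diff_cancel_right' add.commute)
        finally show "(\<integral>\<^sup>+ t. (case (y, t) of (y, t) \<Rightarrow> ?pp y * ennreal (f t)) * ?I (?sh (y, t)) \<partial>lborel)
          = (\<integral>\<^sup>+ s. ?G s \<partial>lborel)" ..
      qed
      also have "\<dots> = (\<integral>\<^sup>+ z. (case z of (y, s) \<Rightarrow> ennreal (joint_density M X p k n y s)) * ?I z \<partial>(?L \<Otimes>\<^sub>M lborel))"
        by (rule lborel.nn_integral_fst[OF JI])
      also have "\<dots> = emeasure ?D2 A"
        by (rule emeasure_density[OF jm A, symmetric])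
      finally show "emeasure ?D1 A = emeasure ?D2 A" .
    qed simp
    finally show "distr M (?L \<Otimes>\<^sub>M lborel) (\<lambda>\<omega>. (?V \<omega>, \<Sum>i=1..n. X i \<omega>))
        = density (?L \<Otimes>\<^sub>M lborel) (\<lambda>(y, s). ennreal (joint_density M X p k n y s))" .
  qed
qed

end

theory Submission
  imports Defs
begin

text \<open>Tilting by \<open>t = t\<^sub>k\<close>, the conditional density is the product of the
  \<open>exp (t y\<^sub>i) p (y\<^sub>i) / \<Phi>(t)\<close> times the ratio of the tilted densities of \<open>S\<^sub>n - S\<^sub>k\<close> and
  \<open>S\<^sub>n\<close>, the first at its mean and the second close to its mean on the scale
  \<open>sqrt (n \<psi>'(t))\<close>. By Laplace's method the tilted density, centred at \<open>\<psi>(t)\<close> and scaled by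
  \<open>sqrt (\<psi>'(t))\<close>, converges to the standard normal density under an exponential envelope, so a local
  limit theorem for triangular arrays sends this ratio to \<open>1\<close>. Finally \<open>m\<close> has derivative of order
  \<open>\<psi>'(t)\<close> near \<open>t\<close>, which gives \<open>t\<^sub>i - t\<^sub>k = O(m\<^sub>k / (n \<psi>'(t\<^sub>k)))\<close>; hence
  \<open>m\<^sub>k (t\<^sub>i - t\<^sub>k)\<close> tends to \<open>0\<close> and \<open>t\<^sub>k\<close> may be replaced by \<open>t\<^sub>i\<close> in the \<open>i\<close>-th factor.\<close>

section \<open>Fourier inversion\<close>

text \<open>The obstacle is that \<open>p\<close> is bounded but not smooth, so a tilted
  characteristic function need not be integrable. It is square integrable, with an L2 bound
  proportional to the supremum of the density. Of the N factors of a power, two are spent on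
  integrability and N - 2 on decay. This yields pointwise inversion for sums of at least two terms,
  and tail control that the envelope makes uniform in n. The Laplace centre \<psi>(t) misses the
  tilted mean by o(sqrt(\<psi>'(t))), an error that n summands would amplify; the limit theorem
  therefore centres at the exact mean. Using one t for both sums makes exponentials and powers of
  the mgf cancel exactly, so no asymptotics of the mgf are needed. What the two regularity classes
  share is that \<psi>' is nearly constant under small relative changes of t and that t^2 \<psi>'(t)
  tends to infinity, so that the window of radius 1/sqrt(\<psi>'(t)) about t is short compared with
  t. The growth hypothesis makes m_k/sqrt(n \<psi>'(t_k)) vanish: this quantity measures how far the
  target of S_n is off its tilted mean, and its square bounds m_k (t_i - t_k).\<close>

definition inverse_char :: "(real \<Rightarrow> complex) \<Rightarrow> real \<Rightarrow> real" where
  "inverse_char \<phi> x = Re (LINT t|lborel. iexp (- (t * x)) * \<phi> t) / (2 * pi)"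

lemma integrable_iexp_mult:
  fixes \<phi> :: "real \<Rightarrow> complex" and f :: "real \<Rightarrow> real"
  assumes "integrable lborel \<phi>" "f \<in> borel_measurable borel"
  shows "integrable lborel (\<lambda>t. iexp (f t) * \<phi> t)"
proof (rule Bochner_Integration.integrable_bound[OF assms(1)])
  show "(\<lambda>t. iexp (f t) * \<phi> t) \<in> borel_measurable lborel"
    using assms by (auto intro!: borel_measurable_times borel_measurable_exp)
qed (auto simp: norm_mult)

lemma continuous_on_inverse_char:
  assumes \<phi>: "integrable lborel \<phi>"
  shows "continuous_on UNIV (inverse_char \<phi>)"
proof -
  have "isCont (\<lambda>x. LINT t|lborel. iexp (- (t * x)) * \<phi> t) x" for x
    unfolding continuous_at_sequentially comp_def
  proof (intro allI impI)
    fix u :: "nat \<Rightarrow> real" assume u: "u \<longlonglongrightarrow> x"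
    show "(\<lambda>n. LINT t|lborel. iexp (- (t * u n)) * \<phi> t) \<longlonglongrightarrow> (LINT t|lborel. iexp (- (t * x)) * \<phi> t)"
    proof (rule integral_dominated_convergence[where w = "\<lambda>t. norm (\<phi> t)"])
      show "AE t in lborel. (\<lambda>n. iexp (- (t * u n)) * \<phi> t) \<longlonglongrightarrow> iexp (- (t * x)) * \<phi> t"
        by (intro AE_I2 tendsto_intros u)
    qed (use \<phi> in \<open>auto simp: norm_mult intro!: borel_measurable_integrable integrable_iexp_mult\<close>)
  qed
  then show ?thesis
    unfolding inverse_char_def by (intro continuous_intros continuous_at_imp_continuous_on ballI) auto
qed

text \<open>The quotient is the kernel of Levy's inversion formula. Written as an integral over
  \<open>{a..b}\<close>, it lets Fubini turn that formula into an integral of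
  \<open>inverse_char\<close>.\<close>

lemma iexp_difference_quotient:
  assumes "a \<le> b" "t \<noteq> 0"
  shows "(LINT x:{a..b}|lborel. iexp (- (t * x))) = (iexp (- (t * a)) - iexp (- (t * b))) / (\<i> * t)"
proof -
  let ?F = "\<lambda>x. - iexp (- (t * x)) / (\<i> * t)"
  have "has_bochner_integral lborel (\<lambda>x. indicator {a..b} x *\<^sub>R iexp (- (t * x))) (?F b - ?F a)"
  proof (rule has_bochner_integral_FTC_Icc[OF assms(1)])
    fix x
    have "((\<lambda>x. - (t * x)) has_vector_derivative - t) (at x within {a..b})"
      by (auto intro!: derivative_eq_intros has_real_derivative_iff_has_vector_derivative[THEN iffD1])
    from vector_diff_chain_within[OF this has_vector_derivative_iexp]
    have "((\<lambda>x. iexp (- (t * x))) has_vector_derivative (- t) *\<^sub>R (\<i> * iexp (- (t * x)))) (at x within {a..b})"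
      by (simp add: comp_def)
    from has_vector_derivative_mult_right[OF this, of "- 1 / (\<i> * t)"]
    show "(?F has_vector_derivative iexp (- (t * x))) (at x within {a..b})"
      using assms(2) by (simp add: scaleR_conv_of_real)
  qed (intro continuous_intros)
  then show ?thesis
    unfolding set_lebesgue_integral_def
    by (simp add: has_bochner_integral_integral_eq diff_divide_distrib)
qed

section \<open>Laws with integrable characteristic function\<close>

context real_distribution
begin

text \<open>Levy's formula is a limit of truncated integrals and needs endpoints without mass. Its
  kernel is bounded by \<open>b - a\<close>, so integrability of the characteristic function removes
  the truncation by dominated convergence; then the kernel is expanded and the integrals are
  exchanged.\<close>

lemma interval_measure_eq_integral_inverse_char:
  assumes \<phi>: "integrable lborel (char M)" and ab: "a \<le> b" "measure M {a} = 0" "measure M {b} = 0"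
  shows "measure M {a<..b} = (LINT x:{a..b}|lborel. inverse_char (char M) x)"
proof -
  let ?G = "\<lambda>t x. indicator {a..b} x *\<^sub>R (iexp (- (t * x)) * char M t)"
  let ?F = "\<lambda>t. (iexp (- (t * a)) - iexp (- (t * b))) / (\<i> * t)"
  have Fb: "norm (?F t) \<le> b - a" for t :: real
    using Levy_Inversion_aux2[of "- b" "- a" t] ab(1) by (cases "t = 0") auto
  have intF: "integrable lborel (\<lambda>t. ?F t * char M t)"
  proof (rule Bochner_Integration.integrable_bound)
    show "integrable lborel (\<lambda>t. (b - a) * norm (char M t))"
      using \<phi> by simp
    show "AE t in lborel. norm (?F t * char M t) \<le> norm ((b - a) * norm (char M t))"
      unfolding norm_mult using Fb ab(1) by (intro AE_I2) (auto intro!: mult_right_mono)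
  qed measurable
  have "(\<lambda>T :: nat. CLBINT t=-T..T. ?F t * char M t) \<longlonglongrightarrow> (LINT t|lborel. ?F t * char M t)"
  proof -
    have "(\<lambda>T::nat. LINT t|lborel. indicator {-real T<..<real T} t *\<^sub>R (?F t * char M t))
        \<longlonglongrightarrow> (LINT t|lborel. ?F t * char M t)"
    proof (rule integral_dominated_convergence[where w = "\<lambda>t. norm (?F t * char M t)"])
      show "AE t in lborel. (\<lambda>T::nat. indicator {-real T<..<real T} t *\<^sub>R (?F t * char M t)) \<longlonglongrightarrow> ?F t * char M t"
      proof (rule AE_I2)
        fix t :: real
        obtain K :: nat where K: "\<bar>t\<bar> < real K" using reals_Archimedean2 by blast
        have "\<forall>\<^sub>F T::nat in sequentially. indicator {-real T<..<real T} t *\<^sub>R (?F t * char M t) = ?F t * char M t"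
          using eventually_ge_at_top[of K] by eventually_elim (use K in \<open>auto simp: indicator_def\<close>)
        then show "(\<lambda>T::nat. indicator {-real T<..<real T} t *\<^sub>R (?F t * char M t)) \<longlonglongrightarrow> ?F t * char M t"
          by (rule tendsto_eventually)
      qed
      show "AE t in lborel. norm (indicator {- real T<..<real T} t *\<^sub>R (?F t * char M t)) \<le> norm (?F t * char M t)" for T
        by (intro AE_I2) (auto simp: indicator_def)
    qed (use intF in \<open>auto intro!: integrable_norm\<close>)
    then show ?thesis
      by (simp add: interval_lebesgue_integral_def set_lebesgue_integral_def)
  qed
  from tendsto_mult_left[OF this, of "1 / (2 * pi)"]
  have 1: "complex_of_real (measure M {a<..b}) = 1 / (2 * pi) * (LINT t|lborel. ?F t * char M t)"
    using Levy_Inversion[OF ab] by (auto intro: LIMSEQ_unique)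
  have int2: "integrable (lborel \<Otimes>\<^sub>M lborel) (\<lambda>(t, x). ?G t x)"
  proof -
    have meas: "(\<lambda>(t, x). ?G t x) \<in> borel_measurable (lborel \<Otimes>\<^sub>M lborel)"
      unfolding split_beta'
      by (auto intro!: borel_measurable_scaleR borel_measurable_times borel_measurable_exp
          measurable_compose[OF measurable_fst char_measurable] borel_measurable_indicator' simp: measurable_split_conv)
    have norm: "(LINT x|lborel. norm (case (t, x) of (t, x) \<Rightarrow> ?G t x))
        = (b - a) * norm (char M t)" for t
      using ab(1) by (simp add: norm_mult)
    show ?thesis
    proof (rule lborel_pair.Fubini_integrable[OF meas])
      show "integrable lborel (\<lambda>t. LINT x|lborel. norm (case (t, x) of (t, x) \<Rightarrow> ?G t x))"
        unfolding norm using \<phi> by simp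
      have "set_integrable lborel {a..b} (\<lambda>x. iexp (- (t * x)) * char M t)" for t
        by (intro borel_integrable_atLeastAtMost' continuous_intros)
      then show "AE t in lborel. integrable lborel (\<lambda>x. case (t, x) of (t, x) \<Rightarrow> ?G t x)"
        by (auto simp: set_integrable_def)
    qed
  qed
  have "(LINT t|lborel. ?F t * char M t) =
      (LINT t|lborel. LINT x|lborel. ?G t x)"
  proof (rule integral_cong_AE)
    show "(\<lambda>t. LINT x|lborel. ?G t x) \<in> borel_measurable lborel"
      using lborel.borel_measurable_lebesgue_integral[of "\<lambda>t x. ?G t x"]
        borel_measurable_integrable[OF int2] by simp
    \<comment> \<open>At \<open>t = 0\<close> the quotient is 0 by the convention for division,
      while the integral of the exponential is \<open>b - a\<close>; this point is
      discarded.\<close>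
    have "AE t in lborel. t \<noteq> (0::real)"
      by (rule AE_lborel_singleton)
    then show "AE t in lborel. ?F t * char M t = (LINT x|lborel. ?G t x)"
    proof eventually_elim
      case (elim t)
      have "(LINT x|lborel. ?G t x) =
        (LINT x:{a..b}|lborel. iexp (- (t * x))) * char M t"
        unfolding set_lebesgue_integral_def by (subst integral_mult_left_zero[symmetric]) simp
      then show ?case using iexp_difference_quotient[OF ab(1) elim] by simp
    qed
  qed measurable
  also have "\<dots> = (LINT x|lborel. LINT t|lborel. ?G t x)"
    by (rule lborel_pair.Fubini_integral[symmetric, OF int2])
  also have "\<dots> = (LINT x|lborel. indicator {a..b} x *\<^sub>R (LINT t|lborel. iexp (- (t * x)) * char M t))"
    by simp
  finally have 2: "(LINT t|lborel. ?F t * char M t) =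
      (LINT x|lborel. indicator {a..b} x *\<^sub>R (LINT t|lborel. iexp (- (t * x)) * char M t))" .
  have int3: "integrable lborel (\<lambda>x. indicator {a..b} x *\<^sub>R (LINT t|lborel. iexp (- (t * x)) * char M t))"
    using lborel_pair.integrable_snd[OF int2] by simp
  have "measure M {a<..b} = Re (LINT t|lborel. ?F t * char M t) / (2 * pi)"
  proof -
    have "complex_of_real (measure M {a<..b}) = complex_of_real (1 / (2 * pi)) * (LINT t|lborel. ?F t * char M t)"
      using 1 by simp
    then have "measure M {a<..b} = Re (complex_of_real (1 / (2 * pi)) * (LINT t|lborel. ?F t * char M t))"
      by (metis Re_complex_of_real)
    then show ?thesis by (simp only: Re_complex_of_real Im_complex_of_real times_complex.sel mult_zero_left) simp
  qed
  also have "\<dots> = (LINT x|lborel. indicator {a..b} x * Re (LINT t|lborel. iexp (- (t * x)) * char M t)) / (2 * pi)"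
    unfolding 2 by (subst integral_Re[OF int3, symmetric]) simp
  also have "\<dots> = (LINT x:{a..b}|lborel. inverse_char (char M) x)"
    unfolding set_lebesgue_integral_def inverse_char_def
    by (subst integral_divide_zero[symmetric]) simp
  finally show ?thesis .
qed

text \<open>Atoms are countable, so every point lies in arbitrarily short intervals with massless
  endpoints. There the interval formula applies and bounds the mass by a constant times the
  length.\<close>

lemma singleton_null_of_integrable_char:
  assumes \<phi>: "integrable lborel (char M)"
  shows "measure M {x} = 0"
proof -
  define C where "C = (LINT t|lborel. norm (char M t)) / (2 * pi)"
  have F: "\<bar>inverse_char (char M) u\<bar> \<le> C" for u
  proof -
    have "\<bar>Re (LINT t|lborel. iexp (- (t * u)) * char M t)\<bar> \<le> (LINT t|lborel. norm (iexp (- (t * u)) * char M t))"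
      by (rule order_trans[OF abs_Re_le_cmod integral_norm_bound])
    also have "\<dots> = (LINT t|lborel. norm (char M t))" by (simp add: norm_mult)
    finally show ?thesis unfolding inverse_char_def C_def by (simp add: divide_right_mono)
  qed
  have C: "0 \<le> C" unfolding C_def by simp
  have non_atom: "\<exists>u. a < u \<and> u < b \<and> measure M {u} = 0" if "a < b" for a b :: real
  proof -
    have "countable {u. measure M {u} \<noteq> 0}" by (rule countable_support)
    then have "\<not> {a<..<b} \<subseteq> {u. measure M {u} \<noteq> 0}"
      using uncountable_open_interval[of a b] that countable_subset by blast
    then show ?thesis by auto
  qed
  have "measure M {x} \<le> e" if "e > 0" for e
  proof -
    \<comment> \<open>The interval used below is shorter than \<open>2 * d\<close>; the summand 1
      avoids a zero denominator.\<close>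
    define d where "d = e / (2 * (C + 1))"
    have d: "d > 0" using C that by (simp add: d_def)
    obtain u where u: "x - d < u" "u < x" "measure M {u} = 0" using non_atom[of "x - d" x] d by auto
    obtain v where v: "x < v" "v < x + d" "measure M {v} = 0" using non_atom[of x "x + d"] d by auto
    have "measure M {x} \<le> measure M {u<..v}"
      by (rule finite_measure_mono) (use u v in auto)
    also have "\<dots> = (LINT w:{u..v}|lborel. inverse_char (char M) w)"
      by (rule interval_measure_eq_integral_inverse_char[OF \<phi>]) (use u v in auto)
    also have "\<dots> \<le> (LINT w:{u..v}|lborel. C)"
    proof (rule set_integral_mono)
      show "set_integrable lborel {u..v} (inverse_char (char M))"
        by (intro borel_integrable_atLeastAtMost' continuous_on_subset[OF continuous_on_inverse_char[OF \<phi>]]) auto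
      show "set_integrable lborel {u..v} (\<lambda>w. C)"
        by (intro borel_integrable_atLeastAtMost' continuous_intros)
    qed (use F abs_le_D1 in blast)
    also have "\<dots> = C * (v - u)"
      using u v by (simp add: set_lebesgue_integral_def)
    also have "\<dots> \<le> C * (2 * d)"
      using u v C by (intro mult_left_mono) auto
    also have "\<dots> \<le> e"
      using C that by (simp add: d_def field_simps)
    finally show ?thesis .
  qed
  then have "measure M {x} \<le> 0" by (rule field_le_epsilon) simp
  then show ?thesis using measure_nonneg[of M "{x}"] by linarith
qed

text \<open>A negative value would persist, by continuity, on a whole interval, which would then
  have negative measure.\<close>

lemma inverse_char_nonneg:
  assumes \<phi>: "integrable lborel (char M)"
  shows "0 \<le> inverse_char (char M) x"
proof (rule ccontr)
  let ?f = "inverse_char (char M)"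
  assume neg: "\<not> 0 \<le> ?f x"
  have cont: "continuous_on UNIV ?f" by (rule continuous_on_inverse_char[OF \<phi>])
  then have "isCont ?f x" by (simp add: continuous_on_eq_continuous_at)
  then obtain d where d: "d > 0" "\<And>y. dist y x < d \<Longrightarrow> dist (?f y) (?f x) < - ?f x / 2"
    using neg unfolding continuous_at_eps_delta by (auto dest: spec[of _ "- ?f x / 2"])
  let ?a = "x - d / 2" and ?b = "x + d / 2"
  have int: "set_integrable lborel {?a..?b} f" if "continuous_on UNIV f" for f :: "real \<Rightarrow> real"
    by (intro borel_integrable_atLeastAtMost' continuous_on_subset[OF that]) auto
  have "0 \<le> measure M {?a<..?b}" by simp
  also have "\<dots> = (LINT w:{?a..?b}|lborel. ?f w)"
    by (rule interval_measure_eq_integral_inverse_char[OF \<phi>])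
      (use d singleton_null_of_integrable_char[OF \<phi>] in auto)
  also have "\<dots> \<le> (LINT w:{?a..?b}|lborel. ?f x / 2)"
  proof (rule set_integral_mono)
    show "?f w \<le> ?f x / 2" if "w \<in> {?a..?b}" for w
    proof -
      have "dist w x < d" using that d(1) by (simp add: dist_real_def abs_less_iff)
      from d(2)[OF this] show ?thesis by (simp add: dist_real_def abs_less_iff)
    qed
  qed (use int cont in auto)
  also have "\<dots> = d * (?f x / 2)"
    using d by (simp add: set_lebesgue_integral_def)
  also have "\<dots> < 0"
    using d neg by (simp add: mult_pos_neg)
  finally show False by simp
qed

text \<open>Half-open intervals are closed under intersection and generate the Borel sets, so
  agreement on them suffices.\<close>

theorem density_inverse_char:
  assumes \<phi>: "integrable lborel (char M)"
  shows "M = density lborel (\<lambda>x. ennreal (inverse_char (char M) x))"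
proof -
  let ?f = "inverse_char (char M)"
  have cont: "continuous_on UNIV ?f" by (rule continuous_on_inverse_char[OF \<phi>])
  have meas [measurable]: "?f \<in> borel_measurable borel"
    using cont by (rule borel_measurable_continuous_onI)
  have eq: "emeasure (density lborel (\<lambda>x. ennreal (?f x))) A = emeasure M A" if A: "A = {a<..b}" for A a b
  proof (cases "a \<le> b")
    case True
    have int: "set_integrable lborel {a..b} ?f"
      by (intro borel_integrable_atLeastAtMost' continuous_on_subset[OF cont]) auto
    have "emeasure (density lborel (\<lambda>x. ennreal (?f x))) A = (\<integral>\<^sup>+x. ennreal (?f x) * indicator {a<..b} x \<partial>lborel)"
      unfolding A by (rule emeasure_density) auto
    also have "\<dots> = (\<integral>\<^sup>+x. ennreal (indicator {a..b} x *\<^sub>R ?f x) \<partial>lborel)"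
    proof (rule nn_integral_cong_AE)
      have "AE x in lborel. x \<noteq> a" by (rule AE_lborel_singleton)
      then show "AE x in lborel. ennreal (?f x) * indicator {a<..b} x = ennreal (indicator {a..b} x *\<^sub>R ?f x)"
        by eventually_elim (auto simp: indicator_def)
    qed
    also have "\<dots> = ennreal (LINT x:{a..b}|lborel. ?f x)"
      unfolding set_lebesgue_integral_def using int inverse_char_nonneg[OF \<phi>]
      by (intro nn_integral_eq_integral) (auto simp: set_integrable_def)
    also have "\<dots> = emeasure M A"
      unfolding A emeasure_eq_measure
      using interval_measure_eq_integral_inverse_char[OF \<phi> True] singleton_null_of_integrable_char[OF \<phi>] by simp
    finally show ?thesis .
  qed (simp add: A)
  have "density lborel (\<lambda>x. ennreal (?f x)) = M"
  proof (rule measure_eqI_generator_eq[where \<Omega> = UNIV and E = "range (\<lambda>(a, b). {a<..b::real})"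
      and A = "\<lambda>n::nat. {- real n<..real n}"])
    show "Int_stable (range (\<lambda>(a, b). {a<..b::real}))"
    proof (rule Int_stableI)
      fix A B assume "A \<in> range (\<lambda>(a, b). {a<..b::real})" "B \<in> range (\<lambda>(a, b). {a<..b::real})"
      then obtain a b c d where "A = {a<..b}" "B = {c<..d}" by auto
      then have "A \<inter> B = (\<lambda>(a, b). {a<..b}) (max a c, min b d)" by auto
      then show "A \<inter> B \<in> range (\<lambda>(a, b). {a<..b::real})" by blast
    qed
    have bs: "sets (borel :: real measure) = sigma_sets UNIV (range (\<lambda>(a, b). {a<..b::real}))"
      by (subst borel_sigma_sets_Ioc) simp
    show "sets M = sigma_sets UNIV (range (\<lambda>(a, b). {a<..b::real}))"
      "sets (density lborel (\<lambda>x. ennreal (?f x))) = sigma_sets UNIV (range (\<lambda>(a, b). {a<..b::real}))"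
      by (simp_all only: bs[symmetric] events_eq_borel sets_density sets_lborel)
    show "range (\<lambda>n::nat. {- real n<..real n}) \<subseteq> range (\<lambda>(a, b). {a<..b::real})"
      by (auto intro!: image_eqI[where x = "(_, _)"])
    show "range (\<lambda>(a, b). {a<..b::real}) \<subseteq> Pow UNIV" by simp
    show "(\<Union>n::nat. {- real n<..real n}) = UNIV"
    proof (intro set_eqI iffI UNIV_I)
      fix x :: real
      obtain K :: nat where "\<bar>x\<bar> < real K" using reals_Archimedean2 by blast
      then show "x \<in> (\<Union>n::nat. {- real n<..real n})" by (auto intro!: exI[of _ K])
    qed
    show "emeasure (density lborel (\<lambda>x. ennreal (?f x))) {- real n<..real n} \<noteq> \<infinity>" for n :: nat
      unfolding eq[OF refl] by simp
    show "emeasure (density lborel (\<lambda>x. ennreal (?f x))) A = emeasure M A"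
      if "A \<in> range (\<lambda>(a, b). {a<..b::real})" for A
      using that by (auto intro: eq)
  qed
  then show ?thesis ..
qed

end

text \<open>A form of Parseval's identity: the squared modulus is the characteristic function times
  its conjugate, that is, a double integral over differences \<open>x - y\<close>, and Fubini moves
  the average over \<open>N\<close> inside. With \<open>N\<close> normal the right side becomes a
  Gaussian kernel.\<close>

lemma integral_cmod_char_sq:
  assumes M: "real_distribution M" and N: "real_distribution N"
  shows "complex_of_real (LINT t|N. (cmod (char M (s * t)))\<^sup>2) = (CLINT y|M. CLINT x|M. char N (s * (x - y)))"
proof -
  interpret M: real_distribution M by fact
  interpret N: real_distribution N by fact
  interpret MN: pair_prob_space M N by unfold_locales
  have setsM [measurable_cong]: "sets M = sets borel" and setsN [measurable_cong]: "sets N = sets borel" by auto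
  have cM [measurable]: "char M \<in> borel_measurable borel" by (rule M.char_measurable)
  have int1: "integrable (M \<Otimes>\<^sub>M N) (\<lambda>(y, t). char M (s * t) * iexp (- (s * t * y)))"
    by (rule MN.P.integrable_const_bound[where B = 1])
      (auto simp: norm_mult M.cmod_char_le_1 split_beta')
  have int2: "integrable (M \<Otimes>\<^sub>M N) (\<lambda>(x, t). iexp (s * t * (x - y)))" for y
    by (rule MN.P.integrable_const_bound[where B = 1]) (auto simp: split_beta')
  have "(cmod (char M (s * t)))\<^sup>2 = (CLINT y|M. char M (s * t) * iexp (- (s * t * y)))" for t
  proof -
    have "complex_of_real ((cmod (char M (s * t)))\<^sup>2) = char M (s * t) * cnj (char M (s * t))"
      by (simp add: complex_norm_square[symmetric])
    also have "cnj (char M (s * t)) = (CLINT y|M. iexp (- (s * t * y)))"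
    proof -
      have "cnj (char M (s * t)) = (CLINT y|M. cnj (iexp (s * t * y)))"
        unfolding char_def by (rule Bochner_Integration.integral_cnj[symmetric])
      then show ?thesis by (simp add: exp_cnj)
    qed
    finally show ?thesis by simp
  qed
  then have "complex_of_real (LINT t|N. (cmod (char M (s * t)))\<^sup>2) = (CLINT t|N. CLINT y|M. char M (s * t) * iexp (- (s * t * y)))"
    by (simp add: integral_complex_of_real[symmetric])
  also have "\<dots> = (CLINT y|M. CLINT t|N. char M (s * t) * iexp (- (s * t * y)))"
    using MN.Fubini_integral[OF int1] by simp
  also have "\<dots> = (CLINT y|M. CLINT t|N. CLINT x|M. iexp (s * t * (x - y)))"
  proof (intro Bochner_Integration.integral_cong refl)
    fix y t
    have "char M (s * t) * iexp (- (s * t * y)) = (CLINT x|M. iexp (s * t * x) * iexp (- (s * t * y)))"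
      unfolding char_def by simp
    also have "\<dots> = (CLINT x|M. iexp (s * t * (x - y)))"
      by (simp add: exp_add[symmetric] algebra_simps)
    finally show "char M (s * t) * iexp (- (s * t * y)) = (CLINT x|M. iexp (s * t * (x - y)))" .
  qed
  also have "\<dots> = (CLINT y|M. CLINT x|M. CLINT t|N. iexp (s * t * (x - y)))"
    using MN.Fubini_integral[OF int2] by simp
  also have "\<dots> = (CLINT y|M. CLINT x|M. char N (s * (x - y)))"
    unfolding char_def by (intro Bochner_Integration.integral_cong refl) (simp add: ac_simps)
  finally show ?thesis .
qed

text \<open>Plancherel's bound, since the square of \<open>r\<close> has integral at most
  \<open>B\<close>. It comes from averaging the squared modulus against a Gaussian weight of width
  \<open>s\<close>: Parseval bounds the average uniformly in \<open>s\<close>, and the weight is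
  then flattened.\<close>

lemma nn_integral_cmod_char_sq_le:
  fixes r :: "real \<Rightarrow> real"
  assumes r [measurable]: "r \<in> borel_measurable borel" and r0: "\<And>x. 0 \<le> r x" and rB: "\<And>x. r x \<le> B"
    and P: "prob_space (density lborel (\<lambda>x. ennreal (r x)))"
  shows "(\<integral>\<^sup>+t. ennreal ((cmod (char (density lborel (\<lambda>x. ennreal (r x))) t))\<^sup>2) \<partial>lborel) \<le> ennreal (2 * pi * B)"
proof -
  let ?e = "\<lambda>s x y. exp (- (s * (x - y))\<^sup>2 / 2)"
  define M where "M = density lborel (\<lambda>x. ennreal (r x))"
  have M: "real_distribution M"
    using P unfolding M_def real_distribution_def real_distribution_axioms_def by simp
  then interpret M: real_distribution M .
  have B: "0 \<le> B" using r0[of 0] rB[of 0] by simp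
  let ?c = "char M"
  have Mr: "integrable lborel r"
    using M.integrable_const[of "1::real"] unfolding M_def
    by (subst (asm) integrable_density) (auto simp: r0)
  \<comment> \<open>The kernel is a multiple of the normal density with mean \<open>y\<close> and
    deviation \<open>1 / s\<close>, so its integral over \<open>x\<close> is the displayed
    factor.\<close>
  have nd: "?e s x y = sqrt (2 * pi) / s * normal_density y (1 / s) x" if "s > 0" for s x y :: real
  proof -
    have "- (x - y)\<^sup>2 / (2 * (1 / s)\<^sup>2) = - (s * (x - y))\<^sup>2 / 2"
      using that by (simp add: power_divide power_mult_distrib)
    moreover have "sqrt (2 * pi * (1 / s)\<^sup>2) = sqrt (2 * pi) / s"
      using that by (simp add: real_sqrt_mult)
    ultimately show ?thesis
      using that unfolding normal_density_def by simp
  qed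
  have inner: "(LINT x|M. ?e s x y) \<le> B * (sqrt (2 * pi) / s)" if s: "s > 0" for s y
  proof -
    have "(LINT x|M. ?e s x y) = (LINT x|lborel. r x * ?e s x y)"
      unfolding M_def by (subst integral_density) (auto simp: r0)
    also have "\<dots> \<le> (LINT x|lborel. B * (sqrt (2 * pi) / s * normal_density y (1 / s) x))"
    proof (rule integral_mono)
      show "integrable lborel (\<lambda>x. B * (sqrt (2 * pi) / s * normal_density y (1 / s) x))"
        using s by (intro integrable_mult_right integrable_normal_density) auto
      show "integrable lborel (\<lambda>x. r x * ?e s x y)"
        by (rule Bochner_Integration.integrable_bound[OF Mr]) (auto simp: abs_mult r0 intro!: mult_left_le)
      show "r x * ?e s x y \<le> B * (sqrt (2 * pi) / s * normal_density y (1 / s) x)" for x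
        unfolding nd[OF s, symmetric] by (intro mult_right_mono rB) simp
    qed
    also have "\<dots> = B * (sqrt (2 * pi) / s)"
      using s by simp
    finally show ?thesis .
  qed
  have sq: "(LINT t|std_normal_distribution. (cmod (?c (s * t)))\<^sup>2) \<le> B * (sqrt (2 * pi) / s)" if s: "s > 0" for s
  proof -
    have "complex_of_real (LINT t|std_normal_distribution. (cmod (?c (s * t)))\<^sup>2)
      = complex_of_real (LINT y|M. LINT x|M. ?e s x y)"
      unfolding integral_cmod_char_sq[OF M real_dist_normal_dist] char_std_normal_distribution
      by simp
    then have "(LINT t|std_normal_distribution. (cmod (?c (s * t)))\<^sup>2) = (LINT y|M. LINT x|M. ?e s x y)"
      using of_real_eq_iff by blast
    also have "\<dots> \<le> (LINT y|M. B * (sqrt (2 * pi) / s))"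
    proof (rule integral_mono')
      show "(LINT x|M. ?e s x y) \<le> B * (sqrt (2 * pi) / s)" for y
        by (rule inner[OF s])
    qed (use B s in auto)
    finally show ?thesis by (simp add: M.prob_space[unfolded M.space_eq_univ])
  qed
  have sq': "(\<integral>\<^sup>+u. ennreal ((cmod (?c u))\<^sup>2 * std_normal_density (u / s)) \<partial>lborel) \<le> ennreal (B * sqrt (2 * pi))" if s: "s > 0" for s
  proof -
    have "(\<integral>\<^sup>+u. ennreal ((cmod (?c u))\<^sup>2 * std_normal_density (u / s)) \<partial>lborel) =
      ennreal s * (\<integral>\<^sup>+t. ennreal ((cmod (?c (s * t)))\<^sup>2 * std_normal_density t) \<partial>lborel)"
      using s by (subst nn_integral_real_affine[where c = s and t = 0]) auto
    also have "(\<integral>\<^sup>+t. ennreal ((cmod (?c (s * t)))\<^sup>2 * std_normal_density t) \<partial>lborel) =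
       (\<integral>\<^sup>+t. ennreal ((cmod (?c (s * t)))\<^sup>2) \<partial>std_normal_distribution)"
      by (subst nn_integral_density) (auto simp: ennreal_mult mult.commute normal_density_nonneg)
    also have "\<dots> = ennreal (LINT t|std_normal_distribution. (cmod (?c (s * t)))\<^sup>2)"
    proof (rule nn_integral_eq_integral)
      interpret N: real_distribution std_normal_distribution by (rule real_dist_normal_dist)
      show "integrable std_normal_distribution (\<lambda>t. (cmod (?c (s * t)))\<^sup>2)"
        by (rule N.integrable_const_bound[where B = 1]) (auto simp: M.cmod_char_le_1 power_le_one)
    qed auto
    also have "ennreal s * \<dots> \<le> ennreal s * ennreal (B * (sqrt (2 * pi) / s))"
      by (intro mult_left_mono ennreal_leI sq s) simp
    also have "\<dots> = ennreal (B * sqrt (2 * pi))"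
      using s B by (subst ennreal_mult[symmetric]) auto
    finally show ?thesis .
  qed
  \<comment> \<open>Fatou's lemma with \<open>s = Suc n\<close>: the weight at \<open>u / s\<close>
    tends to its value at 0, which is \<open>1 / sqrt (2 * pi)\<close>.\<close>
  have "(\<integral>\<^sup>+u. ennreal ((cmod (?c u))\<^sup>2 * std_normal_density 0) \<partial>lborel)
     = (\<integral>\<^sup>+u. liminf (\<lambda>n. ennreal ((cmod (?c u))\<^sup>2 * std_normal_density (u / real (Suc n)))) \<partial>lborel)"
  proof (intro nn_integral_cong lim_imp_Liminf[symmetric])
    fix u :: real
    have "(\<lambda>n. u / real (Suc n)) \<longlonglongrightarrow> 0"
      by (rule LIMSEQ_Suc[OF lim_const_over_n])
    moreover have "isCont std_normal_density 0"
      unfolding std_normal_density_def by (intro continuous_intros) auto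
    ultimately have "(\<lambda>n. (cmod (?c u))\<^sup>2 * std_normal_density (u / real (Suc n))) \<longlonglongrightarrow> (cmod (?c u))\<^sup>2 * std_normal_density 0"
      by (intro tendsto_mult_left isCont_tendsto_compose[where g = std_normal_density])
    then show "(\<lambda>n. ennreal ((cmod (?c u))\<^sup>2 * std_normal_density (u / real (Suc n)))) \<longlonglongrightarrow> ennreal ((cmod (?c u))\<^sup>2 * std_normal_density 0)"
      by (rule tendsto_ennrealI)
  qed simp
  also have "\<dots> \<le> liminf (\<lambda>n. \<integral>\<^sup>+u. ennreal ((cmod (?c u))\<^sup>2 * std_normal_density (u / real (Suc n))) \<partial>lborel)"
    by (rule nn_integral_liminf) simp
  also have "\<dots> \<le> liminf (\<lambda>n::nat. ennreal (B * sqrt (2 * pi)))"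
    by (intro Liminf_mono always_eventually allI sq') simp
  also have "\<dots> = ennreal (B * sqrt (2 * pi))" by (simp add: Liminf_const)
  finally have 1: "(\<integral>\<^sup>+u. ennreal ((cmod (?c u))\<^sup>2 * std_normal_density 0) \<partial>lborel) \<le> ennreal (B * sqrt (2 * pi))" .
  have "(\<integral>\<^sup>+t. ennreal ((cmod (?c t))\<^sup>2) \<partial>lborel) = (\<integral>\<^sup>+t. ennreal (sqrt (2 * pi)) * ennreal ((cmod (?c t))\<^sup>2 * std_normal_density 0) \<partial>lborel)"
    by (intro nn_integral_cong, subst ennreal_mult[symmetric]) (auto simp: std_normal_density_def)
  also have "\<dots> = ennreal (sqrt (2 * pi)) * (\<integral>\<^sup>+t. ennreal ((cmod (?c t))\<^sup>2 * std_normal_density 0) \<partial>lborel)"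
    by (rule nn_integral_cmult) simp
  also have "\<dots> \<le> ennreal (sqrt (2 * pi)) * ennreal (B * sqrt (2 * pi))"
    by (intro mult_left_mono 1) simp
  also have "\<dots> = ennreal (2 * pi * B)"
    using B by (subst ennreal_mult[symmetric]) (auto simp: algebra_simps)
  finally show ?thesis unfolding M_def .
qed

section \<open>A local limit theorem for triangular arrays\<close>

text \<open>A single term of the exponential series at \<open>x / 2\<close> suffices.\<close>

lemma power_times_exp_le:
  fixes x :: real
  assumes "0 \<le> x"
  shows "x ^ k * exp (- x / 2) \<le> 2 ^ k * fact k"
proof -
  have "(x / 2) ^ k / fact k \<le> exp (x / 2)"
  proof -
    have "(\<Sum>n\<in>{k}. (x / 2) ^ n /\<^sub>R fact n) \<le> exp (x / 2)"
      unfolding exp_def by (rule sum_le_suminf[OF summable_exp_generic]) (use assms in auto)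
    moreover have "(\<Sum>n\<in>{k}. (x / 2) ^ n /\<^sub>R fact n) = (x / 2) ^ k / fact k"
      by (simp only: sum.insert finite.emptyI empty_iff not_False_eq_True sum.empty add_0_right
          real_scaleR_def divide_inverse[of "(x / 2) ^ k"] mult.commute)
    ultimately show ?thesis by simp
  qed
  then have "x ^ k \<le> 2 ^ k * fact k * exp (x / 2)"
    by (simp add: pos_divide_le_eq power_divide mult_ac)
  then have "x ^ k * exp (- x / 2) \<le> 2 ^ k * fact k * exp (x / 2) * exp (- x / 2)"
    by (rule mult_right_mono) simp
  also have "\<dots> = 2 ^ k * fact k"
    by (simp add: mult.assoc flip: exp_add)
  finally show ?thesis .
qed

text \<open>Multiplication by 1 + u^2 produces the powers \<open>k\<close> and \<open>k + 2\<close>,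
  both bounded against the exponential, so the integrable function 1/(1 + u^2) dominates.\<close>

lemma integrable_power_times_exp:
  "integrable lborel (\<lambda>u::real. \<bar>u\<bar> ^ k * exp (- \<bar>u\<bar> / 2))"
proof (rule Bochner_Integration.integrable_bound)
  let ?K = "2 ^ k * fact k + 2 ^ (k + 2) * fact (k + 2) :: real"
  show "integrable lborel (\<lambda>u::real. ?K * inverse (1 + u\<^sup>2))"
    using integrable_inverse_1_plus_square
    by (intro integrable_mult_right) (simp add: set_integrable_def)
  show "AE u in lborel. norm (\<bar>u\<bar> ^ k * exp (- \<bar>u\<bar> / 2)) \<le> norm (?K * inverse (1 + u\<^sup>2))"
  proof (rule AE_I2)
    fix u :: real
    have "\<bar>u\<bar> ^ k * exp (- \<bar>u\<bar> / 2) * (1 + u\<^sup>2) = \<bar>u\<bar> ^ k * exp (- \<bar>u\<bar> / 2) + \<bar>u\<bar> ^ (k + 2) * exp (- \<bar>u\<bar> / 2)"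
    proof -
      have "\<bar>u\<bar> ^ (k + 2) = \<bar>u\<bar> ^ k * u\<^sup>2" by (simp add: power_add power2_eq_square)
      then show ?thesis by (simp only: distrib_left distrib_right mult_1_right mult_1_left mult_ac)
    qed
    also have "\<dots> \<le> ?K"
      by (intro add_mono power_times_exp_le) auto
    finally have "\<bar>u\<bar> ^ k * exp (- \<bar>u\<bar> / 2) \<le> ?K * inverse (1 + u\<^sup>2)"
      by (simp add: pos_le_divide_eq add_pos_nonneg flip: divide_inverse)
    moreover have "0 \<le> ?K * inverse (1 + u\<^sup>2)"
      by (intro mult_nonneg_nonneg) (auto simp: add_nonneg_nonneg)
    ultimately show "norm (\<bar>u\<bar> ^ k * exp (- \<bar>u\<bar> / 2)) \<le> norm (?K * inverse (1 + u\<^sup>2))"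
      by (simp add: abs_mult)
  qed
qed measurable

lemma exp_minus_approx:
  fixes x :: real
  assumes "0 \<le> x"
  shows "\<bar>exp (- x) - (1 - x)\<bar> \<le> x\<^sup>2"
proof -
  have "exp (- x) \<le> 1 / (1 + x)"
    using exp_ge_add_one_self[of x] assms by (simp add: exp_minus field_simps)
  also have "\<dots> \<le> 1 - x + x\<^sup>2"
  proof -
    have "1 \<le> (1 - x + x\<^sup>2) * (1 + x)"
      using assms by (simp add: algebra_simps power2_eq_square)
    then show ?thesis using assms by (simp add: field_simps)
  qed
  finally have "exp (- x) \<le> 1 - x + x\<^sup>2" .
  moreover have "1 - x \<le> exp (- x)" using exp_ge_add_one_self[of "- x"] by simp
  ultimately show ?thesis by (auto simp: abs_le_iff)
qed

lemma cube_sum_le: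
  fixes a b :: real
  assumes "0 \<le> a" "0 \<le> b"
  shows "(a + b) ^ 3 \<le> 4 * (a ^ 3 + b ^ 3)"
proof -
  have "4 * (a ^ 3 + b ^ 3) - (a + b) ^ 3 = 3 * (a + b) * (a - b)\<^sup>2"
    by (simp add: power2_eq_square power3_eq_cube algebra_simps)
  moreover have "0 \<le> 3 * (a + b) * (a - b)\<^sup>2" using assms by simp
  ultimately show ?thesis by linarith
qed

lemma power_le_one_plus_cube: "k \<le> 3 \<Longrightarrow> \<bar>u::real\<bar> ^ k \<le> 1 * (1 + \<bar>u\<bar> ^ 3)"
proof (cases "\<bar>u\<bar> \<le> 1")
  case True
  then have "\<bar>u\<bar> ^ k \<le> 1" by (simp add: power_le_one)
  then show ?thesis using order_trans[of _ 1 "1 * (1 + \<bar>u\<bar> ^ 3)"] by simp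
next
  case False
  assume "k \<le> 3"
  then have "\<bar>u\<bar> ^ k \<le> \<bar>u\<bar> ^ 3" using False by (intro power_increasing) auto
  then show ?thesis by simp
qed

text \<open>Pointwise convergence under an exponential envelope independent of \<open>n\<close>: the
  envelope yields uniform third moments, convergence of mean and variance, and the uniform bound
  \<open>r n u \<le> C\<close> behind the L2 estimate. The densities are centred only approximately,
  so their means need not vanish.\<close>

locale gaussian_limit =
  fixes r :: "nat \<Rightarrow> real \<Rightarrow> real" and C :: real
  assumes r_measurable [measurable]: "\<And>n. r n \<in> borel_measurable borel"
    and r_nonneg: "\<And>n u. 0 \<le> r n u"
    and r_le: "\<And>n u. r n u \<le> C * exp (- \<bar>u\<bar> / 2)"
    and r_integral: "\<And>n. (LINT u|lborel. r n u) = 1"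
    and r_lim: "\<And>u. (\<lambda>n. r n u) \<longlonglongrightarrow> std_normal_density u"
begin

definition law :: "nat \<Rightarrow> real measure" where
  "law n = density lborel (\<lambda>u. ennreal (r n u))"

definition mean :: "nat \<Rightarrow> real" where
  "mean n = (LINT u|lborel. u * r n u)"

definition var :: "nat \<Rightarrow> real" where
  "var n = (LINT u|lborel. (u - mean n)\<^sup>2 * r n u)"

text \<open>The exact mean is removed: \<open>mean n\<close> tends to 0, but after
  \<open>N n\<close> summands the drift \<open>sqrt (N n) * mean n\<close> need not.\<close>

definition centred_char :: "nat \<Rightarrow> real \<Rightarrow> complex" where
  "centred_char n w = iexp (- (w * mean n)) * char (law n) w"

lemma C_nonneg: "0 \<le> C"
  using r_nonneg[of 0 0] r_le[of 0 0] by simp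

lemma r_le_C: "r n u \<le> C"
proof -
  have "C * exp (- \<bar>u\<bar> / 2) \<le> C * 1" by (intro mult_left_mono C_nonneg) simp
  then show ?thesis using r_le[of n u] by simp
qed

lemma integrable_envelope: "integrable lborel (\<lambda>u::real. K * ((1 + \<bar>u\<bar> ^ k) * (C * exp (- \<bar>u\<bar> / 2))))"
proof -
  have "integrable lborel (\<lambda>u::real. K * C * (\<bar>u\<bar> ^ 0 * exp (- \<bar>u\<bar> / 2) + \<bar>u\<bar> ^ k * exp (- \<bar>u\<bar> / 2)))"
    by (intro integrable_mult_right Bochner_Integration.integrable_add integrable_power_times_exp)
  then show ?thesis by (simp add: algebra_simps)
qed

lemma moment_bound:
  assumes "\<And>u. \<bar>w u\<bar> \<le> K * (1 + \<bar>u\<bar> ^ k)"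
  shows "norm (w u * r n u) \<le> K * ((1 + \<bar>u\<bar> ^ k) * (C * exp (- \<bar>u\<bar> / 2)))"
proof -
  have "norm (w u * r n u) = \<bar>w u\<bar> * r n u" using r_nonneg by (simp add: abs_mult)
  also have "\<dots> \<le> (K * (1 + \<bar>u\<bar> ^ k)) * (C * exp (- \<bar>u\<bar> / 2))"
    by (rule mult_mono[OF assms r_le]) (use assms[of u] r_nonneg in auto)
  finally show ?thesis by simp
qed

lemma integrable_moment:
  assumes [measurable]: "w \<in> borel_measurable borel" and w: "\<And>u. \<bar>w u\<bar> \<le> K * (1 + \<bar>u\<bar> ^ k)"
  shows "integrable lborel (\<lambda>u. w u * r n u)"
proof (rule Bochner_Integration.integrable_bound[OF integrable_envelope])
  show "AE u in lborel. norm (w u * r n u) \<le> norm (K * ((1 + \<bar>u\<bar> ^ k) * (C * exp (- \<bar>u\<bar> / 2))))"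
    using order_trans[OF moment_bound[of w K k, OF w] abs_ge_self] by (intro AE_I2) simp
qed simp

lemma tendsto_moment:
  assumes [measurable]: "w \<in> borel_measurable borel" and w: "\<And>u. \<bar>w u\<bar> \<le> K * (1 + \<bar>u\<bar> ^ k)"
  shows "(\<lambda>n. LINT u|lborel. w u * r n u) \<longlonglongrightarrow> (LINT u|lborel. w u * std_normal_density u)"
proof (rule integral_dominated_convergence[OF _ _ integrable_envelope[of K k]])
  show "AE u in lborel. norm (w u * r n u) \<le> K * ((1 + \<bar>u\<bar> ^ k) * (C * exp (- \<bar>u\<bar> / 2)))" for n
    by (intro AE_I2 moment_bound w)
qed (auto intro!: tendsto_intros r_lim)

lemma integrable_r_power: "k \<le> 3 \<Longrightarrow> integrable lborel (\<lambda>u. u ^ k * r n u)"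
  "k \<le> 3 \<Longrightarrow> integrable lborel (\<lambda>u. \<bar>u\<bar> ^ k * r n u)"
  by (rule integrable_moment[where K = 1 and k = 3]; use power_le_one_plus_cube in \<open>auto simp: power_abs\<close>)+

lemma integrable_r: "integrable lborel (r n)"
  using integrable_r_power(1)[of 0 n] by simp

lemma real_distribution_law: "real_distribution (law n)"
proof -
  have "emeasure (law n) UNIV = (\<integral>\<^sup>+u. ennreal (r n u) \<partial>lborel)"
    unfolding law_def by (subst emeasure_density) auto
  also have "\<dots> = 1"
    by (subst nn_integral_eq_integral) (auto simp: r_nonneg r_integral integrable_r)
  finally have "prob_space (law n)" by (intro prob_spaceI) (simp add: law_def)
  then show ?thesis
    unfolding real_distribution_def real_distribution_axioms_def by (simp add: law_def)
qed

lemma mean_tendsto: "mean \<longlonglongrightarrow> 0"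
proof -
  have "(\<lambda>n. LINT u|lborel. u * r n u) \<longlonglongrightarrow> (LINT u|lborel. u * std_normal_density u)"
    by (rule tendsto_moment[where K = 1 and k = 3]) (use power_le_one_plus_cube[of 1] in auto)
  moreover have "(LINT u|lborel. u * std_normal_density u) = 0"
    using integral_std_normal_moment_odd[of 0] by (simp add: mult.commute)
  ultimately show ?thesis unfolding mean_def[abs_def] by simp
qed

lemma var_tendsto: "var \<longlonglongrightarrow> 1"
proof -
  have eq: "var = (\<lambda>n. (LINT u|lborel. u ^ 2 * r n u) - (mean n)\<^sup>2)"
  proof
    fix n
    note int = integrable_r_power(1)[of _ n]
    have "var n = (LINT u|lborel. (u\<^sup>2 * r n u - (2 * mean n) * (u * r n u)) + (mean n)\<^sup>2 * r n u)"
      unfolding var_def by (intro Bochner_Integration.integral_cong) (auto simp: power2_eq_square algebra_simps)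
    also have "\<dots> = (LINT u|lborel. u\<^sup>2 * r n u - (2 * mean n) * (u * r n u)) + (LINT u|lborel. (mean n)\<^sup>2 * r n u)"
      using int[of 2] int[of 1] int[of 0] by (intro Bochner_Integration.integral_add) auto
    also have "(LINT u|lborel. u\<^sup>2 * r n u - (2 * mean n) * (u * r n u)) = (LINT u|lborel. u\<^sup>2 * r n u) - (LINT u|lborel. (2 * mean n) * (u * r n u))"
      using int[of 2] int[of 1] by (intro Bochner_Integration.integral_diff) auto
    also have "(LINT u|lborel. (2 * mean n) * (u * r n u)) = 2 * mean n * mean n"
      by (simp add: mean_def)
    also have "(LINT u|lborel. (mean n)\<^sup>2 * r n u) = (mean n)\<^sup>2" by (simp add: r_integral)
    finally show "var n = (LINT u|lborel. u ^ 2 * r n u) - (mean n)\<^sup>2" by (simp add: power2_eq_square)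
  qed
  have "(\<lambda>n. LINT u|lborel. u\<^sup>2 * r n u) \<longlonglongrightarrow> (LINT u|lborel. u\<^sup>2 * std_normal_density u)"
    by (rule tendsto_moment[where K = 1 and k = 3]) (use power_le_one_plus_cube[of 2] in auto)
  moreover have "(LINT u|lborel. u\<^sup>2 * std_normal_density u) = 1"
    using integral_std_normal_moment_even[of 1] by (simp add: mult.commute)
  ultimately have 1: "(\<lambda>n. LINT u|lborel. u\<^sup>2 * r n u) \<longlonglongrightarrow> 1" by simp
  have 2: "(\<lambda>n. (mean n)\<^sup>2) \<longlonglongrightarrow> 0"
    using tendsto_power[OF mean_tendsto, of 2] by simp
  show ?thesis
    unfolding eq using tendsto_diff[OF 1 2] by (simp only: diff_zero)
qed

lemma integral_law:
  fixes f :: "real \<Rightarrow> 'b::{banach, second_countable_topology}"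
  assumes "f \<in> borel_measurable borel"
  shows "(LINT u|law n. f u) = (LINT u|lborel. r n u *\<^sub>R f u)"
  unfolding law_def using assms by (intro integral_density) (auto simp: r_nonneg)

lemma integrable_law_power: "k \<le> 3 \<Longrightarrow> integrable (law n) (\<lambda>u. u ^ k)"
  unfolding law_def using integrable_r_power(1)[of k n]
  by (subst integrable_density) (auto simp: r_nonneg mult.commute)

text \<open>The third-order Taylor estimate for characteristic functions, with one constant for all
  \<open>n\<close> because the envelope bounds third absolute moments uniformly.\<close>

lemma centred_char_approx: "\<exists>D>0. \<forall>n w. cmod (centred_char n w - (1 - w\<^sup>2 * var n / 2)) \<le> D * \<bar>w\<bar> ^ 3"
proof -
  define K where "K = (LINT u|lborel. C * (\<bar>u\<bar> ^ 1 * exp (- \<bar>u\<bar> / 2)))"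
  define K3 where "K3 = (LINT u|lborel. C * (\<bar>u\<bar> ^ 3 * exp (- \<bar>u\<bar> / 2)))"
  have le: "(LINT u|lborel. \<bar>u\<bar> ^ k * r n u) \<le> (LINT u|lborel. C * (\<bar>u\<bar> ^ k * exp (- \<bar>u\<bar> / 2)))" if "k \<le> 3" for k n
  proof (rule integral_mono)
    show "\<bar>u\<bar> ^ k * r n u \<le> C * (\<bar>u\<bar> ^ k * exp (- \<bar>u\<bar> / 2))" for u
      using mult_left_mono[OF r_le[of n u], of "\<bar>u\<bar> ^ k"] by (simp add: mult_ac)
    show "integrable lborel (\<lambda>u. C * (\<bar>u\<bar> ^ k * exp (- \<bar>u\<bar> / 2)))"
      by (intro integrable_mult_right integrable_power_times_exp)
  qed (rule integrable_r_power(2)[OF that])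
  have mean_le: "\<bar>mean n\<bar> \<le> K" for n
  proof -
    have "\<bar>mean n\<bar> \<le> (LINT u|lborel. \<bar>u * r n u\<bar>)"
      unfolding mean_def using integral_norm_bound[of lborel "\<lambda>u. u * r n u"] by simp
    also have "\<dots> = (LINT u|lborel. \<bar>u\<bar> ^ 1 * r n u)" by (simp add: abs_mult r_nonneg)
    also have "\<dots> \<le> K" unfolding K_def by (rule le) simp
    finally show ?thesis .
  qed
  then have K: "0 \<le> K" by (meson abs_ge_zero order_trans)
  have K3: "0 \<le> K3"
    unfolding K3_def using C_nonneg by (intro Bochner_Integration.integral_nonneg) simp
  \<comment> \<open>A bound for the third absolute moment about the mean, by
    \<open>cube_sum_le\<close> with \<open>K\<close> bounding all means; the summand 1 makes it
    positive.\<close>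
  define D where "D = 4 * (K3 + K ^ 3) + 1"
  have D: "D > 0" unfolding D_def using K K3 by (intro add_nonneg_pos) auto
  have "cmod (centred_char n w - (1 - w\<^sup>2 * var n / 2)) \<le> D * \<bar>w\<bar> ^ 3" for n w
  proof -
    interpret L: real_distribution "law n" by (rule real_distribution_law)
    define L' where "L' = distr (law n) borel (\<lambda>u. u - mean n)"
    have shift [measurable]: "(\<lambda>u. u - mean n) \<in> borel_measurable (law n)" by simp
    have L': "real_distribution L'" unfolding L'_def by (rule L.real_distribution_distr) simp
    interpret L': real_distribution L' by (rule L')
    have int_shift: "integrable (law n) (\<lambda>u. (u - mean n) ^ k)" if "k \<in> {1, 2}" for k
    proof -
      have "integrable (law n) (\<lambda>u. u\<^sup>2 - 2 * mean n * u ^ 1 + (mean n)\<^sup>2)"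
        by (intro Bochner_Integration.integrable_add Bochner_Integration.integrable_diff integrable_mult_right
            integrable_law_power L.integrable_const) auto
      moreover have "integrable (law n) (\<lambda>u. u ^ 1 - mean n)"
        by (intro Bochner_Integration.integrable_diff integrable_law_power L.integrable_const) auto
      ultimately show ?thesis using that by (auto simp: power2_diff algebra_simps)
    qed
    have i1: "integrable L' (\<lambda>x. x)" unfolding L'_def using int_shift[of 1] by (subst integrable_distr_eq) auto
    have i2: "integrable L' (\<lambda>x. x\<^sup>2)" unfolding L'_def using int_shift[of 2] by (subst integrable_distr_eq) auto
    have e1: "L'.expectation (\<lambda>x. x) = 0"
    proof -
      have "L'.expectation (\<lambda>x. x) = L.expectation (\<lambda>u. u - mean n)" unfolding L'_def by (subst integral_distr) auto
      also have "\<dots> = L.expectation (\<lambda>u. u) - mean n"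
        using integrable_law_power[of 1 n] L.prob_space by (subst Bochner_Integration.integral_diff) auto
      also have "L.expectation (\<lambda>u. u) = mean n" unfolding mean_def by (subst integral_law) (auto simp: mult.commute)
      finally show ?thesis by simp
    qed
    have e2: "L'.variance (\<lambda>x. x) = var n"
    proof -
      have "L'.variance (\<lambda>x. x) = L'.expectation (\<lambda>x. x\<^sup>2)" by (simp add: e1)
      also have "\<dots> = var n" unfolding L'_def var_def by (subst integral_distr) (auto simp: integral_law mult.commute)
      finally show ?thesis .
    qed
    have c: "centred_char n w = char L' w"
    proof -
      have "char L' w = (CLINT u|law n. iexp (w * (u - mean n)))"
        unfolding char_def L'_def by (subst integral_distr) auto
      also have "\<dots> = (CLINT u|law n. iexp (- (w * mean n)) * iexp (w * u))"
        by (intro Bochner_Integration.integral_cong refl) (simp add: exp_add[symmetric] algebra_simps)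
      also have "\<dots> = centred_char n w" unfolding centred_char_def char_def by simp
      finally show ?thesis ..
    qed
    have m3: "L'.expectation (\<lambda>x. min (6 * x\<^sup>2) (\<bar>w\<bar> * \<bar>x\<bar> ^ 3)) \<le> \<bar>w\<bar> * D"
    proof -
      have ir: "integrable lborel (\<lambda>u. \<bar>u\<bar> ^ 3 * r n u)" by (rule integrable_r_power) simp
      have "L'.expectation (\<lambda>x. min (6 * x\<^sup>2) (\<bar>w\<bar> * \<bar>x\<bar> ^ 3))
         = (LINT u|lborel. r n u * min (6 * (u - mean n)\<^sup>2) (\<bar>w\<bar> * \<bar>u - mean n\<bar> ^ 3))"
        unfolding L'_def by (subst integral_distr) (auto simp: integral_law)
      also have "\<dots> \<le> (LINT u|lborel. \<bar>w\<bar> * (4 * (\<bar>u\<bar> ^ 3 * r n u + K ^ 3 * r n u)))"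
      proof (rule integral_mono')
        show "integrable lborel (\<lambda>u. \<bar>w\<bar> * (4 * (\<bar>u\<bar> ^ 3 * r n u + K ^ 3 * r n u)))"
          using ir integrable_r by (intro integrable_mult_right Bochner_Integration.integrable_add) auto
        fix u
        have "\<bar>u - mean n\<bar> ^ 3 \<le> (\<bar>u\<bar> + K) ^ 3"
          using mean_le[of n] by (intro power_mono) auto
        also have "\<dots> \<le> 4 * (\<bar>u\<bar> ^ 3 + K ^ 3)" by (rule cube_sum_le) (use K in auto)
        finally have "\<bar>w\<bar> * \<bar>u - mean n\<bar> ^ 3 \<le> \<bar>w\<bar> * (4 * (\<bar>u\<bar> ^ 3 + K ^ 3))" by (rule mult_left_mono) simp
        then have "min (6 * (u - mean n)\<^sup>2) (\<bar>w\<bar> * \<bar>u - mean n\<bar> ^ 3) \<le> \<bar>w\<bar> * (4 * (\<bar>u\<bar> ^ 3 + K ^ 3))" by linarith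
        from mult_left_mono[OF this r_nonneg[of n u]]
        show "r n u * min (6 * (u - mean n)\<^sup>2) (\<bar>w\<bar> * \<bar>u - mean n\<bar> ^ 3) \<le> \<bar>w\<bar> * (4 * (\<bar>u\<bar> ^ 3 * r n u + K ^ 3 * r n u))"
          by (simp add: algebra_simps)
        show "0 \<le> \<bar>w\<bar> * (4 * (\<bar>u\<bar> ^ 3 * r n u + K ^ 3 * r n u))"
          using K r_nonneg by (intro mult_nonneg_nonneg add_nonneg_nonneg) auto
      qed
      also have "\<dots> = \<bar>w\<bar> * (4 * ((LINT u|lborel. \<bar>u\<bar> ^ 3 * r n u) + K ^ 3))"
        using ir integrable_r by (simp add: r_integral)
      also have "\<dots> \<le> \<bar>w\<bar> * D"
        unfolding D_def using le[of 3 n] K by (intro mult_left_mono) (auto simp: K3_def)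
      finally show ?thesis .
    qed
    have "cmod (char L' w - (1 - w\<^sup>2 * var n / 2)) \<le> w\<^sup>2 / 6 * L'.expectation (\<lambda>x. min (6 * x\<^sup>2) (\<bar>w\<bar> * \<bar>x\<bar> ^ 3))"
      by (rule L'.char_approx3[OF i1 e1 i2 e2])
    also have "\<dots> \<le> w\<^sup>2 / 6 * (\<bar>w\<bar> * D)" by (intro mult_left_mono m3) simp
    also have "\<dots> = D * \<bar>w\<bar> ^ 3 / 6" by (simp add: power3_eq_cube power2_eq_square flip: abs_mult)
    also have "\<dots> \<le> D * \<bar>w\<bar> ^ 3" using D by simp
    finally show ?thesis unfolding c .
  qed
  then show ?thesis using D by blast
qed

lemma cmod_centred_char: "cmod (centred_char n w) = cmod (char (law n) w)"
  unfolding centred_char_def by (simp add: norm_mult)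

lemma cmod_centred_char_le_1: "cmod (centred_char n w) \<le> 1"
  unfolding cmod_centred_char using real_distribution.cmod_char_le_1[OF real_distribution_law] .

lemma centred_char_measurable [measurable]: "centred_char n \<in> borel_measurable borel"
  unfolding centred_char_def[abs_def] using real_distribution.char_measurable[OF real_distribution_law, of n]
  by measurable

text \<open>Near 0 the variance term dominates the cubic remainder. The bound is Gaussian, so its
  \<open>N\<close>-th power at \<open>v / sqrt N\<close> is exp(-v^2/4), a dominating function free
  of \<open>N\<close>.\<close>

lemma centred_char_near_0: "\<exists>\<delta>>0. \<forall>\<^sub>F n in sequentially. \<forall>w. \<bar>w\<bar> \<le> \<delta> \<longrightarrow> cmod (centred_char n w) \<le> exp (- w\<^sup>2 / 4)"
proof -
  obtain D where D: "D > 0" "\<And>n w. cmod (centred_char n w - (1 - w\<^sup>2 * var n / 2)) \<le> D * \<bar>w\<bar> ^ 3"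
    using centred_char_approx by auto
  \<comment> \<open>The bound 1 keeps the quadratic approximation nonnegative once the variance is
    below 2. The bound \<open>1 / (8 * D)\<close> makes the remainder at most w^2/8, leaving 1 -
    w^2/4 when the variance exceeds 3/4.\<close>
  define \<delta> where "\<delta> = min 1 (1 / (8 * D))"
  have "\<forall>\<^sub>F n in sequentially. var n > 3 / 4" "\<forall>\<^sub>F n in sequentially. var n < 2"
    by (rule order_tendstoD[OF var_tendsto]; simp)+
  then have "\<forall>\<^sub>F n in sequentially. \<forall>w. \<bar>w\<bar> \<le> \<delta> \<longrightarrow> cmod (centred_char n w) \<le> exp (- w\<^sup>2 / 4)"
  proof eventually_elim
    case (elim n)
    show ?case
    proof (intro allI impI)
      fix w assume w: "\<bar>w\<bar> \<le> \<delta>"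
      have w1: "w\<^sup>2 \<le> 1" using w by (simp add: \<delta>_def abs_square_le_1)
      have "w\<^sup>2 * var n \<le> 1 * 2" using w1 elim by (intro mult_mono) auto
      moreover have "w\<^sup>2 * (3 / 4) \<le> w\<^sup>2 * var n" using elim by (intro mult_left_mono) auto
      ultimately have 1: "\<bar>1 - w\<^sup>2 * var n / 2\<bar> \<le> 1 - 3 / 8 * w\<^sup>2" by (simp add: abs_le_iff)
      have "D * \<bar>w\<bar> \<le> D * (1 / (8 * D))" using w D(1) by (intro mult_left_mono) (auto simp: \<delta>_def)
      then have "D * \<bar>w\<bar> \<le> 1 / 8" using D(1) by simp
      then have "(D * \<bar>w\<bar>) * w\<^sup>2 \<le> 1 / 8 * w\<^sup>2" by (rule mult_right_mono) simp
      moreover have "D * \<bar>w\<bar> ^ 3 = (D * \<bar>w\<bar>) * w\<^sup>2" by (simp add: power3_eq_cube power2_eq_square)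
      ultimately have 2: "D * \<bar>w\<bar> ^ 3 \<le> 1 / 8 * w\<^sup>2" by (simp only:)
      have "cmod (centred_char n w) \<le> cmod (complex_of_real (1 - w\<^sup>2 * var n / 2)) + cmod (centred_char n w - (1 - w\<^sup>2 * var n / 2))"
        using norm_triangle_sub[of "centred_char n w" "complex_of_real (1 - w\<^sup>2 * var n / 2)"] by simp
      also have "\<dots> \<le> (1 - 3 / 8 * w\<^sup>2) + 1 / 8 * w\<^sup>2"
        using 1 2 D(2)[of n w] by (intro add_mono) (simp_all only: norm_of_real)
      also have "\<dots> = 1 + (- w\<^sup>2 / 4)" by simp
      also have "\<dots> \<le> exp (- w\<^sup>2 / 4)" by (rule exp_ge_add_one_self)
      finally show "cmod (centred_char n w) \<le> exp (- w\<^sup>2 / 4)" .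
    qed
  qed
  moreover have "\<delta> > 0" using D(1) by (simp add: \<delta>_def)
  ultimately show ?thesis by blast
qed

text \<open>Convergence of the densities in \<open>L\<^sup>1\<close> makes the characteristic functions converge uniformly on
  the whole line, so they stay away from \<open>1\<close> in modulus outside any neighbourhood of \<open>0\<close>.\<close>

lemma centred_char_away_0:
  assumes "\<delta> > 0"
  shows "\<exists>\<kappa>. 0 < \<kappa> \<and> \<kappa> < 1 \<and> (\<forall>\<^sub>F n in sequentially. \<forall>w. \<delta> \<le> \<bar>w\<bar> \<longrightarrow> cmod (centred_char n w) \<le> \<kappa>)"
proof -
  let ?g = "std_normal_density"
  define d where "d n = (LINT u|lborel. \<bar>r n u - ?g u\<bar>)" for n
  have env: "integrable lborel (\<lambda>u::real. C * (\<bar>u\<bar> ^ 0 * exp (- \<bar>u\<bar> / 2)) + ?g u)"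
    by (intro Bochner_Integration.integrable_add integrable_mult_right integrable_power_times_exp integrable_normal_density) auto
  have "d \<longlonglongrightarrow> integral\<^sup>L lborel (\<lambda>u::real. \<bar>0::real\<bar>)"
    unfolding d_def[abs_def]
  proof (rule integral_dominated_convergence[OF _ _ env])
    show "AE u in lborel. (\<lambda>n. \<bar>r n u - ?g u\<bar>) \<longlonglongrightarrow> \<bar>0\<bar>"
    proof (rule AE_I2)
      fix u
      show "(\<lambda>n. \<bar>r n u - ?g u\<bar>) \<longlonglongrightarrow> \<bar>0\<bar>"
        using tendsto_rabs[OF tendsto_diff[OF r_lim[of u] tendsto_const[of "?g u"]]] by simp
    qed
    show "AE u in lborel. norm \<bar>r n u - ?g u\<bar> \<le> C * (\<bar>u\<bar> ^ 0 * exp (- \<bar>u\<bar> / 2)) + ?g u" for n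
    proof (rule AE_I2)
      fix u
      have "\<bar>r n u - ?g u\<bar> \<le> r n u + ?g u"
        using r_nonneg[of n u] normal_density_nonneg[of 0 1 u] by (simp add: abs_le_iff)
      then show "norm \<bar>r n u - ?g u\<bar> \<le> C * (\<bar>u\<bar> ^ 0 * exp (- \<bar>u\<bar> / 2)) + ?g u"
        using r_le[of n u] by simp
    qed
  qed auto
  then have d0: "d \<longlonglongrightarrow> 0" by simp
  have close: "cmod (char (law n) w - complex_of_real (exp (- (w\<^sup>2) / 2))) \<le> d n" for n w
  proof -
    have i1: "integrable lborel (\<lambda>u. r n u *\<^sub>R iexp (w * u))"
      by (rule Bochner_Integration.integrable_bound[OF integrable_r[of n]]) (auto simp: r_nonneg)
    have i2: "integrable lborel (\<lambda>u. ?g u *\<^sub>R iexp (w * u))"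
      by (rule Bochner_Integration.integrable_bound[OF integrable_normal_density[of 1 0]]) auto
    have "complex_of_real (exp (- (w\<^sup>2) / 2)) = char std_normal_distribution w"
      by (simp add: char_std_normal_distribution)
    also have "\<dots> = (LINT u|lborel. ?g u *\<^sub>R iexp (w * u))"
      unfolding char_def by (subst integral_density) auto
    finally have "char (law n) w - complex_of_real (exp (- (w\<^sup>2) / 2))
       = (LINT u|lborel. r n u *\<^sub>R iexp (w * u)) - (LINT u|lborel. ?g u *\<^sub>R iexp (w * u))"
      unfolding char_def by (simp add: integral_law)
    also have "\<dots> = (LINT u|lborel. r n u *\<^sub>R iexp (w * u) - ?g u *\<^sub>R iexp (w * u))"
      using i1 i2 by simp
    also have "cmod \<dots> \<le> (LINT u|lborel. cmod (r n u *\<^sub>R iexp (w * u) - ?g u *\<^sub>R iexp (w * u)))"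
      by (rule integral_norm_bound)
    also have "\<dots> = d n" unfolding d_def
      by (intro Bochner_Integration.integral_cong refl) (simp only: scaleR_diff_left[symmetric] norm_scaleR norm_exp_i_times mult_1_right)
    finally show ?thesis .
  qed
  \<comment> \<open>\<open>q\<close> is the largest value of the Gaussian limit where
    \<open>\<delta> \<le> \<bar>w\<bar>\<close>; the midpoint \<kappa> of \<open>q\<close> and 1
    leaves room for an error below \<open>(1 - q) / 2\<close>.\<close>
  define q where "q = exp (- \<delta>\<^sup>2 / 2)"
  define \<kappa> where "\<kappa> = (1 + q) / 2"
  have q: "0 < q" "q < 1" using assms by (auto simp: q_def)
  have "\<forall>\<^sub>F n in sequentially. d n < (1 - q) / 2"
    using d0 q by (intro order_tendstoD) auto
  then have "\<forall>\<^sub>F n in sequentially. \<forall>w. \<delta> \<le> \<bar>w\<bar> \<longrightarrow> cmod (centred_char n w) \<le> \<kappa>"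
  proof eventually_elim
    case (elim n)
    show ?case
    proof (intro allI impI)
      fix w assume w: "\<delta> \<le> \<bar>w\<bar>"
      have "\<delta>\<^sup>2 \<le> w\<^sup>2" using w assms by (metis abs_le_square_iff abs_of_pos)
      then have "exp (- (w\<^sup>2) / 2) \<le> q" by (simp add: q_def)
      moreover have "cmod (char (law n) w) \<le> cmod (complex_of_real (exp (- (w\<^sup>2) / 2))) + d n"
        using norm_triangle_sub[of "char (law n) w" "complex_of_real (exp (- (w\<^sup>2) / 2))"] close[of n w] by linarith
      ultimately show "cmod (centred_char n w) \<le> \<kappa>"
        unfolding cmod_centred_char \<kappa>_def using elim by (simp add: field_simps)
    qed
  qed
  moreover have "0 < \<kappa>" "\<kappa> < 1" using q by (auto simp: \<kappa>_def)
  ultimately show ?thesis by blast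
qed

text \<open>Centring changes only the phase, and \<open>r n\<close> is bounded by \<open>C\<close>;
  the bound does not depend on \<open>n\<close>.\<close>

lemma nn_integral_centred_char_sq: "(\<integral>\<^sup>+w. ennreal ((cmod (centred_char n w))\<^sup>2) \<partial>lborel) \<le> ennreal (2 * pi * C)"
  unfolding cmod_centred_char law_def
  by (rule nn_integral_cmod_char_sq_le)
    (use r_nonneg r_le_C real_distribution_law[of n] in \<open>auto simp: law_def real_distribution_def\<close>)

lemma integrable_centred_char_sq: "integrable lborel (\<lambda>w. (cmod (centred_char n w))\<^sup>2)"
  by (rule integrableI_bounded) (use nn_integral_centred_char_sq[of n] in \<open>auto simp: top_unique less_top[symmetric]\<close>)

lemma integral_centred_char_sq: "(LINT w|lborel. (cmod (centred_char n w))\<^sup>2) \<le> 2 * pi * C"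
  using nn_integral_centred_char_sq[of n] C_nonneg
  by (subst (asm) nn_integral_eq_integral[OF integrable_centred_char_sq]) (auto simp: ennreal_le_iff)

text \<open>For numbers of modulus at most 1, N-th powers differ by at most N times the difference
  of the bases. So it is enough to compare one factor with exp(-w^2/2) at w = v/sqrt N, to accuracy
  o(1/N).\<close>

lemma centred_char_power_tendsto:
  assumes N: "filterlim N at_top sequentially"
  shows "(\<lambda>n. centred_char n (v / sqrt (real (N n))) ^ N n) \<longlonglongrightarrow> complex_of_real (exp (- v\<^sup>2 / 2))"
proof -
  obtain D where D: "D > 0" "\<And>n w. cmod (centred_char n w - (1 - w\<^sup>2 * var n / 2)) \<le> D * \<bar>w\<bar> ^ 3"
    using centred_char_approx by auto
  have NR: "filterlim (\<lambda>n. real (N n)) at_top sequentially"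
    by (rule filterlim_compose[OF filterlim_real_sequentially N])
  have sN: "filterlim (\<lambda>n. sqrt (real (N n))) at_infinity sequentially"
    by (rule filterlim_at_top_imp_at_infinity[OF filterlim_compose[OF sqrt_at_top NR]])
  \<comment> \<open>Each summand is \<open>N n\<close> times an error of one factor: Taylor
    remainder, variance differing from 1, and quadratic error in expanding the Gaussian.\<close>
  define E where "E n = D * \<bar>v\<bar> ^ 3 / sqrt (real (N n)) + v\<^sup>2 * \<bar>var n - 1\<bar> / 2 + v ^ 4 / 4 / real (N n)" for n
  have "(\<lambda>n. \<bar>var n - 1\<bar>) \<longlonglongrightarrow> \<bar>1 - 1\<bar>"
    by (intro tendsto_intros var_tendsto)
  then have "E \<longlonglongrightarrow> 0 + v\<^sup>2 * 0 / 2 + 0"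
    unfolding E_def[abs_def]
    by (intro tendsto_add tendsto_divide tendsto_mult tendsto_const tendsto_divide_0[OF tendsto_const sN]
        tendsto_divide_0[OF tendsto_const filterlim_at_top_imp_at_infinity[OF NR]]) auto
  then have E0: "E \<longlonglongrightarrow> 0" by simp
  have "\<forall>\<^sub>F n in sequentially. N n \<ge> 1"
    using N by (simp add: filterlim_at_top)
  then have "\<forall>\<^sub>F n in sequentially. cmod (centred_char n (v / sqrt (real (N n))) ^ N n - complex_of_real (exp (- v\<^sup>2 / 2))) \<le> E n"
  proof eventually_elim
    case (elim n)
    define m where "m = real (N n)"
    define w where "w = v / sqrt m"
    have m: "m \<ge> 1" using elim by (simp add: m_def)
    have w2: "w\<^sup>2 = v\<^sup>2 / m" using m by (simp add: w_def power_divide)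
    have mw3: "m * \<bar>w\<bar> ^ 3 = \<bar>v\<bar> ^ 3 / sqrt m"
    proof -
      have "m * \<bar>w\<bar> ^ 3 = (m * w\<^sup>2) * \<bar>w\<bar>" by (simp add: power3_eq_cube power2_eq_square flip: abs_mult)
      also have "m * w\<^sup>2 = v\<^sup>2" using m by (simp add: w2)
      also have "v\<^sup>2 * \<bar>w\<bar> = \<bar>v\<bar> ^ 3 / sqrt m" using m by (simp add: w_def power3_eq_cube power2_eq_square flip: abs_mult)
      finally show ?thesis .
    qed
    have pw: "exp (- v\<^sup>2 / 2) = exp (- (w\<^sup>2 / 2)) ^ N n"
      using m by (simp add: w2 exp_of_nat_mult[symmetric] flip: m_def)
    have "cmod (centred_char n w - complex_of_real (exp (- (w\<^sup>2 / 2)))) \<le>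
        cmod (centred_char n w - complex_of_real (1 - w\<^sup>2 * var n / 2)) + cmod (complex_of_real (1 - w\<^sup>2 * var n / 2) - complex_of_real (exp (- (w\<^sup>2 / 2))))"
      by (rule norm_diff_triangle_ineq[of "centred_char n w" _ _ 0, simplified] order_trans[OF _ norm_triangle_ineq]; simp)
    also have "cmod (complex_of_real (1 - w\<^sup>2 * var n / 2) - complex_of_real (exp (- (w\<^sup>2 / 2)))) = \<bar>1 - w\<^sup>2 * var n / 2 - exp (- (w\<^sup>2 / 2))\<bar>"
      by (simp only: of_real_diff[symmetric] norm_of_real)
    also have "\<dots> \<le> w\<^sup>2 * \<bar>var n - 1\<bar> / 2 + (w\<^sup>2 / 2)\<^sup>2"
    proof -
      have "1 - w\<^sup>2 * var n / 2 - exp (- (w\<^sup>2 / 2)) = w\<^sup>2 * (1 - var n) / 2 - (exp (- (w\<^sup>2 / 2)) - (1 - w\<^sup>2 / 2))"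
        by (simp add: field_simps)
      also have "\<bar>\<dots>\<bar> \<le> \<bar>w\<^sup>2 * (1 - var n) / 2\<bar> + \<bar>exp (- (w\<^sup>2 / 2)) - (1 - w\<^sup>2 / 2)\<bar>"
        by (rule abs_triangle_ineq4)
      also have "\<bar>w\<^sup>2 * (1 - var n) / 2\<bar> = w\<^sup>2 * \<bar>var n - 1\<bar> / 2" by (simp add: abs_mult abs_minus_commute)
      finally show ?thesis using exp_minus_approx[of "w\<^sup>2 / 2"] by simp
    qed
    finally have "cmod (centred_char n w - complex_of_real (exp (- (w\<^sup>2 / 2)))) \<le> D * \<bar>w\<bar> ^ 3 + (w\<^sup>2 * \<bar>var n - 1\<bar> / 2 + (w\<^sup>2 / 2)\<^sup>2)"
      using D(2)[of n w] by simp
    then have "m * cmod (centred_char n w - complex_of_real (exp (- (w\<^sup>2 / 2)))) \<le> m * (D * \<bar>w\<bar> ^ 3 + (w\<^sup>2 * \<bar>var n - 1\<bar> / 2 + (w\<^sup>2 / 2)\<^sup>2))"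
      using m by (intro mult_left_mono) auto
    also have "\<dots> = D * (m * \<bar>w\<bar> ^ 3) + (m * w\<^sup>2) * \<bar>var n - 1\<bar> / 2 + (m * w\<^sup>2) * w\<^sup>2 / 4"
      by (simp add: algebra_simps power2_eq_square)
    also have "\<dots> = E n"
    proof -
      have "m * w\<^sup>2 = v\<^sup>2" using m by (simp add: w2)
      then show ?thesis unfolding mw3 by (simp add: E_def w2 flip: m_def)
    qed
    finally have "m * cmod (centred_char n w - complex_of_real (exp (- (w\<^sup>2 / 2)))) \<le> E n" .
    moreover have "cmod (centred_char n w ^ N n - complex_of_real (exp (- (w\<^sup>2 / 2))) ^ N n) \<le> m * cmod (centred_char n w - complex_of_real (exp (- (w\<^sup>2 / 2))))"
      unfolding m_def by (rule norm_power_diff) (simp_all add: cmod_centred_char_le_1)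
    ultimately show ?case
      unfolding pw by (simp add: w_def m_def)
  qed
  then show ?thesis
    by (subst Lim_null) (rule Lim_null_comparison[OF _ E0])
qed

text \<open>Where \<bar>v\<bar> is at most \<delta> sqrt N the integrand is dominated by a fixed
  Gaussian. Beyond, N - 2 factors are at most \<kappa> and the other two are integrated by the L2
  bound, which costs only sqrt N after rescaling. The limit is 2 pi times the standard normal
  density at 0.\<close>

theorem local_limit:
  assumes N: "filterlim N at_top sequentially" and z: "z \<longlonglongrightarrow> 0"
  shows "(\<lambda>n. CLBINT v. iexp (- (v * z n)) * centred_char n (v / sqrt (real (N n))) ^ N n) \<longlonglongrightarrow> complex_of_real (sqrt (2 * pi))"
proof -
  let ?c = "\<lambda>n v. cmod (centred_char n (v / sqrt (real (N n))))"
  define F where "F n v = iexp (- (v * z n)) * centred_char n (v / sqrt (real (N n))) ^ N n" for n v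
  have F_meas [measurable]: "F n \<in> borel_measurable borel" for n
    unfolding F_def[abs_def] by measurable
  have F_norm: "cmod (F n v) = ?c n v ^ N n" for n v
    by (simp add: F_def norm_mult norm_power)
  obtain \<delta> where \<delta>: "\<delta> > 0" "\<forall>\<^sub>F n in sequentially. \<forall>w. \<bar>w\<bar> \<le> \<delta> \<longrightarrow> cmod (centred_char n w) \<le> exp (- w\<^sup>2 / 4)"
    using centred_char_near_0 by auto
  obtain \<kappa> where \<kappa>: "0 < \<kappa>" "\<kappa> < 1" "\<forall>\<^sub>F n in sequentially. \<forall>w. \<delta> \<le> \<bar>w\<bar> \<longrightarrow> cmod (centred_char n w) \<le> \<kappa>"
    using centred_char_away_0[OF \<delta>(1)] by auto
  have "\<forall>\<^sub>F n in sequentially. N n \<ge> 2"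
    using N by (simp add: filterlim_at_top)
  with \<delta>(2) \<kappa>(3) have "\<forall>\<^sub>F n in sequentially. N n \<ge> 2 \<and> (\<forall>w. \<bar>w\<bar> \<le> \<delta> \<longrightarrow> cmod (centred_char n w) \<le> exp (- w\<^sup>2 / 4)) \<and>
      (\<forall>w. \<delta> \<le> \<bar>w\<bar> \<longrightarrow> cmod (centred_char n w) \<le> \<kappa>)"
    by eventually_elim auto
  then obtain n0 where n0: "\<And>n. n \<ge> n0 \<Longrightarrow> N n \<ge> 2"
    "\<And>n w. n \<ge> n0 \<Longrightarrow> \<bar>w\<bar> \<le> \<delta> \<Longrightarrow> cmod (centred_char n w) \<le> exp (- w\<^sup>2 / 4)"
    "\<And>n w. n \<ge> n0 \<Longrightarrow> \<delta> \<le> \<bar>w\<bar> \<Longrightarrow> cmod (centred_char n w) \<le> \<kappa>"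
    unfolding eventually_sequentially by auto
  define I where "I n = {- \<delta> * sqrt (real (N n))..\<delta> * sqrt (real (N n))}" for n
  have I_meas [measurable]: "I n \<in> sets borel" for n by (simp add: I_def)
  have in_I: "v \<in> I n \<longleftrightarrow> \<bar>v / sqrt (real (N n))\<bar> \<le> \<delta>" if "n \<ge> n0" for n v
    using n0(1)[OF that] by (auto simp: I_def abs_le_iff field_simps)
  have sq_int: "integrable lborel (\<lambda>v. (?c n v)\<^sup>2)"
    "(LINT v|lborel. (?c n v)\<^sup>2) \<le> sqrt (real (N n)) * (2 * pi * C)" if "n \<ge> n0" for n
  proof -
    have s: "0 < sqrt (real (N n))" using n0(1)[OF that] by simp
    then show "integrable lborel (\<lambda>v. (?c n v)\<^sup>2)"
      using lborel_integrable_real_affine[OF integrable_centred_char_sq[of n], of "1 / sqrt (real (N n))" 0] by simp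
    have "(LINT v|lborel. (?c n v)\<^sup>2) = sqrt (real (N n)) * (LINT w|lborel. (cmod (centred_char n w))\<^sup>2)"
      using s lborel_integral_real_affine[of "1 / sqrt (real (N n))" "\<lambda>w. (cmod (centred_char n w))\<^sup>2" 0] by simp
    also have "\<dots> \<le> sqrt (real (N n)) * (2 * pi * C)"
      by (intro mult_left_mono integral_centred_char_sq) simp
    finally show "(LINT v|lborel. (?c n v)\<^sup>2) \<le> sqrt (real (N n)) * (2 * pi * C)" .
  qed
  have F_le_sq: "cmod (F n v) \<le> (?c n v)\<^sup>2" if "n \<ge> n0" for n v
    unfolding F_norm by (rule power_decreasing[OF n0(1)[OF that]]) (auto simp: cmod_centred_char_le_1)
  have F_int: "integrable lborel (F n)" if "n \<ge> n0" for n
    by (rule Bochner_Integration.integrable_bound[OF sq_int(1)[OF that]]) (use F_le_sq[OF that] in auto)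
  have gauss: "integrable lborel (\<lambda>v::real. exp (- v\<^sup>2 / (2 * s\<^sup>2)))" if "s > 0" for s :: real
  proof -
    have "integrable lborel (\<lambda>v. sqrt (2 * pi * s\<^sup>2) * normal_density 0 s v)"
      using that by (intro integrable_mult_right integrable_normal_density)
    then show ?thesis using that by (simp add: normal_density_def)
  qed
  \<comment> \<open>The index is shifted by \<open>n0\<close> because domination must hold for every
    index, and the estimates hold only from \<open>n0\<close> on.\<close>
  have A: "(\<lambda>n. CLBINT v. indicator (I (n + n0)) v *\<^sub>R F (n + n0) v) \<longlonglongrightarrow> (CLBINT v. complex_of_real (exp (- v\<^sup>2 / 2)))"
  proof (rule integral_dominated_convergence)
    show "integrable lborel (\<lambda>v::real. exp (- v\<^sup>2 / 4))" using gauss[of "sqrt 2"] by simp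
    show "AE v in lborel. norm (indicator (I (n + n0)) v *\<^sub>R F (n + n0) v) \<le> exp (- v\<^sup>2 / 4)" for n
    proof (rule AE_I2)
      fix v
      let ?n = "n + n0"
      show "norm (indicator (I ?n) v *\<^sub>R F ?n v) \<le> exp (- v\<^sup>2 / 4)"
      proof (cases "v \<in> I ?n")
        case True
        have "cmod (F ?n v) \<le> exp (- (v / sqrt (real (N ?n)))\<^sup>2 / 4) ^ N ?n"
          unfolding F_norm using True in_I[of ?n v] by (intro power_mono n0(2)) auto
        also have "\<dots> = exp (- v\<^sup>2 / 4)"
          using n0(1)[of ?n] by (simp add: exp_of_nat_mult[symmetric] power_divide)
        finally show ?thesis using True by simp
      qed simp
    qed
    show "AE v in lborel. (\<lambda>n. indicator (I (n + n0)) v *\<^sub>R F (n + n0) v) \<longlonglongrightarrow> complex_of_real (exp (- v\<^sup>2 / 2))"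
    proof (rule AE_I2)
      fix v
      have "(\<lambda>n. iexp (- (v * z n))) \<longlonglongrightarrow> iexp (- (v * 0))"
        by (intro tendsto_intros z)
      from tendsto_mult[OF this centred_char_power_tendsto[OF N, of v]]
      have lim: "(\<lambda>n. F n v) \<longlonglongrightarrow> complex_of_real (exp (- v\<^sup>2 / 2))" by (simp add: F_def)
      have "filterlim (\<lambda>n. sqrt (real (N n))) at_top sequentially"
        by (rule filterlim_compose[OF sqrt_at_top filterlim_compose[OF filterlim_real_sequentially N]])
      then have "\<forall>\<^sub>F n in sequentially. sqrt (real (N n)) \<ge> \<bar>v\<bar> / \<delta>"
        by (simp add: filterlim_at_top)
      then have ev: "\<forall>\<^sub>F n in sequentially. F n v = indicator (I n) v *\<^sub>R F n v"
        by eventually_elim (use \<delta>(1) in \<open>auto simp: I_def indicator_def field_simps abs_le_iff\<close>)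
      have "(\<lambda>n. indicator (I n) v *\<^sub>R F n v) \<longlonglongrightarrow> complex_of_real (exp (- v\<^sup>2 / 2))"
        by (rule Lim_transform_eventually[OF lim ev])
      then show "(\<lambda>n. indicator (I (n + n0)) v *\<^sub>R F (n + n0) v) \<longlonglongrightarrow> complex_of_real (exp (- v\<^sup>2 / 2))"
        by (rule LIMSEQ_ignore_initial_segment)
    qed
  qed auto
  have "(CLBINT v. complex_of_real (exp (- v\<^sup>2 / 2))) = complex_of_real (LINT v|lborel. sqrt (2 * pi) * std_normal_density v)"
    by (simp only: integral_complex_of_real) (simp add: std_normal_density_def)
  also have "\<dots> = complex_of_real (sqrt (2 * pi))" by simp
  finally have lim_val: "(CLBINT v. complex_of_real (exp (- v\<^sup>2 / 2))) = complex_of_real (sqrt (2 * pi))" .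
  have B: "(\<lambda>n. CLBINT v. indicator (- I (n + n0)) v *\<^sub>R F (n + n0) v) \<longlonglongrightarrow> 0"
  proof (rule Lim_null_comparison)
    \<comment> \<open>From \<kappa>^(N-2) sqrt N (2 pi C), with sqrt N replaced by N and two factors
      \<kappa> moved to the denominator.\<close>
    let ?b = "\<lambda>m::nat. real m * \<kappa> ^ m * (2 * pi * C / \<kappa>\<^sup>2)"
    have "(\<lambda>m. real m * \<kappa> ^ m) \<longlonglongrightarrow> 0"
      using powser_times_n_limit_0[of \<kappa>] \<kappa> by simp
    then have "?b \<longlonglongrightarrow> 0" by (rule tendsto_mult_left_zero)
    then have "(\<lambda>n. ?b (N n)) \<longlonglongrightarrow> 0" by (rule filterlim_compose[OF _ N])
    then show "(\<lambda>n. ?b (N (n + n0))) \<longlonglongrightarrow> 0" by (rule LIMSEQ_ignore_initial_segment)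
    show "\<forall>\<^sub>F n in sequentially. norm (CLBINT v. indicator (- I (n + n0)) v *\<^sub>R F (n + n0) v) \<le> ?b (N (n + n0))"
    proof (intro always_eventually allI)
      fix n
      let ?n = "n + n0"
      have n: "?n \<ge> n0" by simp
      have "norm (CLBINT v. indicator (- I ?n) v *\<^sub>R F ?n v) \<le> (LINT v|lborel. norm (indicator (- I ?n) v *\<^sub>R F ?n v))"
        by (rule integral_norm_bound)
      also have "\<dots> \<le> (LINT v|lborel. \<kappa> ^ (N ?n - 2) * (?c ?n v)\<^sup>2)"
      proof (rule integral_mono')
        show "integrable lborel (\<lambda>v. \<kappa> ^ (N ?n - 2) * (?c ?n v)\<^sup>2)"
          by (intro integrable_mult_right sq_int n)
        fix v
        show "norm (indicator (- I ?n) v *\<^sub>R F ?n v) \<le> \<kappa> ^ (N ?n - 2) * (?c ?n v)\<^sup>2"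
        proof (cases "v \<in> I ?n")
          case False
          let ?d = "?c ?n v"
          have "?d \<le> \<kappa>" using False in_I[OF n, of v] by (intro n0(3) n) auto
          then have "?d ^ (N ?n - 2) * ?d\<^sup>2 \<le> \<kappa> ^ (N ?n - 2) * ?d\<^sup>2"
            by (intro mult_right_mono power_mono) auto
          moreover have "?d ^ (N ?n - 2) * ?d\<^sup>2 = ?d ^ N ?n"
            using n0(1)[OF n] by (simp only: power_add[symmetric] le_add_diff_inverse2)
          ultimately show ?thesis using False by (simp add: F_norm)
        qed (use \<kappa> in simp)
        show "0 \<le> \<kappa> ^ (N ?n - 2) * (?c ?n v)\<^sup>2"
          using \<kappa> by simp
      qed
      also have "\<dots> \<le> \<kappa> ^ (N ?n - 2) * (sqrt (real (N ?n)) * (2 * pi * C))"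
        using sq_int(2)[OF n] \<kappa> by (simp add: mult_left_mono)
      also have "\<dots> \<le> \<kappa> ^ (N ?n - 2) * (real (N ?n) * (2 * pi * C))"
      proof -
        have "sqrt (real (N ?n)) \<le> real (N ?n)"
          using n0(1)[OF n] by (intro real_le_lsqrt) (auto simp: power2_eq_square)
        then show ?thesis using \<kappa> C_nonneg by (intro mult_left_mono mult_right_mono) auto
      qed
      also have "\<dots> = ?b (N ?n)"
        using n0(1)[OF n] \<kappa> by (simp add: power_diff)
      finally show "norm (CLBINT v. indicator (- I ?n) v *\<^sub>R F ?n v) \<le> ?b (N ?n)" .
    qed
  qed
  have split: "(CLBINT v. F n v) = (CLBINT v. indicator (I n) v *\<^sub>R F n v) + (CLBINT v. indicator (- I n) v *\<^sub>R F n v)" if "n \<ge> n0" for n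
  proof -
    have "(CLBINT v. indicator (I n) v *\<^sub>R F n v) + (CLBINT v. indicator (- I n) v *\<^sub>R F n v) =
       (CLBINT v. indicator (I n) v *\<^sub>R F n v + indicator (- I n) v *\<^sub>R F n v)"
      using F_int[OF that] by (intro Bochner_Integration.integral_add[symmetric] integrable_mult_indicator) auto
    also have "\<dots> = (CLBINT v. F n v)"
      by (intro Bochner_Integration.integral_cong refl) (auto simp: indicator_def)
    finally show ?thesis ..
  qed
  have "(\<lambda>n. CLBINT v. F (n + n0) v) \<longlonglongrightarrow> complex_of_real (sqrt (2 * pi)) + 0"
    using tendsto_add[OF A[unfolded lim_val] B] by (simp only: split[OF le_add2])
  then have "(\<lambda>n. CLBINT v. F n v) \<longlonglongrightarrow> complex_of_real (sqrt (2 * pi))"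
    by (simp add: LIMSEQ_offset)
  then show ?thesis by (simp add: F_def)
qed

end

section \<open>Exponential tilting\<close>

lemma real_distribution_density:
  fixes f :: "real \<Rightarrow> real"
  assumes "integrable lborel f" "\<And>x. 0 \<le> f x" "(LINT x|lborel. f x) = 1"
  shows "real_distribution (density lborel (\<lambda>x. ennreal (f x)))"
proof -
  have "emeasure (density lborel (\<lambda>x. ennreal (f x))) UNIV = (\<integral>\<^sup>+x. ennreal (f x) \<partial>lborel)"
    using borel_measurable_integrable[OF assms(1)] by (subst emeasure_density) auto
  also have "\<dots> = 1"
    by (subst nn_integral_eq_integral) (use assms in auto)
  finally have "prob_space (density lborel (\<lambda>x. ennreal (f x)))" by (intro prob_spaceI) simp
  then show ?thesis
    unfolding real_distribution_def real_distribution_axioms_def by simp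
qed

lemma exp_second_order: "\<bar>exp y - 1 - y\<bar> \<le> y\<^sup>2 * exp \<bar>y\<bar>" for y :: real
proof -
  obtain s where s: "\<bar>s\<bar> \<le> \<bar>y\<bar>" "exp y = (\<Sum>m<2. y ^ m / fact m) + exp s / fact 2 * y ^ 2"
    using Maclaurin_exp_le[of y 2] by auto
  then have "\<bar>exp y - 1 - y\<bar> = exp s / 2 * y\<^sup>2" by (simp add: numeral_2_eq_2)
  also have "\<dots> \<le> exp \<bar>y\<bar> * y\<^sup>2"
  proof (rule mult_right_mono)
    have "exp s \<le> exp \<bar>y\<bar>" using s(1) by simp
    then show "exp s / 2 \<le> exp \<bar>y\<bar>" using exp_gt_zero[of s] by linarith
  qed simp
  finally show ?thesis by (simp add: mult.commute)
qed

text \<open>Boundedness of every tilt serves twice: spare exponential factors give all moments of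
  all tilts, and each tilted density is bounded, hence has a square integrable characteristic
  function. Positivity on the half-line keeps mgf and variance positive.\<close>

locale tiltable_density =
  fixes p :: "real \<Rightarrow> real"
  assumes p_measurable [measurable]: "p \<in> borel_measurable borel"
    and p_nonneg: "\<And>x. 0 \<le> p x"
    and p_neg: "\<And>x. x < 0 \<Longrightarrow> p x = 0"
    and p_pos: "\<And>x. 0 \<le> x \<Longrightarrow> 0 < p x"
    and p_tilt_bounded: "\<And>t. \<exists>B. \<forall>x. exp (t * x) * p x \<le> B"
begin

text \<open>The bound for the tilt at \<open>t + 1\<close> leaves a factor exp(-x) on the
  half-line.\<close>

lemma tilt_integrable: "integrable lborel (\<lambda>x. exp (t * x) * p x)"
proof -
  obtain B where B: "\<And>x. exp ((t + 1) * x) * p x \<le> B" using p_tilt_bounded by blast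
  have B0: "0 \<le> B" using B[of "-1"] p_neg[of "-1"] by simp
  have "integrable lborel (\<lambda>x::real. B * (exp 0 * (\<bar>x\<bar> ^ 0 * exp (- \<bar>x\<bar> / 2))))"
    by (intro integrable_mult_right integrable_power_times_exp)
  then show ?thesis
  proof (rule Bochner_Integration.integrable_bound)
    show "AE x in lborel. norm (exp (t * x) * p x) \<le> norm (B * (exp 0 * (\<bar>x\<bar> ^ 0 * exp (- \<bar>x\<bar> / 2))))"
    proof (rule AE_I2)
      fix x :: real
      show "norm (exp (t * x) * p x) \<le> norm (B * (exp 0 * (\<bar>x\<bar> ^ 0 * exp (- \<bar>x\<bar> / 2))))"
      proof (cases "x < 0")
        case False
        have "exp (t * x) * p x = exp ((t + 1) * x) * p x * exp (- x)"
          by (simp add: exp_add[symmetric] algebra_simps flip: exp_add)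
        also have "\<dots> \<le> B * exp (- x)" by (intro mult_right_mono B) simp
        also have "\<dots> \<le> B * exp (- \<bar>x\<bar> / 2)" using False B0 by (intro mult_left_mono) auto
        finally show ?thesis using B0 p_nonneg[of x] by (simp add: abs_mult)
      qed (simp add: p_neg)
    qed
  qed measurable
qed

lemma power_tilt_integrable: "integrable lborel (\<lambda>x. x ^ k * (exp (t * x) * p x))"
proof (rule Bochner_Integration.integrable_bound)
  show "integrable lborel (\<lambda>x. 2 ^ k * fact k * (exp ((t + 1 / 2) * x) * p x))"
    by (intro integrable_mult_right tilt_integrable)
  show "AE x in lborel. norm (x ^ k * (exp (t * x) * p x)) \<le> norm (2 ^ k * fact k * (exp ((t + 1 / 2) * x) * p x))"
  proof (rule AE_I2)
    fix x :: real
    show "norm (x ^ k * (exp (t * x) * p x)) \<le> norm (2 ^ k * fact k * (exp ((t + 1 / 2) * x) * p x))"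
    proof (cases "x < 0")
      case False
      have "x ^ k = x ^ k * exp (- x / 2) * exp (x / 2)" by (simp add: mult.assoc flip: exp_add)
      also have "\<dots> \<le> 2 ^ k * fact k * exp (x / 2)"
        using False by (intro mult_right_mono power_times_exp_le) auto
      finally have "x ^ k * (exp (t * x) * p x) \<le> 2 ^ k * fact k * exp (x / 2) * (exp (t * x) * p x)"
        by (rule mult_right_mono) (simp add: p_nonneg)
      also have "\<dots> = 2 ^ k * fact k * (exp ((t + 1 / 2) * x) * p x)"
        by (simp add: distrib_right exp_add)
      finally show ?thesis using False p_nonneg[of x] by (simp add: abs_mult)
    qed (simp add: p_neg)
  qed
qed measurable

text \<open>Without normalisation, differentiation in \<open>t\<close> just raises the index; index
  0 is the mgf.\<close>

definition moment :: "nat \<Rightarrow> real \<Rightarrow> real" where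
  "moment k t = (LINT x|lborel. x ^ k * (exp (t * x) * p x))"

lemma mgf_eq_moment: "mgf p t = moment 0 t"
  unfolding mgf_def moment_def set_lebesgue_integral_def
  by (intro Bochner_Integration.integral_cong refl) (auto simp: indicator_def p_neg)

text \<open>Differentiation under the integral by hand: the second-order remainder of the
  exponential is dominated by d^2 times the integrand of the moment \<open>k + 2\<close> at
  \<open>t + 1\<close>, so the difference quotient is off by O(d).\<close>

lemma moment_has_derivative: "(moment k has_real_derivative moment (Suc k) t) (at t)"
proof -
  let ?w = "\<lambda>k t x. x ^ k * (exp (t * x) * p x)"
  define K where "K = (LINT x|lborel. ?w (k + 2) (t + 1) x)"
  have quot: "\<bar>(moment k (t + d) - moment k t) / d - moment (Suc k) t\<bar> \<le> K * \<bar>d\<bar>" if d: "\<bar>d\<bar> \<le> 1" "d \<noteq> 0" for d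
  proof -
    have eq: "moment k (t + d) - moment k t - d * moment (Suc k) t = (LINT x|lborel. ?w k (t + d) x
        - ?w k t x - d * ?w (Suc k) t x)"
      unfolding moment_def using power_tilt_integrable by (simp del: power_Suc)
    have "\<bar>moment k (t + d) - moment k t - d * moment (Suc k) t\<bar> \<le> (LINT x|lborel. d\<^sup>2 * ?w (k + 2) (t + 1) x)"
      unfolding eq
    proof (rule order_trans[OF integral_abs_bound integral_mono'])
      show "integrable lborel (\<lambda>x. d\<^sup>2 * ?w (k + 2) (t + 1) x)"
        by (intro integrable_mult_right power_tilt_integrable)
      fix x :: real
      have *: "\<bar>?w k (t + d) x - ?w k t x - d * ?w (Suc k) t x\<bar>
         \<le> d\<^sup>2 * ?w (k + 2) (t + 1) x \<and> 0 \<le> d\<^sup>2 * ?w (k + 2) (t + 1) x"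
      proof (cases "x < 0")
        case False
        let ?v = "?w k t x"
        have w: "0 \<le> ?v" using False p_nonneg[of x] by simp
        have "?w k (t + d) x - ?w k t x - d * ?w (Suc k) t x
           = ?v * (exp (d * x) - 1 - d * x)"
          by (simp add: algebra_simps exp_add)
        also have "\<bar>\<dots>\<bar> = ?v * \<bar>exp (d * x) - 1 - d * x\<bar>" by (subst abs_mult) (simp only: abs_of_nonneg[OF w])
        also have "\<dots> \<le> ?v * ((d * x)\<^sup>2 * exp \<bar>d * x\<bar>)" by (intro mult_left_mono exp_second_order w)
        \<comment> \<open>For \<open>\<bar>d\<bar> \<le> 1\<close> and \<open>x \<ge> 0\<close> the
          growth of the remainder costs one unit of tilt.\<close>
        also have "\<dots> \<le> ?v * ((d * x)\<^sup>2 * exp x)"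
          using False d mult_right_mono[of "\<bar>d\<bar>" 1 x] by (intro mult_left_mono w) (auto simp: abs_mult)
        also have "\<dots> = d\<^sup>2 * ?w (k + 2) (t + 1) x"
          by (simp add: algebra_simps exp_add power2_eq_square)
        finally show ?thesis using False p_nonneg[of x] by simp
      qed (simp add: p_neg)
      show "\<bar>?w k (t + d) x - ?w k t x - d * ?w (Suc k) t x\<bar>
         \<le> d\<^sup>2 * ?w (k + 2) (t + 1) x" using * by simp
      show "0 \<le> d\<^sup>2 * ?w (k + 2) (t + 1) x" using * by simp
    qed
    also have "\<dots> = d\<^sup>2 * K" unfolding K_def by (rule integral_mult_right_zero)
    finally have 1: "\<bar>moment k (t + d) - moment k t - d * moment (Suc k) t\<bar> \<le> d\<^sup>2 * K" .
    have "\<bar>(moment k (t + d) - moment k t) / d - moment (Suc k) t\<bar> = \<bar>moment k (t + d) - moment k t - d * moment (Suc k) t\<bar> / \<bar>d\<bar>"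
      using d(2) by (subst abs_divide[symmetric]) (simp add: diff_divide_distrib)
    also have "\<dots> \<le> d\<^sup>2 * K / \<bar>d\<bar>" by (intro divide_right_mono 1) simp
    also have "\<dots> = K * \<bar>d\<bar>" proof -
      have "d\<^sup>2 = \<bar>d\<bar> * \<bar>d\<bar>" by (simp add: power2_eq_square)
      then show ?thesis using d(2) by (simp del: abs_mult_self_eq)
    qed
    finally show ?thesis .
  qed
  have "\<forall>\<^sub>F d in at 0. \<bar>d\<bar> \<le> (1::real) \<and> d \<noteq> 0"
    unfolding eventually_at by (intro exI[of _ 1]) auto
  then have ev: "\<forall>\<^sub>F d in at 0. norm ((moment k (t + d) - moment k t) / d - moment (Suc k) t) \<le> K * \<bar>d\<bar>"
    by eventually_elim (use quot in auto)
  have "((\<lambda>d. K * \<bar>d\<bar>) \<longlongrightarrow> K * \<bar>0\<bar>) (at (0::real))"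
    by (intro tendsto_intros)
  then have "((\<lambda>d. K * \<bar>d\<bar>) \<longlongrightarrow> 0) (at (0::real))" by simp
  then have "((\<lambda>d. (moment k (t + d) - moment k t) / d - moment (Suc k) t) \<longlongrightarrow> 0) (at 0)"
    by (rule Lim_null_comparison[OF ev])
  then show ?thesis
    unfolding DERIV_def by (subst Lim_null)
qed

lemma mgf_pos: "0 < mgf p t"
proof -
  have "0 \<le> mgf p t" unfolding mgf_eq_moment moment_def by (intro Bochner_Integration.integral_nonneg) (simp add: p_nonneg)
  moreover have "mgf p t \<noteq> 0"
  proof
    assume "mgf p t = 0"
    then have "AE x in lborel. exp (t * x) * p x = 0"
      using integral_nonneg_eq_0_iff_AE[OF tilt_integrable[of t]] by (simp add: mgf_eq_moment moment_def p_nonneg)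
    then have "AE x in lborel. x \<notin> {0..1::real}"
      by eventually_elim (use p_pos in \<open>force simp: less_le\<close>)
    then have "emeasure lborel {0..1::real} = 0"
      by (subst (asm) AE_iff_measurable[of "{0..1}"]) auto
    then show False by simp
  qed
  ultimately show ?thesis by simp
qed

lemma tilted_mean_eq: "tilted_mean p t = moment 1 t / moment 0 t"
proof -
  have "((\<lambda>s. ln (mgf p s)) has_real_derivative moment 1 t / moment 0 t) (at t)"
    unfolding mgf_eq_moment using moment_has_derivative[of 0 t] mgf_pos[of t, unfolded mgf_eq_moment]
    by (auto intro!: derivative_eq_intros simp: field_simps)
  then show ?thesis unfolding tilted_mean_def by (rule DERIV_imp_deriv)
qed

lemma ln_mgf_has_derivative: "((\<lambda>s. ln (mgf p s)) has_real_derivative tilted_mean p t) (at t)"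
  unfolding tilted_mean_eq mgf_eq_moment using moment_has_derivative[of 0 t] mgf_pos[of t, unfolded mgf_eq_moment]
  by (auto intro!: derivative_eq_intros simp: field_simps)

text \<open>The centred form makes positivity visible; that this is the derivative of the tilted
  mean is proved next.\<close>

definition tilted_variance :: "real \<Rightarrow> real" where
  "tilted_variance t = (LINT x|lborel. (x - tilted_mean p t)\<^sup>2 * (exp (t * x) * p x)) / mgf p t"

lemma tilted_mean_has_derivative: "(tilted_mean p has_real_derivative tilted_variance t) (at t)"
proof -
  let ?w = "\<lambda>k x. x ^ k * (exp (t * x) * p x)"
  have pos: "0 < moment 0 s" for s using mgf_pos[of s] by (simp add: mgf_eq_moment)
  let ?m = "tilted_mean p t"
  have "(LINT x|lborel. (x - ?m)\<^sup>2 * (exp (t * x) * p x)) =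
     (LINT x|lborel. ?w 2 x - 2 * ?m * ?w 1 x + ?m\<^sup>2 * ?w 0 x)"
    by (intro Bochner_Integration.integral_cong refl) (simp add: power2_eq_square algebra_simps)
  also have "\<dots> = (LINT x|lborel. ?w 2 x - 2 * ?m * ?w 1 x) + (LINT x|lborel. ?m\<^sup>2 * ?w 0 x)"
    by (intro Bochner_Integration.integral_add Bochner_Integration.integrable_diff integrable_mult_right power_tilt_integrable)
  also have "(LINT x|lborel. ?w 2 x - 2 * ?m * ?w 1 x) = moment 2 t - (LINT x|lborel. 2 * ?m * ?w 1 x)"
    unfolding moment_def by (intro Bochner_Integration.integral_diff integrable_mult_right power_tilt_integrable)
  also have "(LINT x|lborel. 2 * ?m * ?w 1 x) = 2 * ?m * moment 1 t" unfolding moment_def by (rule integral_mult_right_zero)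
  also have "(LINT x|lborel. ?m\<^sup>2 * ?w 0 x) = ?m\<^sup>2 * moment 0 t" unfolding moment_def by (rule integral_mult_right_zero)
  finally have var: "tilted_variance t = (moment 2 t * moment 0 t - moment 1 t * moment 1 t) / (moment 0 t * moment 0 t)"
    unfolding tilted_variance_def mgf_eq_moment tilted_mean_eq using pos[of t] by (simp add: field_simps power2_eq_square)
  have "((\<lambda>s. moment 1 s / moment 0 s) has_real_derivative (moment 2 t * moment 0 t - moment 1 t * moment 1 t) / (moment 0 t * moment 0 t)) (at t)"
    using DERIV_divide[OF moment_has_derivative[of 1 t] moment_has_derivative[of 0 t]] pos[of t] by (simp add: numeral_2_eq_2)
  then show ?thesis unfolding var tilted_mean_eq[abs_def] .
qed

lemma tilted_variance_pos: "0 < tilted_variance t"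
proof -
  let ?w = "\<lambda>k x. x ^ k * (exp (t * x) * p x)"
  let ?V = "\<lambda>x. (x - tilted_mean p t)\<^sup>2 * (exp (t * x) * p x)"
  let ?m = "tilted_mean p t"
  have int: "integrable lborel ?V"
  proof -
    have "integrable lborel (\<lambda>x. ?w 2 x - 2 * ?m * ?w 1 x + ?m\<^sup>2 * ?w 0 x)"
      by (intro Bochner_Integration.integrable_add Bochner_Integration.integrable_diff integrable_mult_right power_tilt_integrable)
    also have "(\<lambda>x. ?w 2 x - 2 * ?m * ?w 1 x + ?m\<^sup>2 * ?w 0 x) = ?V"
      by (simp add: fun_eq_iff power2_eq_square algebra_simps)
    finally show ?thesis .
  qed
  have "0 \<le> (LINT x|lborel. ?V x)"
    by (intro Bochner_Integration.integral_nonneg) (simp add: p_nonneg)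
  moreover have "(LINT x|lborel. ?V x) \<noteq> 0"
  proof
    assume "(LINT x|lborel. ?V x) = 0"
    then have "AE x in lborel. ?V x = 0"
      using integral_nonneg_eq_0_iff_AE[OF int] by (simp add: p_nonneg)
    moreover have "AE x in lborel. x \<noteq> ?m" by (rule AE_lborel_singleton)
    ultimately have "AE x in lborel. x \<notin> {0..1::real}"
      by eventually_elim (use p_pos in \<open>force simp: less_le\<close>)
    then have "emeasure lborel {0..1::real} = 0"
      by (subst (asm) AE_iff_measurable[of "{0..1}"]) auto
    then show False by simp
  qed
  ultimately show ?thesis unfolding tilted_variance_def using mgf_pos[of t] by simp
qed

text \<open>This gives the uniqueness on which the definite description in \<open>tilt\<close>
  depends.\<close>

lemma strict_mono_tilted_mean: "strict_mono (tilted_mean p)"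
  by (rule strict_monoI) (meson DERIV_pos_imp_increasing tilted_mean_has_derivative tilted_variance_pos)

lemma tilt_tilted_mean: "tilt p (tilted_mean p t) = t"
  unfolding tilt_def using strict_mono_tilted_mean by (auto simp: strict_mono_eq)

section \<open>Characteristic functions of tilted densities and the density of a sum\<close>

definition tilted_char :: "real \<Rightarrow> real \<Rightarrow> complex" where
  "tilted_char t \<tau> = (CLINT x|lborel. (exp (t * x) * p x / mgf p t) *\<^sub>R iexp (\<tau> * x))"

lemma integral_tilted: "(LINT x|lborel. exp (t * x) * p x / mgf p t) = 1"
  using mgf_pos[of t] by (simp add: mgf_eq_moment moment_def)

lemma integrable_tilted: "integrable lborel (\<lambda>x. exp (t * x) * p x / mgf p t)"
  by (intro integrable_divide tilt_integrable)

lemma tilted_nonneg: "0 \<le> exp (t * x) * p x / mgf p t"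
  using mgf_pos[of t] p_nonneg[of x] by simp

lemma tilted_char_eq_char: "tilted_char t = char (density lborel (\<lambda>x. ennreal (exp (t * x) * p x / mgf p t)))"
  unfolding tilted_char_def[abs_def] char_def[abs_def]
  by (subst integral_density) (auto simp: tilted_nonneg)

lemma real_distribution_tilted: "real_distribution (density lborel (\<lambda>x. ennreal (exp (t * x) * p x / mgf p t)))"
  by (intro real_distribution_density integrable_tilted tilted_nonneg integral_tilted)

text \<open>Boundedness of the density gives square integrability, hence the requirement of two
  factors; any further factors have modulus at most 1.\<close>

lemma integrable_tilted_char_power:
  assumes "2 \<le> N"
  shows "integrable lborel (\<lambda>\<tau>. tilted_char t \<tau> ^ N)"
proof -
  obtain B where B: "\<And>x. exp (t * x) * p x \<le> B" using p_tilt_bounded by blast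
  interpret T: real_distribution "density lborel (\<lambda>x. ennreal (exp (t * x) * p x / mgf p t))"
    by (rule real_distribution_tilted)
  have [measurable]: "tilted_char t \<in> borel_measurable borel"
    unfolding tilted_char_eq_char by (rule T.char_measurable)
  have "(\<integral>\<^sup>+\<tau>. ennreal ((cmod (tilted_char t \<tau>))\<^sup>2) \<partial>lborel) \<le> ennreal (2 * pi * (B / mgf p t))"
    unfolding tilted_char_eq_char
    by (rule nn_integral_cmod_char_sq_le)
      (use B tilted_nonneg mgf_pos[of t] T.prob_space_axioms in \<open>auto intro: divide_right_mono less_imp_le\<close>)
  then have "integrable lborel (\<lambda>\<tau>. (cmod (tilted_char t \<tau>))\<^sup>2)"
    by (intro integrableI_bounded) (auto simp: top_unique less_top[symmetric])
  then show ?thesis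
  proof (rule Bochner_Integration.integrable_bound)
    show "AE \<tau> in lborel. norm (tilted_char t \<tau> ^ N) \<le> norm ((cmod (tilted_char t \<tau>))\<^sup>2)"
      using T.cmod_char_le_1 assms unfolding tilted_char_eq_char
      by (intro AE_I2) (auto simp: norm_power intro!: power_decreasing)
  qed measurable
qed

text \<open>The law of the sum tilted by \<open>exp (t s)\<close> has characteristic function \<open>tilted_char t ^ N\<close>;
  inverting it and removing the tilt gives the continuous density.\<close>

lemma cont_density_sum:
  fixes M :: "'a measure" and X :: "nat \<Rightarrow> 'a \<Rightarrow> real"
  assumes M: "prob_space M" and ind: "prob_space.indep_vars M (\<lambda>_. borel) X I"
    and X: "\<And>i. i \<in> I \<Longrightarrow> distributed M lborel (X i) (\<lambda>x. ennreal (p x))"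
    and I: "finite I" "2 \<le> card I"
  shows "cont_density M (\<lambda>\<omega>. \<Sum>i\<in>I. X i \<omega>) s =
    exp (- (t * s)) * mgf p t ^ card I * inverse_char (\<lambda>\<tau>. tilted_char t \<tau> ^ card I) s"
proof -
  interpret prob_space M by (rule M)
  define N where "N = card I"
  define \<Phi> where "\<Phi> = mgf p t"
  have \<Phi>: "\<Phi> > 0" unfolding \<Phi>_def by (rule mgf_pos)
  let ?S = "\<lambda>\<omega>. \<Sum>i\<in>I. X i \<omega>"
  have X_meas: "X i \<in> borel_measurable M" if "i \<in> I" for i
    using X[OF that] by (auto simp: distributed_def)
  have S_meas [measurable]: "?S \<in> borel_measurable M"
    using X_meas by (intro borel_measurable_sum) auto
  define L where "L = distr M borel ?S"
  \<comment> \<open>The tilted law of the sum; \<open>\<Phi> ^ N\<close> is its normalisation by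
    independence.\<close>
  define \<nu> where "\<nu> = density L (\<lambda>s. ennreal (exp (t * s) / \<Phi> ^ N))"
  have single: "integrable M (\<lambda>\<omega>. f (X i \<omega>)) \<and> (LINT \<omega>|M. f (X i \<omega>)) = (CLINT x|lborel. p x *\<^sub>R f x)"
    if "i \<in> I" "f \<in> borel_measurable borel" "\<And>x. cmod (f x) = exp (t * x) / \<Phi>" for i and f :: "real \<Rightarrow> complex"
  proof
    have int: "integrable lborel (\<lambda>x. p x *\<^sub>R f x)"
    proof (rule Bochner_Integration.integrable_bound[OF integrable_tilted[of t]])
      show "(\<lambda>x. p x *\<^sub>R f x) \<in> borel_measurable lborel"
        using that(2) by measurable
    qed (use \<Phi> in \<open>auto simp: that(3) p_nonneg \<Phi>_def mult.commute\<close>)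
    have Xm: "X i \<in> measurable M lborel" using X[OF that(1)] by (auto simp: distributed_def)
    have fm: "f \<in> borel_measurable lborel" using that(2) by simp
    have d: "distr M lborel (X i) = density lborel (\<lambda>x. ennreal (p x))"
      by (rule distributed_distr_eq_density[OF X[OF that(1)]])
    show "integrable M (\<lambda>\<omega>. f (X i \<omega>))"
      unfolding integrable_distr_eq[OF Xm fm, symmetric] d
      using int fm by (subst integrable_density) (auto simp: p_nonneg)
    show "(LINT \<omega>|M. f (X i \<omega>)) = (CLINT x|lborel. p x *\<^sub>R f x)"
      unfolding integral_distr[OF Xm fm, symmetric] d
      using fm by (subst integral_density) (auto simp: p_nonneg)
  qed
  \<comment> \<open>At \<tau> = 0 this shows that \<nu> has mass 1; for general \<tau> it is its
    characteristic function.\<close>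
  have prod: "integrable M (\<lambda>\<omega>. (exp (t * ?S \<omega>) / \<Phi> ^ N) *\<^sub>R iexp (\<tau> * ?S \<omega>)) \<and>
    (CLINT \<omega>|M. (exp (t * ?S \<omega>) / \<Phi> ^ N) *\<^sub>R iexp (\<tau> * ?S \<omega>)) = tilted_char t \<tau> ^ N" for \<tau>
  proof -
    define f where "f x = (exp (t * x) / \<Phi>) *\<^sub>R iexp (\<tau> * x)" for x :: real
    have f_meas [measurable]: "f \<in> borel_measurable borel" unfolding f_def[abs_def] by measurable
    have f_norm: "cmod (f x) = exp (t * x) / \<Phi>" for x using \<Phi> by (simp add: f_def)
    have pr: "(exp (t * ?S \<omega>) / \<Phi> ^ N) *\<^sub>R iexp (\<tau> * ?S \<omega>) = (\<Prod>i\<in>I. f (X i \<omega>))" for \<omega>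
      by (simp add: f_def scaleR_conv_of_real prod.distrib sum_distrib_left exp_sum I(1) N_def
          of_real_prod prod_dividef of_real_divide del: of_real_exp)
    have ind': "indep_vars (\<lambda>_. borel) (\<lambda>i \<omega>. f (X i \<omega>)) I"
      using indep_vars_compose2[OF ind, of "\<lambda>_. f" "\<lambda>_. borel"] by simp
    have int: "integrable M (\<lambda>\<omega>. f (X i \<omega>))" if "i \<in> I" for i
      using single[OF that f_meas f_norm] by simp
    have "(CLINT \<omega>|M. f (X i \<omega>)) = tilted_char t \<tau>" if "i \<in> I" for i
      using single[OF that f_meas f_norm]
      by (simp add: tilted_char_def f_def \<Phi>_def mult.commute)
    then show ?thesis
      using indep_vars_lebesgue_integral[OF I(1) ind' int] indep_vars_integrable[OF I(1) ind' int]
      unfolding pr by (simp add: N_def)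
  qed
  have setsL [measurable_cong, simp]: "sets L = sets borel" "space L = UNIV" by (auto simp: L_def)
  have w_int: "integrable L (\<lambda>s. exp (t * s) / \<Phi> ^ N)" "(LINT s|L. exp (t * s) / \<Phi> ^ N) = 1"
  proof -
    have 1: "integrable M (\<lambda>\<omega>. complex_of_real (exp (t * ?S \<omega>) / \<Phi> ^ N))"
      "(CLINT \<omega>|M. complex_of_real (exp (t * ?S \<omega>) / \<Phi> ^ N)) = tilted_char t 0 ^ N"
      using prod[of 0] by (simp_all add: scaleR_conv_of_real)
    have "tilted_char t 0 = 1"
      unfolding tilted_char_eq_char using real_distribution.char_zero[OF real_distribution_tilted] .
    then have "complex_of_real (LINT \<omega>|M. exp (t * ?S \<omega>) / \<Phi> ^ N) = 1"
      using 1(2) by (simp only: integral_complex_of_real power_one)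
    then have "(LINT \<omega>|M. exp (t * ?S \<omega>) / \<Phi> ^ N) = 1"
      by (simp only: of_real_eq_1_iff)
    moreover have "integrable M (\<lambda>\<omega>. exp (t * ?S \<omega>) / \<Phi> ^ N)"
      using integrable_Re[OF 1(1)] by (simp only: Re_complex_of_real)
    ultimately have "integrable M (\<lambda>\<omega>. exp (t * ?S \<omega>) / \<Phi> ^ N)" "(LINT \<omega>|M. exp (t * ?S \<omega>) / \<Phi> ^ N) = 1"
      by auto
    then show "integrable L (\<lambda>s. exp (t * s) / \<Phi> ^ N)" "(LINT s|L. exp (t * s) / \<Phi> ^ N) = 1"
      unfolding L_def by (subst integrable_distr_eq integral_distr; simp)+
  qed
  have \<nu>: "real_distribution \<nu>"
  proof -
    have "emeasure \<nu> UNIV = (\<integral>\<^sup>+s. ennreal (exp (t * s) / \<Phi> ^ N) \<partial>L)"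
      unfolding \<nu>_def by (subst emeasure_density) auto
    also have "\<dots> = 1"
      using w_int \<Phi> by (subst nn_integral_eq_integral) auto
    finally have "prob_space \<nu>" by (intro prob_spaceI) (simp add: \<nu>_def)
    then show ?thesis
      unfolding real_distribution_def real_distribution_axioms_def by (simp add: \<nu>_def)
  qed
  have char_\<nu>: "char \<nu> = (\<lambda>\<tau>. tilted_char t \<tau> ^ N)"
  proof
    fix \<tau>
    have "char \<nu> \<tau> = (CLINT s|L. (exp (t * s) / \<Phi> ^ N) *\<^sub>R iexp (\<tau> * s))"
      unfolding char_def \<nu>_def using \<Phi> by (subst integral_density) auto
    also have "\<dots> = tilted_char t \<tau> ^ N"
      unfolding L_def using prod[of \<tau>] by (subst integral_distr) auto
    finally show "char \<nu> \<tau> = tilted_char t \<tau> ^ N" .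
  qed
  let ?F = "inverse_char (\<lambda>\<tau>. tilted_char t \<tau> ^ N)"
  have int: "integrable lborel (\<lambda>\<tau>. tilted_char t \<tau> ^ N)"
    using I(2) by (intro integrable_tilted_char_power) (simp add: N_def)
  have F_cont: "continuous_on UNIV ?F" by (rule continuous_on_inverse_char[OF int])
  have [measurable]: "?F \<in> borel_measurable borel" using F_cont by (rule borel_measurable_continuous_onI)
  have F0: "0 \<le> ?F s" for s
    using real_distribution.inverse_char_nonneg[OF \<nu>] int by (simp add: char_\<nu>)
  have \<nu>_F: "\<nu> = density lborel (\<lambda>s. ennreal (?F s))"
    using real_distribution.density_inverse_char[OF \<nu>] int by (simp add: char_\<nu>)
  let ?f = "\<lambda>s. exp (- (t * s)) * \<Phi> ^ N * ?F s"
  \<comment> \<open>The reciprocal weight undoes the tilt, so a continuous density of \<nu> gives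
    one of the untilted sum.\<close>
  have "L = density \<nu> (\<lambda>s. ennreal (exp (- (t * s)) * \<Phi> ^ N))"
  proof -
    have "density \<nu> (\<lambda>s. ennreal (exp (- (t * s)) * \<Phi> ^ N)) = density L (\<lambda>s. ennreal (exp (t * s) / \<Phi> ^ N) * ennreal (exp (- (t * s)) * \<Phi> ^ N))"
      unfolding \<nu>_def by (subst density_density_eq) auto
    also have "(\<lambda>s. ennreal (exp (t * s) / \<Phi> ^ N) * ennreal (exp (- (t * s)) * \<Phi> ^ N)) = (\<lambda>s. 1)"
      using \<Phi> by (auto simp: ennreal_mult[symmetric] exp_minus)
    finally show ?thesis by (simp add: density_1)
  qed
  also have "\<dots> = density lborel (\<lambda>s. ennreal (?f s))"
    unfolding \<nu>_F using \<Phi> F0 by (subst density_density_eq) (auto simp: ennreal_mult[symmetric] mult.commute)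
  finally have "distributed M lborel ?S (\<lambda>s. ennreal (?f s))"
    unfolding distributed_def L_def by (auto cong: distr_cong simp: distr_cong[of M M lborel borel])
  then have "cont_density M ?S = ?f"
    using \<Phi> F0 by (intro cont_density_eq[OF M] continuous_intros F_cont) (auto simp: less_imp_le)
  then show ?thesis by (simp add: N_def \<Phi>_def)
qed

text \<open>The density of (Y - x)/\<sigma> for Y with the density tilted by \<open>t\<close>. The
  centre \<open>x\<close> is free because Laplace's method centres at \<psi>(t), not at the tilted
  mean.\<close>

definition rescaled :: "real \<Rightarrow> real \<Rightarrow> real \<Rightarrow> real \<Rightarrow> real" where
  "rescaled t x \<sigma> u = \<sigma> * (exp (t * (x + \<sigma> * u)) * p (x + \<sigma> * u)) / mgf p t"

lemma rescaled_measurable [measurable]: "rescaled t x \<sigma> \<in> borel_measurable borel"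
  unfolding rescaled_def[abs_def] by measurable

lemma rescaled_nonneg: "0 < \<sigma> \<Longrightarrow> 0 \<le> rescaled t x \<sigma> u"
  unfolding rescaled_def using p_nonneg mgf_pos[of t] by simp

lemma integral_rescaled:
  fixes f :: "real \<Rightarrow> 'b::{banach, second_countable_topology}"
  assumes "0 < \<sigma>"
  shows "(LINT u|lborel. rescaled t x \<sigma> u *\<^sub>R f u) = (LINT v|lborel. (exp (t * v) * p v / mgf p t) *\<^sub>R f ((v - x) / \<sigma>))"
  using assms
  by (subst lborel_integral_real_affine[of \<sigma> _ x])
    (auto simp: rescaled_def simp flip: Bochner_Integration.integral_scaleR_right intro!: Bochner_Integration.integral_cong)

lemma integral_rescaled_1:
  assumes "0 < \<sigma>"
  shows "(LINT u|lborel. rescaled t x \<sigma> u) = 1"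
  using integral_rescaled[OF assms, of t x "\<lambda>_. 1::real"] integral_tilted[of t] by simp

lemma integral_rescaled_id:
  assumes "0 < \<sigma>"
  shows "(LINT u|lborel. u * rescaled t x \<sigma> u) = (tilted_mean p t - x) / \<sigma>"
proof -
  have "(LINT u|lborel. u * rescaled t x \<sigma> u) = (LINT u|lborel. rescaled t x \<sigma> u *\<^sub>R u)" by (simp add: mult.commute)
  also have "\<dots> = (LINT v|lborel. (v ^ 1 * (exp (t * v) * p v) - x * (v ^ 0 * (exp (t * v) * p v))) / (mgf p t * \<sigma>))"
    unfolding integral_rescaled[OF assms] by (intro Bochner_Integration.integral_cong refl) (simp add: field_simps)
  also have "\<dots> = (LINT v|lborel. v ^ 1 * (exp (t * v) * p v) - x * (v ^ 0 * (exp (t * v) * p v))) / (mgf p t * \<sigma>)"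
    by (rule integral_divide_zero)
  also have "(LINT v|lborel. v ^ 1 * (exp (t * v) * p v) - x * (v ^ 0 * (exp (t * v) * p v))) = moment 1 t - (LINT v|lborel. x * (v ^ 0 * (exp (t * v) * p v)))"
    unfolding moment_def by (intro Bochner_Integration.integral_diff integrable_mult_right power_tilt_integrable)
  also have "(LINT v|lborel. x * (v ^ 0 * (exp (t * v) * p v))) = x * moment 0 t"
    unfolding moment_def by (rule integral_mult_right_zero)
  finally show ?thesis
    using mgf_pos[of t] assms unfolding tilted_mean_eq mgf_eq_moment by (simp add: field_simps)
qed

lemma integral_rescaled_variance:
  assumes "0 < \<sigma>"
  shows "(LINT u|lborel. (u - (tilted_mean p t - x) / \<sigma>)\<^sup>2 * rescaled t x \<sigma> u) = tilted_variance t / \<sigma>\<^sup>2"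
proof -
  have "(LINT u|lborel. (u - (tilted_mean p t - x) / \<sigma>)\<^sup>2 * rescaled t x \<sigma> u) =
      (LINT u|lborel. rescaled t x \<sigma> u *\<^sub>R (u - (tilted_mean p t - x) / \<sigma>)\<^sup>2)" by (simp add: mult.commute)
  also have "\<dots> = (LINT v|lborel. (v - tilted_mean p t)\<^sup>2 * (exp (t * v) * p v) / (mgf p t * \<sigma>\<^sup>2))"
    unfolding integral_rescaled[OF assms]
    by (intro Bochner_Integration.integral_cong refl) (use assms in \<open>simp add: power_divide diff_divide_distrib[symmetric]\<close>)
  also have "\<dots> = (LINT v|lborel. (v - tilted_mean p t)\<^sup>2 * (exp (t * v) * p v)) / (mgf p t * \<sigma>\<^sup>2)"
    by (rule integral_divide_zero)
  finally show ?thesis unfolding tilted_variance_def by simp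
qed

lemma char_rescaled:
  assumes "0 < \<sigma>"
  shows "char (density lborel (\<lambda>u. ennreal (rescaled t x \<sigma> u))) w = iexp (- (w * x / \<sigma>)) * tilted_char t (w / \<sigma>)"
proof -
  have "char (density lborel (\<lambda>u. ennreal (rescaled t x \<sigma> u))) w = (CLBINT u. rescaled t x \<sigma> u *\<^sub>R iexp (w * u))"
    unfolding char_def by (subst integral_density) (auto simp: rescaled_nonneg[OF assms])
  also have "\<dots> = (CLBINT v. iexp (- (w * x / \<sigma>)) * ((exp (t * v) * p v / mgf p t) *\<^sub>R iexp (w / \<sigma> * v)))"
    unfolding integral_rescaled[OF assms]
    by (intro Bochner_Integration.integral_cong refl)
      (simp add: scaleR_conv_of_real exp_diff exp_minus field_simps diff_divide_distrib)
  also have "\<dots> = iexp (- (w * x / \<sigma>)) * tilted_char t (w / \<sigma>)"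
    unfolding tilted_char_def by (rule integral_mult_right_zero)
  finally show ?thesis .
qed

text \<open>The substitution \<tau> = v/(\<sigma> sqrt N). The phase of the shift by
  \<open>x\<close> and the centring phase for \<open>(m - x) / \<sigma>\<close> combine to one in
  \<open>m\<close> alone, so the choice of \<open>x\<close> does not affect the value.\<close>

lemma inverse_char_rescaled:
  fixes \<sigma> t :: real and N :: nat
  assumes \<sigma>: "0 < \<sigma>" and N: "0 < N"
  defines "m \<equiv> tilted_mean p t"
  shows "inverse_char (\<lambda>\<tau>. tilted_char t \<tau> ^ N) s =
    Re (CLBINT v. iexp (- (v * ((s - real N * m) / (\<sigma> * sqrt (real N))))) *
      (iexp (- (v / sqrt (real N) * ((m - x) / \<sigma>))) * char (density lborel (\<lambda>u. ennreal (rescaled t x \<sigma> u))) (v / sqrt (real N))) ^ N)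
    / (2 * pi * (\<sigma> * sqrt (real N)))"
proof -
  let ?c = "char (density lborel (\<lambda>u. ennreal (rescaled t x \<sigma> u)))"
  let ?r = "sqrt (real N)"
  have r: "0 < ?r" "?r * ?r = real N" using N by auto
  have "(CLBINT \<tau>. iexp (- (\<tau> * s)) * tilted_char t \<tau> ^ N) =
      \<bar>1 / (\<sigma> * ?r)\<bar> *\<^sub>R (CLBINT v. iexp (- ((0 + 1 / (\<sigma> * ?r) * v) * s)) * tilted_char t (0 + 1 / (\<sigma> * ?r) * v) ^ N)"
    by (rule lborel_integral_real_affine) (use \<sigma> r in simp)
  also have "(CLBINT v. iexp (- ((0 + 1 / (\<sigma> * ?r) * v) * s)) * tilted_char t (0 + 1 / (\<sigma> * ?r) * v) ^ N) =
     (CLBINT v. iexp (- (v * ((s - real N * m) / (\<sigma> * ?r)))) *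
      (iexp (- (v / ?r * ((m - x) / \<sigma>))) * ?c (v / ?r)) ^ N)"
  proof (intro Bochner_Integration.integral_cong refl)
    fix v
    have "iexp (- (v / ?r * ((m - x) / \<sigma>))) * iexp (- (v / ?r * x / \<sigma>)) = iexp (- (v * m / (\<sigma> * ?r)))"
      using \<sigma> r by (simp add: exp_add[symmetric] field_simps)
    then have "(iexp (- (v / ?r * ((m - x) / \<sigma>))) * ?c (v / ?r)) ^ N
       = iexp (- (v * m / (\<sigma> * ?r))) ^ N * tilted_char t (v / ?r / \<sigma>) ^ N"
      unfolding char_rescaled[OF \<sigma>] by (simp only: mult.assoc[symmetric] power_mult_distrib)
    also have "iexp (- (v * m / (\<sigma> * ?r))) ^ N = iexp (- (v * (real N * m) / (\<sigma> * ?r)))"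
      by (simp add: exp_of_nat_mult[symmetric] algebra_simps)
    finally have "iexp (- (v * ((s - real N * m) / (\<sigma> * ?r)))) *
      (iexp (- (v / ?r * ((m - x) / \<sigma>))) * ?c (v / ?r)) ^ N
      = iexp (- (v * ((s - real N * m) / (\<sigma> * ?r)))) * iexp (- (v * (real N * m) / (\<sigma> * ?r))) * tilted_char t (v / ?r / \<sigma>) ^ N"
      by simp
    also have "iexp (- (v * ((s - real N * m) / (\<sigma> * ?r)))) * iexp (- (v * (real N * m) / (\<sigma> * ?r))) = iexp (- ((0 + 1 / (\<sigma> * ?r) * v) * s))"
      by (simp add: exp_add[symmetric] algebra_simps diff_divide_distrib)
    also have "v / ?r / \<sigma> = 0 + 1 / (\<sigma> * ?r) * v" by simp
    finally show "iexp (- ((0 + 1 / (\<sigma> * ?r) * v) * s)) * tilted_char t (0 + 1 / (\<sigma> * ?r) * v) ^ N =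
      iexp (- (v * ((s - real N * m) / (\<sigma> * ?r)))) *
      (iexp (- (v / ?r * ((m - x) / \<sigma>))) * ?c (v / ?r)) ^ N" ..
  qed
  finally show ?thesis
    unfolding inverse_char_def using \<sigma> r by simp
qed

text \<open>The density of the tilted sum at a point within o(\<sigma> sqrt N) of its mean; the
  limit is the peak of the normal density.\<close>

lemma inverse_char_tendsto:
  assumes G: "gaussian_limit (\<lambda>n. rescaled (t n) (x n) (\<sigma> n)) C"
    and \<sigma>: "\<And>n. 0 < \<sigma> n" and N: "filterlim N at_top sequentially"
    and z: "(\<lambda>n. (s n - real (N n) * tilted_mean p (t n)) / (\<sigma> n * sqrt (real (N n)))) \<longlonglongrightarrow> 0"
  shows "(\<lambda>n. \<sigma> n * sqrt (real (N n)) * inverse_char (\<lambda>\<tau>. tilted_char (t n) \<tau> ^ N n) (s n)) \<longlonglongrightarrow> 1 / sqrt (2 * pi)"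
proof -
  interpret G: gaussian_limit "\<lambda>n. rescaled (t n) (x n) (\<sigma> n)" C by (rule G)
  have "(\<lambda>n. Re (CLBINT v. iexp (- (v * ((s n - real (N n) * tilted_mean p (t n)) / (\<sigma> n * sqrt (real (N n)))))) *
      G.centred_char n (v / sqrt (real (N n))) ^ N n) / (2 * pi)) \<longlonglongrightarrow> Re (complex_of_real (sqrt (2 * pi))) / (2 * pi)"
    by (intro tendsto_divide tendsto_Re tendsto_const G.local_limit[OF N z]) simp
  moreover have "Re (complex_of_real (sqrt (2 * pi))) / (2 * pi) = 1 / sqrt (2 * pi)"
    using real_div_sqrt[of "2 * pi"] by (simp add: divide_simps)
  ultimately have lim: "(\<lambda>n. Re (CLBINT v. iexp (- (v * ((s n - real (N n) * tilted_mean p (t n)) / (\<sigma> n * sqrt (real (N n)))))) *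
      G.centred_char n (v / sqrt (real (N n))) ^ N n) / (2 * pi)) \<longlonglongrightarrow> 1 / sqrt (2 * pi)" by (simp only:)
  have "\<forall>\<^sub>F n in sequentially. N n \<ge> 1" using N by (simp add: filterlim_at_top)
  then have "\<forall>\<^sub>F n in sequentially. Re (CLBINT v. iexp (- (v * ((s n - real (N n) * tilted_mean p (t n)) / (\<sigma> n * sqrt (real (N n)))))) *
      G.centred_char n (v / sqrt (real (N n))) ^ N n) / (2 * pi) =
      \<sigma> n * sqrt (real (N n)) * inverse_char (\<lambda>\<tau>. tilted_char (t n) \<tau> ^ N n) (s n)"
  proof eventually_elim
    case (elim n)
    then show ?case
      using \<sigma>[of n] inverse_char_rescaled[OF \<sigma>[of n], of "N n" "t n" "s n" "x n"]
      unfolding G.centred_char_def G.mean_def G.law_def integral_rescaled_id[OF \<sigma>] by simp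
  qed
  then show ?thesis
    by (rule Lim_transform_eventually[OF lim])
qed

end

section \<open>Laplace's method\<close>

text \<open>The common core of the regularity classes. Nothing is asked of the shape of
  \<open>h\<close> below \<open>X0\<close>. \<open>\<psi>'_stable\<close> allows \<psi> to be
  linearised on windows short relative to \<open>t\<close>, and \<open>\<psi>'_large\<close> says
  that the Laplace windows are of that kind.\<close>

locale regular_inverse =
  fixes g h \<psi> \<psi>' :: "real \<Rightarrow> real" and X0 T0 :: real
  assumes X0: "0 < X0" and T0: "0 < T0"
    and g_deriv: "\<And>x. 0 < x \<Longrightarrow> (g has_real_derivative h x) (at x)"
    and h_mono: "\<And>x y. X0 \<le> x \<Longrightarrow> x \<le> y \<Longrightarrow> h x \<le> h y"
    and \<psi>_ge: "\<And>t. T0 \<le> t \<Longrightarrow> X0 \<le> \<psi> t"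
    and h_\<psi>: "\<And>t. T0 \<le> t \<Longrightarrow> h (\<psi> t) = t"
    and \<psi>_deriv: "\<And>t. T0 \<le> t \<Longrightarrow> (\<psi> has_real_derivative \<psi>' t) (at t)"
    and \<psi>'_pos: "\<And>t. T0 \<le> t \<Longrightarrow> 0 < \<psi>' t"
    and \<psi>_top: "filterlim \<psi> at_top at_top"
    and \<psi>'_stable: "\<And>\<delta>. 0 < \<delta> \<Longrightarrow> \<exists>\<kappa>>0. \<forall>\<^sub>F t in at_top. \<forall>s. \<bar>s - t\<bar> \<le> \<kappa> * t \<longrightarrow> \<bar>\<psi>' s - \<psi>' t\<bar> \<le> \<delta> * \<psi>' t"
    and \<psi>'_large: "filterlim (\<lambda>t. t\<^sup>2 * \<psi>' t) at_top at_top"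
begin

text \<open>The width of the Laplace peak of t x - g(x) at \<psi>(t): formally 1/\<psi>'(t) is the
  second derivative of \<open>g\<close> there. In the variable \<open>t\<close> the dual scale is
  \<open>1 / \<sigma> t\<close>.\<close>

definition \<sigma> :: "real \<Rightarrow> real" where "\<sigma> t = sqrt (\<psi>' t)"

lemma \<sigma>_pos: "T0 \<le> t \<Longrightarrow> 0 < \<sigma> t"
  unfolding \<sigma>_def using \<psi>'_pos by simp

lemma \<sigma>_sq: "T0 \<le> t \<Longrightarrow> (\<sigma> t)\<^sup>2 = \<psi>' t"
  unfolding \<sigma>_def using \<psi>'_pos by (simp add: less_imp_le)

lemma \<sigma>_large: "filterlim (\<lambda>t. t * \<sigma> t) at_top at_top"
proof -
  have 1: "filterlim (\<lambda>t. sqrt (t\<^sup>2 * \<psi>' t)) at_top at_top"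
    by (rule filterlim_compose[OF sqrt_at_top \<psi>'_large])
  have 2: "\<forall>\<^sub>F t in at_top. sqrt (t\<^sup>2 * \<psi>' t) = t * \<sigma> t"
    using eventually_ge_at_top[of 0] by eventually_elim (simp add: \<sigma>_def real_sqrt_mult)
  show ?thesis using 1 unfolding filterlim_cong[OF refl refl 2] .
qed

lemma eventually_\<sigma>_large: "\<forall>\<^sub>F t in at_top. K \<le> t * \<sigma> t"
  using \<sigma>_large by (simp add: filterlim_at_top)

lemma h_top: "filterlim h at_top at_top"
  unfolding filterlim_at_top
proof
  fix K
  let ?t = "max K T0"
  show "\<forall>\<^sub>F x in at_top. K \<le> h x"
    using eventually_ge_at_top[of "\<psi> ?t"]
    by eventually_elim (use h_mono[of "\<psi> ?t"] \<psi>_ge[of ?t] h_\<psi>[of ?t] in force)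
qed

lemma tangent_le:
  assumes "X0 \<le> x" "X0 \<le> y"
  shows "g x + h x * (y - x) \<le> g y"
proof (cases x y rule: linorder_cases)
  case less
  obtain z where z: "x < z" "z < y" "g y - g x = (y - x) * h z"
    using MVT2[OF less, of g h] g_deriv X0 assms by force
  have "(y - x) * h x \<le> (y - x) * h z" using less z h_mono[of x z] assms by (intro mult_left_mono) auto
  then show ?thesis using z(3) by (simp add: mult.commute)
next
  case greater
  obtain z where z: "y < z" "z < x" "g x - g y = (x - y) * h z"
    using MVT2[OF greater, of g h] g_deriv X0 assms by force
  have "(x - y) * h z \<le> (x - y) * h x" using greater z h_mono[of z x] assms by (intro mult_left_mono) auto
  then show ?thesis using z(3) by (simp add: algebra_simps)
qed simp

text \<open>Since \<open>t * \<sigma> t\<close> tends to infinity, \<open>V / \<sigma> t\<close> is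
  eventually below any fixed fraction of \<open>t\<close>. The bound \<open>t / 2 \<le> s\<close>
  lets other eventual properties be used at \<open>s\<close>.\<close>

lemma \<psi>'_near:
  assumes "0 < \<delta>"
  shows "\<forall>\<^sub>F t in at_top. T0 \<le> t \<and> (\<forall>s. \<bar>s - t\<bar> \<le> V / \<sigma> t \<longrightarrow> T0 \<le> s \<and> t / 2 \<le> s \<and> \<bar>\<psi>' s - \<psi>' t\<bar> \<le> \<delta> * \<psi>' t)"
proof -
  obtain \<kappa> where \<kappa>: "\<kappa> > 0" "\<forall>\<^sub>F t in at_top. \<forall>s. \<bar>s - t\<bar> \<le> \<kappa> * t \<longrightarrow> \<bar>\<psi>' s - \<psi>' t\<bar> \<le> \<delta> * \<psi>' t"
    using \<psi>'_stable[OF assms] by auto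
  from \<kappa>(2) eventually_ge_at_top[of "2 * T0"] eventually_\<sigma>_large[of "V / \<kappa>"] eventually_\<sigma>_large[of "V / (1 / 2)"]
  show ?thesis
  proof eventually_elim
    case (elim t)
    have t: "T0 \<le> t" using elim(2) T0 by simp
    have s0: "0 < \<sigma> t" by (rule \<sigma>_pos[OF t])
    have "V / \<sigma> t \<le> \<kappa> * t" "V / \<sigma> t \<le> t / 2"
      using elim(3,4) s0 \<kappa>(1) by (simp_all add: field_simps)
    show ?case
    proof (intro conjI allI impI)
      fix s assume s: "\<bar>s - t\<bar> \<le> V / \<sigma> t"
      show "\<bar>\<psi>' s - \<psi>' t\<bar> \<le> \<delta> * \<psi>' t"
        using elim(1) order_trans[OF s \<open>V / \<sigma> t \<le> \<kappa> * t\<close>] by blast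
      show "t / 2 \<le> s" using order_trans[OF s \<open>V / \<sigma> t \<le> t / 2\<close>] by linarith
      then show "T0 \<le> s" using elim(2) by linarith
    qed (rule t)
  qed
qed

text \<open>\<open>h\<close> is never differentiated. Linearising \<psi> places the point
  \<open>\<psi> t + \<sigma> t * u\<close> between the values of \<psi> at
  \<open>t + (u - \<delta>) / \<sigma> t\<close> and \<open>t + (u + \<delta>) / \<sigma> t\<close>;
  monotonicity of \<open>h\<close> then traps its value between these two arguments.\<close>

lemma scaled_slope:
  assumes \<delta>: "0 < \<delta>" "\<delta> \<le> 1" and V: "0 \<le> V"
  shows "\<forall>\<^sub>F t in at_top. \<forall>u. \<bar>u\<bar> \<le> V \<longrightarrow> X0 \<le> \<psi> t + \<sigma> t * u \<and> \<bar>\<sigma> t * (h (\<psi> t + \<sigma> t * u) - t) - u\<bar> \<le> \<delta>"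
proof -
  \<comment> \<open>Scaled displacements \<open>u - \<delta>\<close> and \<open>u + \<delta>\<close>
    have modulus at most \<open>V + 1\<close>, so a relative error \<delta>' in \<psi>' accumulates
    to \<open>\<delta> * \<sigma> t\<close>.\<close>
  define \<delta>' where "\<delta>' = \<delta> / (V + 1)"
  have \<delta>': "0 < \<delta>'" "(V + 1) * \<delta>' = \<delta>" using \<delta> V by (simp_all add: \<delta>'_def)
  show ?thesis using \<psi>'_near[OF \<delta>'(1), of "V + 1"]
  proof eventually_elim
    case (elim t)
    then have t: "T0 \<le> t" by simp
    have s0: "0 < \<sigma> t" by (rule \<sigma>_pos[OF t])
    have lin: "\<bar>\<psi> (t + w) - \<psi> t - w * (\<sigma> t)\<^sup>2\<bar> \<le> \<delta> * \<sigma> t \<and> T0 \<le> t + w" if w: "\<bar>w\<bar> * \<sigma> t \<le> V + 1" for w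
    proof
      have wV: "\<bar>w\<bar> \<le> (V + 1) / \<sigma> t" using w s0 by (simp add: field_simps)
      have near: "T0 \<le> s \<and> \<bar>\<psi>' s - \<psi>' t\<bar> \<le> \<delta>' * \<psi>' t" if "\<bar>s - t\<bar> \<le> \<bar>w\<bar>" for s
        using elim order_trans[OF that wV] by blast
      show "T0 \<le> t + w" using near[of "t + w"] by simp
      have "norm ((\<psi> (t + w) - \<psi>' t * (t + w)) - (\<psi> t - \<psi>' t * t)) \<le> \<delta>' * \<psi>' t * norm (t + w - t)"
      proof (rule field_differentiable_bound[where S = "cball t \<bar>w\<bar>" and f' = "\<lambda>s. \<psi>' s - \<psi>' t"])
        fix s assume "s \<in> cball t \<bar>w\<bar>"
        then have "\<bar>s - t\<bar> \<le> \<bar>w\<bar>" by (simp add: dist_real_def abs_minus_commute)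
        note n = near[OF this]
        show "((\<lambda>s. \<psi> s - \<psi>' t * s) has_field_derivative \<psi>' s - \<psi>' t) (at s within cball t \<bar>w\<bar>)"
        proof -
          have d: "(\<psi> has_field_derivative \<psi>' s) (at s within cball t \<bar>w\<bar>)"
            by (rule has_field_derivative_at_within[OF \<psi>_deriv]) (use n in simp)
          have "((\<lambda>s. \<psi>' t * s) has_field_derivative \<psi>' t) (at s within cball t \<bar>w\<bar>)"
            by (rule DERIV_cmult_Id)
          from DERIV_diff[OF d this] show ?thesis .
        qed
        show "norm (\<psi>' s - \<psi>' t) \<le> \<delta>' * \<psi>' t" using n by simp
      qed (auto simp: dist_real_def)
      then have "\<bar>\<psi> (t + w) - \<psi> t - w * (\<sigma> t)\<^sup>2\<bar> \<le> \<delta>' * \<psi>' t * \<bar>w\<bar>"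
        unfolding \<sigma>_sq[OF t] by (simp add: algebra_simps)
      also have "\<dots> = \<delta>' * \<sigma> t * (\<bar>w\<bar> * \<sigma> t)" by (simp add: \<sigma>_sq[OF t, symmetric] power2_eq_square)
      also have "\<dots> \<le> \<delta>' * \<sigma> t * (V + 1)" using w \<delta>' s0 by (intro mult_left_mono) auto
      also have "\<dots> = \<delta> * \<sigma> t" using \<delta>'(2) by (simp add: mult_ac)
      finally show "\<bar>\<psi> (t + w) - \<psi> t - w * (\<sigma> t)\<^sup>2\<bar> \<le> \<delta> * \<sigma> t" .
    qed
    show ?case
    proof (intro allI impI)
      fix u assume u: "\<bar>u\<bar> \<le> V"
      define x where "x = \<psi> t + \<sigma> t * u"
      have scale: "(a / \<sigma> t) * (\<sigma> t)\<^sup>2 = \<sigma> t * a" "\<bar>a / \<sigma> t\<bar> * \<sigma> t = \<bar>a\<bar>" for a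
        using s0 by (simp_all add: power2_eq_square)
      have lo: "\<psi> (t + (u - \<delta>) / \<sigma> t) \<le> x" "T0 \<le> t + (u - \<delta>) / \<sigma> t"
        using lin[of "(u - \<delta>) / \<sigma> t"] u \<delta> unfolding scale by (auto simp: x_def algebra_simps abs_le_iff)
      have up: "x \<le> \<psi> (t + (u + \<delta>) / \<sigma> t)" "T0 \<le> t + (u + \<delta>) / \<sigma> t"
        using lin[of "(u + \<delta>) / \<sigma> t"] u \<delta> unfolding scale by (auto simp: x_def algebra_simps abs_le_iff)
      have x: "X0 \<le> x" using \<psi>_ge[OF lo(2)] lo(1) by simp
      have "t + (u - \<delta>) / \<sigma> t \<le> h x"
        using h_mono[OF \<psi>_ge[OF lo(2)] lo(1)] h_\<psi>[OF lo(2)] by simp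
      moreover have "h x \<le> t + (u + \<delta>) / \<sigma> t"
        using h_mono[OF x up(1)] h_\<psi>[OF up(2)] by simp
      ultimately have "\<bar>\<sigma> t * (h x - t) - u\<bar> \<le> \<delta>"
        using s0 by (simp add: field_simps abs_le_iff)
      with x show "X0 \<le> \<psi> t + \<sigma> t * u \<and> \<bar>\<sigma> t * (h (\<psi> t + \<sigma> t * u) - t) - u\<bar> \<le> \<delta>"
        unfolding x_def by blast
    qed
  qed
qed

text \<open>By the slope estimate \<open>h\<close> is at least \<open>t / 2\<close> at the point,
  and monotonicity excludes this on \<open>{X0..K}\<close> for large \<open>t\<close>.\<close>

lemma scaled_point_top: "filterlim (\<lambda>t. \<psi> t + \<sigma> t * u) at_top at_top"
  unfolding filterlim_at_top
proof
  fix K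
  let ?K = "max K X0"
  from scaled_slope[of 1 "\<bar>u\<bar>"]
  have "\<forall>\<^sub>F t in at_top. X0 \<le> \<psi> t + \<sigma> t * u \<and> \<bar>\<sigma> t * (h (\<psi> t + \<sigma> t * u) - t) - u\<bar> \<le> 1"
    by (simp, rule eventually_mono) auto
  then show "\<forall>\<^sub>F t in at_top. K \<le> \<psi> t + \<sigma> t * u"
    using eventually_\<sigma>_large[of "2 * (\<bar>u\<bar> + 1)"] eventually_gt_at_top[of "2 * h ?K"] eventually_ge_at_top[of T0]
  proof eventually_elim
    case (elim t)
    let ?x = "\<psi> t + \<sigma> t * u"
    have s0: "0 < \<sigma> t" by (rule \<sigma>_pos[OF elim(4)])
    have "- (\<bar>u\<bar> + 1) \<le> \<sigma> t * (h ?x - t)" using elim(1) by linarith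
    then have "\<sigma> t * (t / 2) \<le> \<sigma> t * h ?x" using elim(2) by (simp add: algebra_simps)
    then have "h ?K < h ?x" using s0 elim(3) by simp
    then show ?case using h_mono[of ?x ?K] elim(1) by (cases "?x \<le> ?K") auto
  qed
qed

text \<open>The drop of the exponent t x - g(x) from its value at \<psi>(t), in the scaled variable.
  The linear term vanishes at \<open>u = 0\<close> because \<open>h (\<psi> t) = t\<close>.\<close>

definition potential :: "real \<Rightarrow> real \<Rightarrow> real" where
  "potential t u = g (\<psi> t + \<sigma> t * u) - g (\<psi> t) - t * (\<sigma> t * u)"

text \<open>The derivative in \<open>u\<close> is uniformly close to \<open>u\<close> by
  \<open>scaled_slope\<close>; the mean value inequality from 0 gives the quadratic.\<close>

lemma potential_tendsto: "((\<lambda>t. potential t u) \<longlongrightarrow> u\<^sup>2 / 2) at_top"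
proof (rule tendstoI)
  fix e :: real assume e: "0 < e"
  define \<delta> where "\<delta> = min 1 (e / (2 * (\<bar>u\<bar> + 1)))"
  have \<delta>: "0 < \<delta>" "\<delta> \<le> 1" "\<delta> * \<bar>u\<bar> < e"
  proof -
    show "0 < \<delta>" "\<delta> \<le> 1" using e by (auto simp: \<delta>_def)
    have "\<delta> * \<bar>u\<bar> \<le> e / (2 * (\<bar>u\<bar> + 1)) * \<bar>u\<bar>" by (intro mult_right_mono) (auto simp: \<delta>_def)
    also have "\<dots> = e / 2 * (\<bar>u\<bar> / (\<bar>u\<bar> + 1))" by simp
    also have "\<dots> \<le> e / 2 * 1" using e by (intro mult_left_mono) auto
    also have "\<dots> < e" using e by simp
    finally show "\<delta> * \<bar>u\<bar> < e" .
  qed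
  show "\<forall>\<^sub>F t in at_top. dist (potential t u) (u\<^sup>2 / 2) < e"
    using scaled_slope[OF \<delta>(1,2), of "\<bar>u\<bar>", simplified]
  proof eventually_elim
    case (elim t)
    have "norm ((potential t u - u\<^sup>2 / 2) - (potential t 0 - 0\<^sup>2 / 2)) \<le> \<delta> * norm (u - 0)"
    proof (rule field_differentiable_bound[where S = "cball 0 \<bar>u\<bar>" and f' = "\<lambda>v. \<sigma> t * (h (\<psi> t + \<sigma> t * v) - t) - v"])
      fix v :: real assume "v \<in> cball 0 \<bar>u\<bar>"
      then have v: "\<bar>v\<bar> \<le> \<bar>u\<bar>" by (simp add: dist_real_def)
      then have pos: "0 < \<psi> t + \<sigma> t * v" using elim X0 by force
      have "((\<lambda>v. g (\<psi> t + \<sigma> t * v)) has_real_derivative h (\<psi> t + \<sigma> t * v) * \<sigma> t) (at v within cball 0 \<bar>u\<bar>)"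
        by (rule DERIV_chain2[where f = g and g = "\<lambda>v. \<psi> t + \<sigma> t * v", OF g_deriv[OF pos]])
          (auto intro!: derivative_eq_intros)
      then show "((\<lambda>v. potential t v - v\<^sup>2 / 2) has_field_derivative \<sigma> t * (h (\<psi> t + \<sigma> t * v) - t) - v) (at v within cball 0 \<bar>u\<bar>)"
        unfolding potential_def by (auto intro!: derivative_eq_intros simp: algebra_simps)
      show "norm (\<sigma> t * (h (\<psi> t + \<sigma> t * v) - t) - v) \<le> \<delta>" using elim v by simp
    qed auto
    then have "\<bar>potential t u - u\<^sup>2 / 2\<bar> \<le> \<delta> * \<bar>u\<bar>" by (simp add: potential_def)
    then show ?case using \<delta>(3) by (simp add: dist_real_def)
  qed
qed

text \<open>Convexity of \<open>g\<close>: the potential lies above its tangents at \<open>-1\<close>, \<open>0\<close> and \<open>1\<close>.\<close>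

lemma potential_ge:
  "\<forall>\<^sub>F t in at_top. \<forall>u. X0 \<le> \<psi> t + \<sigma> t * u \<longrightarrow> (\<bar>u\<bar> - 1) / 2 \<le> potential t u"
  using scaled_slope[of "1 / 2" 1, simplified] eventually_ge_at_top[of T0]
proof eventually_elim
  case (elim t)
  have s0: "0 < \<sigma> t" by (rule \<sigma>_pos[OF elim(2)])
  have tan: "potential t v + \<sigma> t * (h (\<psi> t + \<sigma> t * v) - t) * (u - v) \<le> potential t u"
    if "X0 \<le> \<psi> t + \<sigma> t * v" "X0 \<le> \<psi> t + \<sigma> t * u" for u v
    using tangent_le[OF that] by (simp add: potential_def algebra_simps)
  have X: "X0 \<le> \<psi> t + \<sigma> t * 0" "X0 \<le> \<psi> t + \<sigma> t * 1" "X0 \<le> \<psi> t + \<sigma> t * (- 1)"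
    using elim(1)[rule_format, of 0] elim(1)[rule_format, of 1] elim(1)[rule_format, of "- 1"] by simp_all
  have "\<bar>\<sigma> t * (h (\<psi> t + \<sigma> t * 1) - t) - 1\<bar> \<le> 1 / 2" "\<bar>\<sigma> t * (h (\<psi> t + \<sigma> t * (- 1)) - t) - (- 1)\<bar> \<le> 1 / 2"
    using elim(1)[rule_format, of 1] elim(1)[rule_format, of "- 1"] by simp_all
  \<comment> \<open>Slopes at 1 and -1 are within 1/2 of 1 and -1, so both tangents rise outwards at
    rate at least 1/2.\<close>
  then have s: "1 / 2 \<le> \<sigma> t * (h (\<psi> t + \<sigma> t * 1) - t)" "\<sigma> t * (h (\<psi> t + \<sigma> t * (- 1)) - t) \<le> - 1 / 2"
    by linarith+
  have 0: "0 \<le> potential t u" if "X0 \<le> \<psi> t + \<sigma> t * u" for u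
    using tan[OF X(1) that] h_\<psi>[OF elim(2)] by (simp add: potential_def)
  show ?case
  proof (intro allI impI)
    fix u assume u: "X0 \<le> \<psi> t + \<sigma> t * u"
    consider "1 \<le> u" | "\<bar>u\<bar> \<le> 1" | "u \<le> - 1" by linarith
    then show "(\<bar>u\<bar> - 1) / 2 \<le> potential t u"
    proof cases
      case 1
      then show ?thesis using tan[OF X(2) u] 0[OF X(2)] mult_right_mono[OF s(1), of "u - 1"] by simp
    next
      case 2
      then show ?thesis using 0[OF u] by simp
    next
      case 3
      then have "- 1 / 2 * (u - (- 1)) \<le> \<sigma> t * (h (\<psi> t + \<sigma> t * (- 1)) - t) * (u - (- 1))"
        by (intro mult_right_mono_neg s) simp
      then have "- 1 / 2 * (u - (- 1)) \<le> potential t u"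
        using tan[OF X(3) u] 0[OF X(3)] by linarith
      then show ?thesis using 3 by (simp add: field_simps)
    qed
  qed
qed

end

section \<open>Convergence of the tilted densities to the normal density\<close>

locale laplace_density = tiltable_density p + regular_inverse g h \<psi> \<psi>' X0 T0
  for p g h \<psi> \<psi>' :: "real \<Rightarrow> real" and X0 T0 :: real +
  fixes q :: "real \<Rightarrow> real" and c B :: real
  assumes c_pos: "0 < c"
    and p_eq: "\<And>x. 0 \<le> x \<Longrightarrow> p x = c * exp (- (g x - q x))"
    and p_le: "\<And>x. p x \<le> B"
    and q_lim: "(q \<longlongrightarrow> 0) at_top"
begin

text \<open>The tilted weight divided by its formal peak value without \<open>q\<close>. It
  converges to the unnormalised Gaussian, so the mgf can be left out until the end.\<close>

definition profile :: "real \<Rightarrow> real \<Rightarrow> real" where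
  "profile t u = exp (t * (\<psi> t + \<sigma> t * u)) * p (\<psi> t + \<sigma> t * u) / (c * exp (t * \<psi> t - g (\<psi> t)))"

lemma profile_measurable [measurable]: "profile t \<in> borel_measurable borel"
  unfolding profile_def[abs_def] by measurable

lemma profile_nonneg: "0 \<le> profile t u"
  unfolding profile_def using p_nonneg c_pos by simp

lemma profile_eq:
  assumes "0 \<le> \<psi> t + \<sigma> t * u"
  shows "profile t u = exp (q (\<psi> t + \<sigma> t * u) - potential t u)"
proof -
  have "exp (t * (\<psi> t + \<sigma> t * u)) * (c * exp (- (g (\<psi> t + \<sigma> t * u) - q (\<psi> t + \<sigma> t * u))))
     = c * exp (t * \<psi> t - g (\<psi> t)) * exp (q (\<psi> t + \<sigma> t * u) - potential t u)"
    by (simp add: potential_def algebra_simps flip: exp_add)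
  then show ?thesis
    using c_pos by (simp add: profile_def p_eq[OF assms])
qed

lemma profile_tendsto: "((\<lambda>t. profile t u) \<longlongrightarrow> exp (- u\<^sup>2 / 2)) at_top"
proof -
  have "((\<lambda>t. exp (q (\<psi> t + \<sigma> t * u) - potential t u)) \<longlongrightarrow> exp (0 - u\<^sup>2 / 2)) at_top"
    by (intro tendsto_exp tendsto_diff filterlim_compose[OF q_lim scaled_point_top] potential_tendsto)
  moreover have "\<forall>\<^sub>F t in at_top. 0 \<le> \<psi> t + \<sigma> t * u"
    using scaled_point_top[of u] by (simp add: filterlim_at_top)
  then have "\<forall>\<^sub>F t in at_top. exp (q (\<psi> t + \<sigma> t * u) - potential t u) = profile t u"
    by eventually_elim (simp add: profile_eq)
  ultimately show ?thesis using Lim_transform_eventually by force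
qed

text \<open>Beyond a fixed point the envelope comes from the convexity of \<open>g\<close>; before that point,
  \<open>p\<close> is merely bounded and the decay comes from the factor \<open>exp (t x)\<close>.\<close>

lemma profile_le: "\<exists>C. \<forall>\<^sub>F t in at_top. \<forall>u. profile t u \<le> C * exp (- \<bar>u\<bar> / 2)"
proof -
  have "\<forall>\<^sub>F x in at_top. \<bar>q x\<bar> < 1"
    using tendstoD[OF q_lim, of 1] by simp
  then obtain X where X: "\<And>x. X \<le> x \<Longrightarrow> \<bar>q x\<bar> < 1" unfolding eventually_at_top_linorder by auto
  define X1 where "X1 = max X X0"
  have X1: "X0 \<le> X1" "0 < X1" "\<And>x. X1 \<le> x \<Longrightarrow> \<bar>q x\<bar> < 1" using X0 X by (auto simp: X1_def)
  have B: "0 \<le> B" using p_nonneg[of 0] p_le[of 0] by simp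
  \<comment> \<open>First entry: \<open>q\<close> contributes at most 1 and
    \<open>potential_ge\<close> an offset 1/2. Second entry: \<open>p\<close> is at most
    \<open>B\<close>, and the exponent is compared with its value at \<open>X1\<close>.\<close>
  define C where "C = max (exp (3 / 2)) (B / c * exp (g X1 + 1 / 2))"
  have "\<forall>\<^sub>F t in at_top. \<forall>u. profile t u \<le> C * exp (- \<bar>u\<bar> / 2)"
    using potential_ge eventually_\<sigma>_large[of "1 / 2"] \<psi>_top[unfolded filterlim_at_top, rule_format, of X1] eventually_ge_at_top[of T0]
  proof eventually_elim
    case (elim t)
    have s0: "0 < \<sigma> t" by (rule \<sigma>_pos[OF elim(4)])
    show ?case
    proof
      fix u
      let ?x = "\<psi> t + \<sigma> t * u"
      show "profile t u \<le> C * exp (- \<bar>u\<bar> / 2)"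
      proof (cases "X1 \<le> ?x")
        case True
        then have "(\<bar>u\<bar> - 1) / 2 \<le> potential t u" "q ?x < 1" using elim(1) X1(1) X1(3)[OF True] by auto
        then have "q ?x - potential t u \<le> 3 / 2 + - \<bar>u\<bar> / 2" by (simp add: field_simps)
        then have "profile t u \<le> exp (3 / 2) * exp (- \<bar>u\<bar> / 2)"
          using True X1(2) by (simp add: profile_eq flip: exp_add)
        also have "\<dots> \<le> C * exp (- \<bar>u\<bar> / 2)" by (intro mult_right_mono) (auto simp: C_def)
        finally show ?thesis .
      next
        case False
        \<comment> \<open>The scaled coordinate of \<open>X1\<close>. \<open>potential_ge\<close> at
          \<open>u1\<close> bounds \<open>g (\<psi> t)\<close> in terms of \<open>g X1\<close>; from
          \<open>u1\<close> down to \<open>u\<close> the factor exp(t x) decays at rate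
          \<open>t * \<sigma> t\<close>, at least 1/2.\<close>
        define u1 where "u1 = (X1 - \<psi> t) / \<sigma> t"
        have u1: "\<psi> t + \<sigma> t * u1 = X1" "u1 \<le> 0" using s0 elim(3) by (auto simp: u1_def divide_le_0_iff)
        have u: "u < u1" using False s0 by (simp add: u1_def field_simps)
        have "(\<bar>u1\<bar> - 1) / 2 \<le> potential t u1" using elim(1)[rule_format, of u1] X1(1) u1(1) by simp
        then have pot: "g (\<psi> t) + t * (\<sigma> t * u1) \<le> g X1 + (u1 + 1) / 2"
          using u1 unfolding potential_def u1(1) by (simp add: field_simps)
        have "(t * \<sigma> t) * (u - u1) \<le> 1 / 2 * (u - u1)" using elim(2) u by (intro mult_right_mono_neg) auto
        then have expo: "t * ?x - (t * \<psi> t - g (\<psi> t)) \<le> (g X1 + 1 / 2) + - \<bar>u\<bar> / 2"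
          using pot u u1(2) by (simp add: field_simps)
        have "profile t u = p ?x / c * exp (t * ?x - (t * \<psi> t - g (\<psi> t)))"
          unfolding profile_def by (simp only: exp_diff times_divide_times_eq mult.commute)
        also have "\<dots> \<le> B / c * exp ((g X1 + 1 / 2) + - \<bar>u\<bar> / 2)"
          using expo p_le[of ?x] c_pos B by (intro mult_mono divide_right_mono) auto
        also have "\<dots> = B / c * exp (g X1 + 1 / 2) * exp (- \<bar>u\<bar> / 2)" by (simp only: exp_add mult.assoc)
        also have "\<dots> \<le> C * exp (- \<bar>u\<bar> / 2)" by (intro mult_right_mono) (auto simp: C_def)
        finally show ?thesis .
      qed
    qed
  qed
  then show ?thesis by blast
qed

lemma profile_integral_tendsto: "((\<lambda>t. LINT u|lborel. profile t u) \<longlongrightarrow> sqrt (2 * pi)) at_top"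
proof -
  obtain C where C: "\<forall>\<^sub>F t in at_top. \<forall>u. profile t u \<le> C * exp (- \<bar>u\<bar> / 2)"
    using profile_le by blast
  have env: "integrable lborel (\<lambda>u::real. C * (\<bar>u\<bar> ^ 0 * exp (- \<bar>u\<bar> / 2)))"
    by (intro integrable_mult_right integrable_power_times_exp)
  have "((\<lambda>t. LINT u|lborel. profile t u) \<longlongrightarrow> (LINT u|lborel. exp (- u\<^sup>2 / 2))) at_top"
  proof (rule integral_dominated_convergence_at_top[OF _ _ env])
    show "\<forall>\<^sub>F t in at_top. AE u in lborel. norm (profile t u) \<le> C * (\<bar>u\<bar> ^ 0 * exp (- \<bar>u\<bar> / 2))"
      using C by eventually_elim (auto simp: profile_nonneg)
    show "AE u in lborel. ((\<lambda>t. profile t u) \<longlongrightarrow> exp (- u\<^sup>2 / 2)) at_top"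
      by (intro AE_I2 profile_tendsto)
  qed auto
  moreover have "(LINT u|lborel. exp (- u\<^sup>2 / 2)) = (LINT u|lborel. sqrt (2 * pi) * std_normal_density u)"
    by (intro Bochner_Integration.integral_cong refl) (simp add: std_normal_density_def)
  ultimately show ?thesis by simp
qed

text \<open>Both functions are proportional and the left one has integral 1, so the constant is
  found without evaluating the mgf.\<close>

lemma rescaled_eq_profile:
  assumes t: "T0 \<le> t"
  shows "rescaled t (\<psi> t) (\<sigma> t) u = profile t u / (LINT v|lborel. profile t v)"
proof -
  define K where "K = \<sigma> t * (c * exp (t * \<psi> t - g (\<psi> t))) / mgf p t"
  have K: "K > 0" unfolding K_def using \<sigma>_pos[OF t] c_pos mgf_pos[of t] by simp
  have eq: "rescaled t (\<psi> t) (\<sigma> t) u = K * profile t u" for u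
    unfolding rescaled_def profile_def K_def using c_pos by simp
  have "1 = (LINT u|lborel. rescaled t (\<psi> t) (\<sigma> t) u)"
    using integral_rescaled_1[OF \<sigma>_pos[OF t]] by simp
  also have "\<dots> = (LINT u|lborel. K * profile t u)" unfolding eq ..
  also have "\<dots> = K * (LINT u|lborel. profile t u)" by (rule integral_mult_right_zero)
  finally have "(LINT u|lborel. profile t u) = 1 / K" using K by (simp add: field_simps)
  then show ?thesis unfolding eq using K by simp
qed

lemma gaussian_limit_rescaled:
  "\<exists>C T. T0 \<le> T \<and> (\<forall>t. (\<forall>n. T \<le> t n) \<longrightarrow> filterlim t at_top sequentially \<longrightarrow>
     gaussian_limit (\<lambda>n. rescaled (t n) (\<psi> (t n)) (\<sigma> (t n))) C)"
proof -
  obtain C where C: "\<forall>\<^sub>F t in at_top. \<forall>u. profile t u \<le> C * exp (- \<bar>u\<bar> / 2)"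
    using profile_le by blast
  \<comment> \<open>The limiting integral exceeds 1, so normalising preserves the envelope constant
    \<open>C\<close>.\<close>
  have "1\<^sup>2 < 2 * pi" using pi_gt3 by simp
  then have "1 < sqrt (2 * pi)" by (rule real_less_rsqrt)
  then have I: "\<forall>\<^sub>F t in at_top. 1 < (LINT u|lborel. profile t u)"
    by (rule order_tendstoD(1)[OF profile_integral_tendsto])
  obtain T1 where T1: "\<And>t. T1 \<le> t \<Longrightarrow> (\<forall>u. profile t u \<le> C * exp (- \<bar>u\<bar> / 2)) \<and> 1 < (LINT u|lborel. profile t u)"
    using eventually_conj[OF C I] unfolding eventually_at_top_linorder by blast
  have "gaussian_limit (\<lambda>n. rescaled (t n) (\<psi> (t n)) (\<sigma> (t n))) C"
    if t: "\<And>n. max T0 T1 \<le> t n" and lim: "filterlim t at_top sequentially" for t :: "nat \<Rightarrow> real"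
  proof
    have tn: "T0 \<le> t n" "T1 \<le> t n" for n using t[of n] by auto
    show "rescaled (t n) (\<psi> (t n)) (\<sigma> (t n)) \<in> borel_measurable borel" for n by simp
    show "0 \<le> rescaled (t n) (\<psi> (t n)) (\<sigma> (t n)) u" for n u by (rule rescaled_nonneg[OF \<sigma>_pos[OF tn(1)]])
    show "(LINT u|lborel. rescaled (t n) (\<psi> (t n)) (\<sigma> (t n)) u) = 1" for n by (rule integral_rescaled_1[OF \<sigma>_pos[OF tn(1)]])
    show "rescaled (t n) (\<psi> (t n)) (\<sigma> (t n)) u \<le> C * exp (- \<bar>u\<bar> / 2)" for n u
    proof -
      have "profile (t n) u / (LINT v|lborel. profile (t n) v) \<le> profile (t n) u / 1"
        using T1[OF tn(2)[of n]] profile_nonneg by (intro divide_left_mono) auto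
      then show ?thesis unfolding rescaled_eq_profile[OF tn(1)] using T1[OF tn(2)[of n]] by (auto intro: order_trans)
    qed
    show "(\<lambda>n. rescaled (t n) (\<psi> (t n)) (\<sigma> (t n)) u) \<longlonglongrightarrow> std_normal_density u" for u
    proof -
      have "(\<lambda>n. profile (t n) u / (LINT v|lborel. profile (t n) v)) \<longlonglongrightarrow> exp (- u\<^sup>2 / 2) / sqrt (2 * pi)"
        by (intro tendsto_divide filterlim_compose[OF profile_tendsto lim] filterlim_compose[OF profile_integral_tendsto lim]) simp
      then show ?thesis unfolding rescaled_eq_profile[OF tn(1)] std_normal_density_def by simp
    qed
  qed
  then show ?thesis by (intro exI[of _ C] exI[of _ "max T0 T1"]) auto
qed

end

section \<open>Regularity classes\<close>

text \<open>A derivative of order 1/t changes \<open>D\<close> by at most 2 K \<kappa> over a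
  relative window of size \<kappa>, so exp(D) changes by a factor close to 1.\<close>

lemma stable_of_log_derivative:
  fixes D D' :: "real \<Rightarrow> real"
  assumes T: "0 < T" and D: "\<And>t. T \<le> t \<Longrightarrow> (D has_real_derivative D' t) (at t)"
    and bound: "\<And>t. T \<le> t \<Longrightarrow> \<bar>D' t\<bar> \<le> K / t" and \<delta>: "0 < \<delta>"
  shows "\<exists>\<kappa>>0. \<forall>\<^sub>F t in at_top. \<forall>s. \<bar>s - t\<bar> \<le> \<kappa> * t \<longrightarrow> \<bar>exp (D s) - exp (D t)\<bar> \<le> \<delta> * exp (D t)"
proof -
  have K: "0 \<le> K" using bound[of T] T by (smt (verit) divide_neg_pos)
  obtain d where d: "0 < d" "\<And>x. \<bar>x\<bar> < d \<Longrightarrow> \<bar>exp x - 1\<bar> < \<delta>"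
  proof -
    have "isCont exp (0::real)" by simp
    then obtain d where "0 < d" "\<And>x. dist x 0 < d \<Longrightarrow> dist (exp x) (exp (0::real)) < \<delta>"
      using \<delta> unfolding continuous_at_eps_delta by blast
    then show ?thesis using that by (simp add: dist_real_def)
  qed
  \<comment> \<open>The bound 1/2 keeps the window above \<open>t / 2\<close>; the other makes
    \<open>2 * K * \<kappa>\<close> less than \<open>d\<close>.\<close>
  define \<kappa> where "\<kappa> = min (1 / 2) (d / (4 * (K + 1)))"
  have \<kappa>: "0 < \<kappa>" "\<kappa> \<le> 1 / 2" using d K by (simp_all only: \<kappa>_def min.cobounded1) auto
  have K\<kappa>: "2 * K * \<kappa> < d"
  proof -
    have "2 * K * \<kappa> \<le> 2 * K * (d / (4 * (K + 1)))" using K by (intro mult_left_mono) (auto simp: \<kappa>_def)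
    also have "\<dots> = d / 2 * (K / (K + 1))" using K by (simp add: field_simps)
    also have "\<dots> \<le> d / 2 * 1" using d K by (intro mult_left_mono) auto
    also have "\<dots> < d" using d by simp
    finally show ?thesis .
  qed
  have "\<forall>\<^sub>F t in at_top. \<forall>s. \<bar>s - t\<bar> \<le> \<kappa> * t \<longrightarrow> \<bar>exp (D s) - exp (D t)\<bar> \<le> \<delta> * exp (D t)"
    using eventually_ge_at_top[of "2 * T"]
  proof eventually_elim
    case (elim t)
    have t0: "0 < t" using elim T by simp
    show ?case
    proof (intro allI impI)
      fix s assume s: "\<bar>s - t\<bar> \<le> \<kappa> * t"
      have "norm (D s - D t) \<le> (K / (t / 2)) * norm (s - t)"
      proof (rule field_differentiable_bound[where S = "cball t (\<kappa> * t)" and f' = D'])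
        fix v assume "v \<in> cball t (\<kappa> * t)"
        then have v: "\<bar>v - t\<bar> \<le> \<kappa> * t" by (simp add: dist_real_def abs_minus_commute)
        have "\<kappa> * t \<le> 1 / 2 * t" using \<kappa>(2) t0 by (intro mult_right_mono) auto
        then have v2: "t / 2 \<le> v" using v by linarith
        show "(D has_field_derivative D' v) (at v within cball t (\<kappa> * t))"
          by (rule has_field_derivative_at_within[OF D]) (use v2 elim in linarith)
        have "\<bar>D' v\<bar> \<le> K / v" by (rule bound) (use v2 elim in linarith)
        also have "\<dots> \<le> K / (t / 2)" using v2 t0 K by (intro divide_left_mono) auto
        finally show "norm (D' v) \<le> K / (t / 2)" by simp
      qed (use s \<kappa> t0 in \<open>auto simp: dist_real_def abs_minus_commute\<close>)
      also have "\<dots> \<le> (K / (t / 2)) * (\<kappa> * t)" using s K t0 by (intro mult_left_mono) auto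
      also have "\<dots> = 2 * K * \<kappa>" using t0 by simp
      also have "\<dots> < d" by (rule K\<kappa>)
      finally have "\<bar>exp (D s - D t) - 1\<bar> < \<delta>" by (intro d(2)) simp
      then have "\<bar>exp (D s - D t) - 1\<bar> * exp (D t) \<le> \<delta> * exp (D t)" by (intro mult_right_mono) auto
      moreover have "\<bar>exp (D s - D t) - 1\<bar> * exp (D t) = \<bar>(exp (D s - D t) - 1) * exp (D t)\<bar>" by (simp add: abs_mult)
      moreover have "(exp (D s - D t) - 1) * exp (D t) = exp (D s) - exp (D t)"
        by (simp add: left_diff_distrib flip: exp_add)
      ultimately show "\<bar>exp (D s) - exp (D t)\<bar> \<le> \<delta> * exp (D t)" by simp
    qed
  qed
  then show ?thesis using \<kappa>(1) by blast
qed

text \<open>In both regularity classes the derivative of the inverse function \<open>\<psi>\<close> of \<open>h\<close> has the form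
  \<open>\<psi> E / t\<close>, where \<open>E = \<epsilon>\<close> for rapidly varying \<open>h\<close> and \<open>E = 1 / (\<beta> + \<epsilon> \<circ> \<psi>)\<close> for
  regularly varying \<open>h\<close>.\<close>

lemma regular_inverseI:
  fixes g h \<psi> E E' :: "real \<Rightarrow> real"
  assumes X0: "0 < X0" and T0: "0 < T0"
    and g: "\<And>x. 0 < x \<Longrightarrow> (g has_real_derivative h x) (at x)"
    and h: "\<And>x y. X0 \<le> x \<Longrightarrow> x \<le> y \<Longrightarrow> h x \<le> h y"
    and \<psi>_ge: "\<And>t. T0 \<le> t \<Longrightarrow> X0 \<le> \<psi> t"
    and h_\<psi>: "\<And>t. T0 \<le> t \<Longrightarrow> h (\<psi> t) = t"
    and \<psi>: "\<And>t. T0 \<le> t \<Longrightarrow> (\<psi> has_real_derivative \<psi> t * E t / t) (at t)"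
    and \<psi>_top: "filterlim \<psi> at_top at_top"
    and E: "\<And>t. T0 \<le> t \<Longrightarrow> (E has_real_derivative E' t) (at t)"
    and E_bounds: "\<And>t. T0 \<le> t \<Longrightarrow> 0 < E t \<and> E t \<le> K" "\<And>t. T0 \<le> t \<Longrightarrow> \<bar>t * E' t / E t\<bar> \<le> K"
    and E_large: "filterlim (\<lambda>t. t * E t) at_top at_top"
  shows "regular_inverse g h \<psi> (\<lambda>t. \<psi> t * E t / t) X0 T0"
proof
  have \<psi>_pos: "0 < \<psi> t" if "T0 \<le> t" for t using \<psi>_ge[OF that] X0 by simp
  show pos: "0 < \<psi> t * E t / t" if "T0 \<le> t" for t
    using \<psi>_pos[OF that] E_bounds(1)[OF that] T0 that by simp
  \<comment> \<open>The logarithm of the claimed \<psi>'; \<open>t\<close> times its derivative is E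
    + t E'/E - 1, bounded by \<open>2 * K + 1\<close>.\<close>
  define D where "D t = ln (\<psi> t) + ln (E t) - ln t" for t
  have D: "(D has_real_derivative (\<psi> t * E t / t) / \<psi> t + E' t / E t - 1 / t) (at t)" if t: "T0 \<le> t" for t
  proof -
    have "((\<lambda>t. ln (\<psi> t)) has_real_derivative 1 / \<psi> t * (\<psi> t * E t / t)) (at t)"
      by (rule DERIV_chain2[where f = ln, OF DERIV_ln_divide[OF \<psi>_pos[OF t]] \<psi>[OF t]])
    moreover have "((\<lambda>t. ln (E t)) has_real_derivative 1 / E t * E' t) (at t)"
      using E_bounds(1)[OF t] by (intro DERIV_chain2[where f = ln, OF DERIV_ln_divide E[OF t]]) auto
    moreover have "(ln has_real_derivative 1 / t) (at t)" using T0 t by (intro DERIV_ln_divide) auto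
    ultimately have "((\<lambda>t. ln (\<psi> t) + ln (E t) - ln t) has_real_derivative 1 / \<psi> t * (\<psi> t * E t / t) + 1 / E t * E' t - 1 / t) (at t)"
      by (intro DERIV_diff DERIV_add)
    then show ?thesis unfolding D_def[abs_def] using \<psi>_pos[OF t] by simp
  qed
  have D_bound: "\<bar>(\<psi> t * E t / t) / \<psi> t + E' t / E t - 1 / t\<bar> \<le> (2 * K + 1) / t" if t: "T0 \<le> t" for t
  proof -
    have t0: "0 < t" using T0 t by simp
    have "(\<psi> t * E t / t) / \<psi> t + E' t / E t - 1 / t = (E t + t * E' t / E t - 1) / t"
      using \<psi>_pos[OF t] t0 by (simp add: field_simps)
    also have "\<bar>\<dots>\<bar> = \<bar>E t + t * E' t / E t - 1\<bar> / t" using t0 by simp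
    also have "\<dots> \<le> (2 * K + 1) / t"
    proof (intro divide_right_mono less_imp_le[OF t0])
      have "\<bar>b + a - 1\<bar> \<le> 2 * K + 1" if "\<bar>a\<bar> \<le> K" "0 < b" "b \<le> K" for a b :: real using that by linarith
      then show "\<bar>E t + t * E' t / E t - 1\<bar> \<le> 2 * K + 1" using E_bounds[OF t] by blast
    qed
    finally show ?thesis .
  qed
  have exp_D: "exp (D t) = \<psi> t * E t / t" if "T0 \<le> t" for t
    using \<psi>_pos[OF that] E_bounds(1)[OF that] T0 that by (simp add: D_def exp_diff exp_add)
  show "\<exists>\<kappa>>0. \<forall>\<^sub>F t in at_top. \<forall>s. \<bar>s - t\<bar> \<le> \<kappa> * t \<longrightarrow>
     \<bar>\<psi> s * E s / s - \<psi> t * E t / t\<bar> \<le> \<delta> * (\<psi> t * E t / t)" if \<delta>: "0 < \<delta>" for \<delta>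
  proof -
    obtain \<kappa> where \<kappa>: "\<kappa> > 0" "\<forall>\<^sub>F t in at_top. \<forall>s. \<bar>s - t\<bar> \<le> \<kappa> * t \<longrightarrow> \<bar>exp (D s) - exp (D t)\<bar> \<le> \<delta> * exp (D t)"
      using stable_of_log_derivative[OF T0 D D_bound \<delta>] by auto
    define \<kappa>' where "\<kappa>' = min \<kappa> (1 / 2)"
    from \<kappa>(2) eventually_ge_at_top[of "2 * T0"]
    have "\<forall>\<^sub>F t in at_top. \<forall>s. \<bar>s - t\<bar> \<le> \<kappa>' * t \<longrightarrow> \<bar>\<psi> s * E s / s - \<psi> t * E t / t\<bar> \<le> \<delta> * (\<psi> t * E t / t)"
    proof eventually_elim
      case (elim t)
      show ?case
      proof (intro allI impI)
        fix s assume s: "\<bar>s - t\<bar> \<le> \<kappa>' * t"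
        have t: "T0 \<le> t" "0 < t" using elim(2) T0 by auto
        have "\<kappa>' * t \<le> \<kappa> * t" "\<kappa>' * t \<le> 1 / 2 * t" using t(2) by (intro mult_right_mono; simp add: \<kappa>'_def)+
        then have near: "\<bar>s - t\<bar> \<le> \<kappa> * t" "T0 \<le> s" using s elim(2) by linarith+
        then have "\<bar>exp (D s) - exp (D t)\<bar> \<le> \<delta> * exp (D t)" using elim(1) by blast
        then show "\<bar>\<psi> s * E s / s - \<psi> t * E t / t\<bar> \<le> \<delta> * (\<psi> t * E t / t)"
          unfolding exp_D[OF t(1)] exp_D[OF near(2)] .
      qed
    qed
    moreover have "\<kappa>' > 0" using \<kappa>(1) by (simp add: \<kappa>'_def)
    ultimately show ?thesis by blast
  qed
  \<comment> \<open>Here t^2 \<psi>' equals t E \<psi>, and \<psi> is at least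
    \<open>X0\<close>.\<close>
  have "filterlim (\<lambda>t. t * E t * X0) at_top at_top"
    using filterlim_tendsto_pos_mult_at_top[OF tendsto_const X0 E_large] by (simp add: mult.commute)
  then show "filterlim (\<lambda>t. t\<^sup>2 * (\<psi> t * E t / t)) at_top at_top"
  proof (rule filterlim_at_top_mono)
    show "\<forall>\<^sub>F t in at_top. t * E t * X0 \<le> t\<^sup>2 * (\<psi> t * E t / t)"
      using eventually_ge_at_top[of T0]
    proof eventually_elim
      case (elim t)
      have "t * E t * X0 \<le> t * E t * \<psi> t"
        using E_bounds(1)[OF elim] \<psi>_ge[OF elim] T0 elim by (intro mult_left_mono) auto
      then show ?case using T0 elim by (simp add: power2_eq_square mult_ac)
    qed
  qed
qed (use assms in auto)

section \<open>From the integral representations to the derivative of the inverse\<close>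

lemma integral_R0_has_derivative:
  fixes e :: "real \<Rightarrow> real"
  assumes e: "continuous_on {1..} e" and x: "1 < x"
  shows "((\<lambda>x. exp (integral {1..x} (\<lambda>u. e u / u))) has_real_derivative exp (integral {1..x} (\<lambda>u. e u / u)) * (e x / x)) (at x)"
proof -
  have cont: "continuous_on {1..x + 1} (\<lambda>u. e u / u)"
    by (intro continuous_intros continuous_on_subset[OF e]) auto
  have "((\<lambda>x. integral {1..x} (\<lambda>u. e u / u)) has_real_derivative e x / x) (at x within {1..x + 1})"
    using integral_has_real_derivative[OF cont, of x] x by simp
  then have "((\<lambda>x. integral {1..x} (\<lambda>u. e u / u)) has_real_derivative e x / x) (at x)"
    using x at_within_interior[of x "{1..x + 1}"] by simp
  from DERIV_chain2[where f = exp, OF DERIV_exp this] show ?thesis .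
qed

lemma R0_with_has_derivative:
  assumes "R0_with l e e' e''" and x: "1 < x"
  shows "(l has_real_derivative l x * e x / x) (at x)" and "(e has_real_derivative e' x) (at x)"
proof -
  have e: "\<And>x. 1 \<le> x \<Longrightarrow> (e has_real_derivative e' x) (at x within {1..})"
    and l: "\<And>x. 1 \<le> x \<Longrightarrow> l x = exp (integral {1..x} (\<lambda>u. e u / u))"
    using assms(1) by (auto simp: R0_with_def)
  have cont: "continuous_on {1..} e"
    unfolding continuous_on_eq_continuous_within using e DERIV_continuous by blast
  show "(e has_real_derivative e' x) (at x)"
    using e[of x] x at_within_interior[of x "{1..}"] by (simp add: interior_real_atLeast)
  have "(l has_real_derivative exp (integral {1..x} (\<lambda>u. e u / u)) * (e x / x)) (at x)"
  proof (rule has_field_derivative_transform_within_open[OF integral_R0_has_derivative[OF cont x], of "{1<..}"])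
  qed (use x l in auto)
  then show "(l has_real_derivative l x * e x / x) (at x)"
    using x l[of x] by simp
qed

lemma gen_inverse_eqI:
  assumes "0 < x" "u \<le> h x" "\<And>y. 0 < y \<Longrightarrow> y < x \<Longrightarrow> h y < u"
  shows "gen_inverse h u = x"
  unfolding gen_inverse_def
proof (rule cInf_eq_minimum)
  show "x \<le> y" if "y \<in> {x. 0 < x \<and> u \<le> h x}" for y
    using that assms(3)[of y] by force
qed (use assms in simp)

text \<open>A level above the supremum of \<open>h\<close> on \<open>{0<..b}\<close> is reached only
  beyond \<open>b\<close>. Unboundedness keeps the level sets nonempty; the infimum of an empty set
  would carry no information.\<close>

lemma gen_inverse_at_top:
  assumes bdd: "\<And>b. bdd_above (h ` {0<..b})" and unbounded: "\<And>u. \<exists>x>0. u \<le> h x"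
  shows "filterlim (gen_inverse h) at_top at_top"
  unfolding filterlim_at_top
proof
  fix b :: real
  obtain H where "\<forall>x\<in>{0<..b}. h x \<le> H"
    using bdd[of b] unfolding bdd_above_def by auto
  then have H: "\<And>x. 0 < x \<Longrightarrow> x \<le> b \<Longrightarrow> h x \<le> H" by simp
  show "\<forall>\<^sub>F u in at_top. b \<le> gen_inverse h u"
    using eventually_gt_at_top[of H]
  proof eventually_elim
    case (elim u)
    show ?case unfolding gen_inverse_def
    proof (rule cInf_greatest)
      show "{x. 0 < x \<and> u \<le> h x} \<noteq> {}" using unbounded[of u] by auto
      show "b \<le> x" if "x \<in> {x. 0 < x \<and> u \<le> h x}" for x
        using that H[of x] elim by force
    qed
  qed
qed

text \<open>Beyond \<open>X0\<close> the logarithmic derivative of \<open>h\<close> is (\<beta> +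
  e)/x with \<beta> + e between \<beta>/2 and 2\<beta>, so \<open>h\<close> is strictly increasing
  there with at least power growth. Below \<open>X0\<close> only an upper bound \<open>H\<close> is
  known; \<open>gen_inverse h\<close> inverts \<open>h\<close> at levels above \<open>H\<close>,
  where the inverse function rule gives its derivative.\<close>

lemma regular_inverse_of_R_beta:
  assumes h: "h \<in> R_beta \<beta>" and \<beta>: "0 < \<beta>"
    and g: "\<And>x. 0 < x \<Longrightarrow> (g has_real_derivative h x) (at x)"
    and bdd: "\<And>b. bdd_above (h ` {0<..b})"
  shows "\<exists>\<psi>' X0 T0. regular_inverse g h (gen_inverse h) \<psi>' X0 T0"
proof -
  obtain l e e' e'' where R0: "R0_with l e e' e''"
    and hl: "\<forall>\<^sub>F x in at_top. h x = x powr \<beta> * l x"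
    and lims: "Limsup at_top (\<lambda>x. ereal (x * \<bar>e' x\<bar>)) < \<infinity>"
    using h by (auto simp: R_beta_def)
  obtain K :: nat where "Limsup at_top (\<lambda>x. ereal (x * \<bar>e' x\<bar>)) < ereal (real K)"
    using lims less_PInf_Ex_of_nat by auto
  then have evK: "\<forall>\<^sub>F x in at_top. x * \<bar>e' x\<bar> < real K"
    by (auto dest!: Limsup_lessD)
  have e0: "(e \<longlongrightarrow> 0) at_top" using R0 by (simp add: R0_with_def)
  have eve: "\<forall>\<^sub>F x in at_top. \<bar>e x\<bar> < \<beta> / 2"
    using tendstoD[OF e0, of "\<beta> / 2"] \<beta> by simp
  obtain X where X: "\<And>x. X \<le> x \<Longrightarrow> h x = x powr \<beta> * l x \<and> x * \<bar>e' x\<bar> < real K \<and> \<bar>e x\<bar> < \<beta> / 2"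
    using eventually_conj[OF hl eventually_conj[OF evK eve]] unfolding eventually_at_top_linorder by blast
  define X0 where "X0 = max X 1 + 1"
  have X0: "1 < X0" "X < X0" by (auto simp: X0_def)
  have l_pos: "0 < l x" if "1 \<le> x" for x using R0 that by (simp add: R0_with_def)
  have h_pos: "0 < h x" if "X0 \<le> x" for x using X[of x] l_pos[of x] that X0 by simp
  have h_deriv: "(h has_real_derivative h x * (\<beta> + e x) / x) (at x)" if x: "X0 \<le> x" for x
  proof -
    have x1: "1 < x" "X < x" "0 < x" using x X0 by auto
    have "((\<lambda>x. x powr \<beta>) has_real_derivative \<beta> * x powr (\<beta> - 1)) (at x)"
      by (rule has_real_derivative_powr[OF x1(3)])
    from DERIV_mult[OF this R0_with_has_derivative(1)[OF R0 x1(1)]]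
    have "((\<lambda>x. x powr \<beta> * l x) has_real_derivative \<beta> * x powr (\<beta> - 1) * l x + l x * e x / x * x powr \<beta>) (at x)" .
    moreover have "\<beta> * x powr (\<beta> - 1) * l x + l x * e x / x * x powr \<beta> = h x * (\<beta> + e x) / x"
      using X[of x] x1 by (simp add: powr_diff field_simps)
    ultimately have "((\<lambda>x. x powr \<beta> * l x) has_real_derivative h x * (\<beta> + e x) / x) (at x)" by simp
    then show ?thesis
      by (rule has_field_derivative_transform_within_open[where S = "{X<..}"]) (use x1 X in auto)
  qed
  have \<beta>e: "\<beta> / 2 < \<beta> + e x" "\<beta> + e x < 2 * \<beta>" if "X0 \<le> x" for x
    using X[of x] that X0 \<beta> by (auto simp: abs_less_iff)
  have h_strict: "h x < h y" if "X0 \<le> x" "x < y" for x y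
  proof (rule DERIV_pos_imp_increasing[OF that(2)])
    fix z assume "x \<le> z" "z \<le> y"
    then have z: "X0 \<le> z" using that by simp
    then show "\<exists>D. (h has_real_derivative D) (at z) \<and> 0 < D"
      using h_deriv[OF z] h_pos[OF z] \<beta>e(1)[OF z] \<beta> X0 by (intro exI[of _ "h z * (\<beta> + e z) / z"]) auto
  qed
  have h_cont: "isCont h x" if "X0 \<le> x" for x using DERIV_isCont[OF h_deriv[OF that]] .
  \<comment> \<open>ln h minus (\<beta>/2) ln x is nondecreasing, because \<beta> + e exceeds
    \<beta>/2.\<close>
  have h_ge: "h X0 * (x / X0) powr (\<beta> / 2) \<le> h x" if x: "X0 \<le> x" for x
  proof -
    have "ln (h X0) - \<beta> / 2 * ln X0 \<le> ln (h x) - \<beta> / 2 * ln x"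
    proof (rule DERIV_nonneg_imp_nondecreasing[OF x])
      fix z assume z: "X0 \<le> z" "z \<le> x"
      have z0: "0 < z" using z X0 by simp
      have "((\<lambda>z. ln (h z)) has_real_derivative 1 / h z * (h z * (\<beta> + e z) / z)) (at z)"
        by (rule DERIV_chain2[where f = ln, OF DERIV_ln_divide[OF h_pos[OF z(1)]] h_deriv[OF z(1)]])
      moreover have "((\<lambda>z. \<beta> / 2 * ln z) has_real_derivative \<beta> / 2 * (1 / z)) (at z)"
        by (rule DERIV_cmult[OF DERIV_ln_divide[OF z0]])
      ultimately have "((\<lambda>z. ln (h z) - \<beta> / 2 * ln z) has_real_derivative 1 / h z * (h z * (\<beta> + e z) / z) - \<beta> / 2 * (1 / z)) (at z)"
        by (rule DERIV_diff)
      moreover have "1 / h z * (h z * (\<beta> + e z) / z) - \<beta> / 2 * (1 / z) = (\<beta> + e z - \<beta> / 2) / z"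
        using h_pos[OF z(1)] z0 by (simp add: field_simps)
      moreover have "0 \<le> (\<beta> + e z - \<beta> / 2) / z" using \<beta>e(1)[OF z(1)] z0 by simp
      ultimately show "\<exists>D. ((\<lambda>z. ln (h z) - \<beta> / 2 * ln z) has_real_derivative D) (at z) \<and> 0 \<le> D" by auto
    qed
    then have "ln (h X0) + \<beta> / 2 * (ln x - ln X0) \<le> ln (h x)" by (simp add: field_simps)
    then have "exp (ln (h X0) + \<beta> / 2 * (ln x - ln X0)) \<le> h x"
      using h_pos[OF x] by (simp add: ln_ge_iff)
    moreover have "ln (x / X0) = ln x - ln X0" using x X0 by (simp add: ln_div)
    ultimately show ?thesis
      using x X0 h_pos[of X0] by (simp add: powr_def exp_add)
  qed
  have unbounded: "\<exists>x>X0. u < h x" for u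
  proof -
    \<comment> \<open>Chosen so that the lower bound \<open>h_ge\<close> equals
      \<open>\<bar>u\<bar> + 2 * h X0\<close>.\<close>
    define x where "x = X0 * (\<bar>u\<bar> / h X0 + 2) powr (2 / \<beta>)"
    have "0 \<le> \<bar>u\<bar> / h X0" using h_pos[of X0] by simp
    then have y: "1 < \<bar>u\<bar> / h X0 + 2" by linarith
    then have "1 < (\<bar>u\<bar> / h X0 + 2) powr (2 / \<beta>)" using \<beta> by (intro gr_one_powr) auto
    then have x: "X0 < x" using X0 by (simp add: x_def)
    have "u < h X0 * (\<bar>u\<bar> / h X0 + 2)" using h_pos[of X0] by (simp add: algebra_simps)
    also have "\<dots> = h X0 * (x / X0) powr (\<beta> / 2)"
      using y X0 \<beta> by (simp add: x_def powr_powr)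
    also have "\<dots> \<le> h x" by (rule h_ge) (use x in simp)
    finally show ?thesis using x by blast
  qed
  obtain H where "\<forall>x\<in>{0<..X0}. h x \<le> H"
    using bdd[of X0] unfolding bdd_above_def by auto
  then have H: "\<And>x. 0 < x \<Longrightarrow> x \<le> X0 \<Longrightarrow> h x \<le> H" by simp
  let ?\<psi> = "gen_inverse h"
  \<comment> \<open>Points up to \<open>X0\<close> have values at most \<open>H\<close>, hence
    cannot reach the level first; above \<open>X0\<close> strict monotonicity decides.\<close>
  have \<psi>_h: "?\<psi> (h x) = x" if x: "X0 < x" "H < h x" for x
  proof (rule gen_inverse_eqI)
    fix y assume y: "0 < y" "y < x"
    show "h y < h x" using h_strict[of y x] H[of y] x y by (cases "y \<le> X0") auto
  qed (use x X0 in auto)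
  have \<psi>_ex: "X0 < ?\<psi> t \<and> h (?\<psi> t) = t" if t: "H < t" for t
  proof -
    obtain x1 where x1: "X0 < x1" "t < h x1" using unbounded by blast
    have "h X0 \<le> t" using H[of X0] X0 t by simp
    then obtain x where x: "X0 \<le> x" "x \<le> x1" "h x = t"
      using IVT[of h X0 t x1] x1 h_cont by auto
    moreover have "x \<noteq> X0" using x(3) H[of X0] X0 t by auto
    ultimately show ?thesis using \<psi>_h[of x] t by auto
  qed
  have \<psi>_cont: "isCont ?\<psi> t" if t: "H < t" for t
  proof -
    \<comment> \<open>A level still above \<open>H\<close> but below \<open>t\<close>, so that
      \<open>h\<close> is invertible on a neighbourhood of \<open>?\<psi> t\<close>.\<close>
    define t' where "t' = (H + t) / 2"
    have t': "H < t'" "t' < t" using t by (auto simp: t'_def)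
    have lt: "?\<psi> t' < ?\<psi> t"
      using h_strict[of "?\<psi> t" "?\<psi> t'"] \<psi>_ex[OF t] \<psi>_ex[OF t'(1)] t' by (cases "?\<psi> t'" "?\<psi> t" rule: linorder_cases) auto
    have "isCont ?\<psi> (h (?\<psi> t))"
    proof (rule isCont_inverse_function2[where f = h and g = ?\<psi> and x = "?\<psi> t" and a = "?\<psi> t'" and b = "?\<psi> t + 1"])
      fix z assume z: "?\<psi> t' \<le> z" "z \<le> ?\<psi> t + 1"
      then have "X0 < z" using \<psi>_ex[OF t'(1)] by simp
      moreover have "t' \<le> h z" using \<psi>_ex[OF t'(1)] h_strict[of "?\<psi> t'" z] z by (cases "z = ?\<psi> t'") auto
      ultimately show "?\<psi> (h z) = z" "isCont h z" using \<psi>_h[of z] t' h_cont[of z] by auto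
    qed (use lt in auto)
    then show ?thesis using \<psi>_ex[OF t] by simp
  qed
  define T0 where "T0 = max H 0 + 1"
  have T0: "0 < T0" "H < T0" by (auto simp: T0_def)
  define E where "E t = 1 / (\<beta> + e (?\<psi> t))" for t
  have \<psi>_deriv: "(?\<psi> has_real_derivative ?\<psi> t * E t / t) (at t)" if t: "T0 \<le> t" for t
  proof -
    have Ht: "H < t" using t T0 by simp
    have \<psi>t: "X0 < ?\<psi> t" "h (?\<psi> t) = t" using \<psi>_ex[OF Ht] by auto
    have D: "(h has_real_derivative t * (\<beta> + e (?\<psi> t)) / ?\<psi> t) (at (?\<psi> t))" using h_deriv[of "?\<psi> t"] \<psi>t by simp
    have "(?\<psi> has_real_derivative inverse (t * (\<beta> + e (?\<psi> t)) / ?\<psi> t)) (at t)"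
    proof (rule DERIV_inverse_function[where g = ?\<psi> and x = t and a = H and b = "t + 1", OF D])
      show "t * (\<beta> + e (?\<psi> t)) / ?\<psi> t \<noteq> 0" using \<beta>e(1)[of "?\<psi> t"] \<psi>t t T0 X0 \<beta> by auto
    qed (use Ht \<psi>_ex \<psi>_cont in auto)
    then show ?thesis by (simp add: E_def divide_inverse mult_ac)
  qed
  have "regular_inverse g h ?\<psi> (\<lambda>t. ?\<psi> t * E t / t) X0 T0"
  \<comment> \<open>The first summand of the constant bounds \<open>E\<close>; the second bounds t
    E'/E, which is -\<psi> e'(\<psi>) E^2.\<close>
  proof (rule regular_inverseI[where K = "2 / \<beta> + real K * (2 / \<beta>)\<^sup>2" and E' = "\<lambda>t. - (e' (?\<psi> t) * (?\<psi> t * E t / t)) * (E t)\<^sup>2"])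
    show "0 < X0" using X0 by simp
    show "0 < T0" by (rule T0)
    show "h x \<le> h y" if "X0 \<le> x" "x \<le> y" for x y using h_strict[of x y] that by (cases "x = y") auto
    have \<psi>t: "X0 < ?\<psi> t" "h (?\<psi> t) = t" if "T0 \<le> t" for t using \<psi>_ex[of t] that T0 by auto
    then show "X0 \<le> ?\<psi> t" "h (?\<psi> t) = t" if "T0 \<le> t" for t using that by force+
    have E1: "0 < E t" "E t \<le> 2 / \<beta>" "1 / (2 * \<beta>) \<le> E t" if "T0 \<le> t" for t
    proof -
      have "\<beta> / 2 < \<beta> + e (?\<psi> t)" "\<beta> + e (?\<psi> t) < 2 * \<beta>" using \<beta>e[of "?\<psi> t"] \<psi>t[OF that] by auto
      then show "0 < E t" "E t \<le> 2 / \<beta>" "1 / (2 * \<beta>) \<le> E t"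
        using \<beta> by (auto simp: E_def field_simps)
    qed
    show "0 < E t \<and> E t \<le> 2 / \<beta> + real K * (2 / \<beta>)\<^sup>2" if "T0 \<le> t" for t
      using E1[OF that] by (auto intro: add_increasing2)
    show "(E has_real_derivative - (e' (?\<psi> t) * (?\<psi> t * E t / t)) * (E t)\<^sup>2) (at t)" if t: "T0 \<le> t" for t
    proof -
      have "(e has_real_derivative e' (?\<psi> t)) (at (?\<psi> t))"
        by (rule R0_with_has_derivative(2)[OF R0]) (use \<psi>t[OF t] X0 in simp)
      from DERIV_chain2[where f = e, OF this \<psi>_deriv[OF t]]
      have D: "((\<lambda>t. \<beta> + e (?\<psi> t)) has_real_derivative e' (?\<psi> t) * (?\<psi> t * E t / t)) (at t)"
        using DERIV_add[OF DERIV_const[of \<beta>]] by fastforce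
      have nz: "\<beta> + e (?\<psi> t) \<noteq> 0" using E1(1)[OF t] by (auto simp: E_def)
      have inv: "inverse (\<beta> + e (?\<psi> v)) = E v" for v by (simp add: E_def inverse_eq_divide)
      have inv2: "inverse ((\<beta> + e (?\<psi> t)) ^ Suc (Suc 0)) = (E t)\<^sup>2"
        by (simp add: inv[symmetric] power2_eq_square)
      have "(E has_real_derivative - (e' (?\<psi> t) * (?\<psi> t * E t / t) * (E t)\<^sup>2)) (at t)"
        using DERIV_inverse_fun[OF D nz] by (simp only: inv inv2)
      then show ?thesis by simp
    qed
    show "\<bar>t * (- (e' (?\<psi> t) * (?\<psi> t * E t / t)) * (E t)\<^sup>2) / E t\<bar> \<le> 2 / \<beta> + real K * (2 / \<beta>)\<^sup>2" if t: "T0 \<le> t" for t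
    proof -
      have p: "0 < ?\<psi> t" "0 < t" using \<psi>t[OF t] X0 T0 t by auto
      have "\<bar>t * (- (e' (?\<psi> t) * (?\<psi> t * E t / t)) * (E t)\<^sup>2) / E t\<bar> = ?\<psi> t * \<bar>e' (?\<psi> t)\<bar> * (E t)\<^sup>2"
        using p E1(1)[OF t] by (simp add: abs_mult power2_eq_square)
      also have "\<dots> \<le> real K * (2 / \<beta>)\<^sup>2"
        using X[of "?\<psi> t"] \<psi>t[OF t] X0 E1[OF t] p by (intro mult_mono power_mono) auto
      also have "\<dots> \<le> 2 / \<beta> + real K * (2 / \<beta>)\<^sup>2" using \<beta> by simp
      finally show ?thesis .
    qed
    show "filterlim ?\<psi> at_top at_top"
    proof (rule gen_inverse_at_top[OF bdd])
      show "\<exists>x>0. u \<le> h x" for u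
      proof -
        obtain x where "X0 < x" "u < h x" using unbounded by blast
        then show ?thesis using X0 by (intro exI[of _ x]) auto
      qed
    qed
    have "filterlim (\<lambda>t::real. t * (1 / (2 * \<beta>))) at_top at_top"
      using filterlim_tendsto_pos_mult_at_top[OF tendsto_const _ filterlim_ident, of "1 / (2 * \<beta>)"] \<beta> by (simp add: mult.commute)
    then show "filterlim (\<lambda>t. t * E t) at_top at_top"
    proof (rule filterlim_at_top_mono)
      show "\<forall>\<^sub>F t in at_top. t * (1 / (2 * \<beta>)) \<le> t * E t"
        using eventually_ge_at_top[of T0] by eventually_elim (rule mult_left_mono[OF E1(3)]; use T0 in simp)
    qed
  qed (use g \<psi>_deriv in auto)
  then show ?thesis by blast
qed

text \<open>Here the representation gives \<psi>, its derivative and \<open>E = e\<close> directly,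
  and the lower limit condition makes \<open>e\<close> eventually positive. What must be proved is
  that \<psi> is a true right inverse, since \<open>h\<close> is not assumed continuous.\<close>

lemma regular_inverse_of_R_infinity:
  assumes h: "h \<in> R_infinity"
    and g: "\<And>x. 0 < x \<Longrightarrow> (g has_real_derivative h x) (at x)"
  shows "\<exists>\<psi>' X0 T0. regular_inverse g h (gen_inverse h) \<psi>' X0 T0"
proof -
  let ?\<psi> = "gen_inverse h"
  have mono: "strict_mono_on {0<..} h" and "?\<psi> \<in> R0_tilde"
    using h by (auto simp: R_infinity_def)
  then obtain e e' e'' \<eta> where R0: "R0_with ?\<psi> e e' e''" and \<psi>_top: "filterlim ?\<psi> at_top at_top"
    and e'0: "((\<lambda>x. x * e' x / e x) \<longlongrightarrow> 0) at_top"
    and \<eta>: "0 < \<eta>" "\<eta> < 1 / 4" and lim: "Liminf at_top (\<lambda>x. ereal (x powr \<eta> * e x)) > 0"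
    by (auto simp: R0_tilde_def)
  obtain r where r: "0 < ereal r" "ereal r < Liminf at_top (\<lambda>x. ereal (x powr \<eta> * e x))"
    using ereal_dense2[OF lim] by blast
  have evr: "\<forall>\<^sub>F x in at_top. r < x powr \<eta> * e x" using less_LiminfD[OF r(2)] by simp
  have r0: "0 < r" using r(1) by simp
  have e0: "(e \<longlongrightarrow> 0) at_top" using R0 by (simp add: R0_with_def)
  have ev1: "\<forall>\<^sub>F x in at_top. \<bar>e x\<bar> < 1" using tendstoD[OF e0, of 1] by simp
  have ev2: "\<forall>\<^sub>F x in at_top. \<bar>x * e' x / e x\<bar> < 1" using tendstoD[OF e'0, of 1] by simp
  obtain T where T: "\<And>x. T \<le> x \<Longrightarrow> r < x powr \<eta> * e x \<and> \<bar>e x\<bar> < 1 \<and> \<bar>x * e' x / e x\<bar> < 1"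
    using eventually_conj[OF evr eventually_conj[OF ev1 ev2]] unfolding eventually_at_top_linorder by blast
  define T1 where "T1 = max T 1 + 1"
  have T1: "1 < T1" "T < T1" by (auto simp: T1_def)
  have e_pos: "0 < e t" if "T1 \<le> t" for t
  proof -
    have "0 < t powr \<eta> * e t" using T[of t] T1 that r0 by simp
    then show ?thesis using that T1 by (simp add: zero_less_mult_iff)
  qed
  have \<psi>_pos: "0 < ?\<psi> t" if "1 \<le> t" for t using R0 that by (simp add: R0_with_def)
  have \<psi>_deriv: "(?\<psi> has_real_derivative ?\<psi> t * e t / t) (at t)" if "T1 \<le> t" for t
    by (rule R0_with_has_derivative(1)[OF R0]) (use that T1 in simp)
  have \<psi>_strict: "?\<psi> s < ?\<psi> t" if "T1 \<le> s" "s < t" for s t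
  proof (rule DERIV_pos_imp_increasing[OF that(2)])
    fix z assume "s \<le> z" "z \<le> t"
    then have z: "T1 \<le> z" using that by simp
    then show "\<exists>D. (?\<psi> has_real_derivative D) (at z) \<and> 0 < D"
      using \<psi>_deriv[OF z] \<psi>_pos[of z] e_pos[OF z] T1 by (intro exI[of _ "?\<psi> z * e z / z"]) auto
  qed
  \<comment> \<open>If \<open>h\<close> never reached a level, all higher levels would give the same
    \<open>Inf {}\<close>, contradicting strict growth of \<psi>.\<close>
  have nonempty: "{x. 0 < x \<and> u \<le> h x} \<noteq> {}" for u
  proof
    assume empty: "{x. 0 < x \<and> u \<le> h x} = {}"
    let ?s = "max u T1"
    have "{x. 0 < x \<and> v \<le> h x} = {}" if "u \<le> v" for v using empty that by force
    then have "?\<psi> v = Inf {}" if "u \<le> v" for v unfolding gen_inverse_def using that by (simp only:)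
    from this[of ?s] this[of "?s + 1"] have "?\<psi> ?s = ?\<psi> (?s + 1)" by simp
    then show False using \<psi>_strict[of ?s "?s + 1"] by simp
  qed
  have bdd: "bdd_below {x. 0 < x \<and> u \<le> h x}" for u by (rule bdd_belowI[of _ 0]) auto
  have h_less: "h y < t" if "0 < y" "y < ?\<psi> t" for y t
  proof (rule ccontr)
    assume "\<not> h y < t"
    then have "?\<psi> t \<le> y" unfolding gen_inverse_def using that by (intro cInf_lower bdd) auto
    then show False using that by simp
  qed
  have h_strict: "h x < h y" if "0 < x" "x < y" for x y using strict_mono_onD[OF mono, of x y] that by simp
  have h_ge: "t \<le> h y" if ty: "?\<psi> t < y" for y t
  proof -
    obtain z where "0 < z" "t \<le> h z" "z < y" using cInf_lessD[OF nonempty, of t y] ty unfolding gen_inverse_def by auto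
    then show ?thesis using h_strict[of z y] by simp
  qed
  text \<open>A jump of \<open>h\<close> would make \<open>\<psi>\<close> constant on an interval.\<close>
  have h_\<psi>: "h (?\<psi> t) = t" if t: "T1 < t" for t
  proof (rule antisym; rule ccontr)
    have pos: "0 < ?\<psi> t" using \<psi>_pos t T1 by simp
    {
      assume "\<not> h (?\<psi> t) \<le> t"
      then obtain u where u: "t < u" "u < h (?\<psi> t)" using dense by (meson not_le)
      have "?\<psi> u = ?\<psi> t"
        by (rule gen_inverse_eqI) (use pos u h_less[of _ t] in \<open>auto intro: less_trans\<close>)
      then show False using \<psi>_strict[of t u] u t by simp
    }
    {
      assume "\<not> t \<le> h (?\<psi> t)"
      then obtain u where u: "max T1 (h (?\<psi> t)) < u" "u < t" using dense[of "max T1 (h (?\<psi> t))" t] t by auto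
      have lt: "?\<psi> u < ?\<psi> t" using \<psi>_strict[of u t] u by simp
      then obtain y where y: "?\<psi> u < y" "y < ?\<psi> t" using dense by blast
      have "u \<le> h y" by (rule h_ge[OF y(1)])
      also have "\<dots> < h (?\<psi> t)" using y \<psi>_pos[of u] u T1 by (intro h_strict) auto
      finally show False using u by simp
    }
  qed
  define T0 where "T0 = T1 + 1"
  have T0: "T1 < T0" "0 < T0" using T1 by (auto simp: T0_def)
  have "regular_inverse g h ?\<psi> (\<lambda>t. ?\<psi> t * e t / t) (?\<psi> T0) T0"
  proof (rule regular_inverseI[where K = 1 and E' = e'])
    show X0: "0 < ?\<psi> T0" using \<psi>_pos[of T0] T0 T1 by simp
    show "0 < T0" by (rule T0)
    show "h x \<le> h y" if "?\<psi> T0 \<le> x" "x \<le> y" for x y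
      using h_strict[of x y] that X0 by (cases "x = y") auto
    show "?\<psi> T0 \<le> ?\<psi> t" if "T0 \<le> t" for t
      using \<psi>_strict[of T0 t] that T0 by (cases "t = T0") auto
    show "(e has_real_derivative e' t) (at t)" if "T0 \<le> t" for t
      by (rule R0_with_has_derivative(2)[OF R0]) (use that T0 T1 in simp)
    show "0 < e t \<and> e t \<le> 1" "\<bar>t * e' t / e t\<bar> \<le> 1" if "T0 \<le> t" for t
      using e_pos[of t] T[of t] that T0 T1 by auto
    \<comment> \<open>For t > 1, \<open>t powr \<eta>\<close> is at most \<open>sqrt t\<close>, so
      the lower limit condition gives \<open>e t \<ge> r / sqrt t\<close>.\<close>
    have "filterlim (\<lambda>t::real. r * sqrt t) at_top at_top"
      by (rule filterlim_tendsto_pos_mult_at_top[OF tendsto_const r0 sqrt_at_top])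
    then show "filterlim (\<lambda>t. t * e t) at_top at_top"
    proof (rule filterlim_at_top_mono)
      show "\<forall>\<^sub>F t in at_top. r * sqrt t \<le> t * e t"
        using eventually_ge_at_top[of T0]
      proof eventually_elim
        case (elim t)
        then have t: "1 < t" "T \<le> t" using T0 T1 by auto
        have e: "0 < e t" using e_pos[of t] elim T0 by simp
        have "r \<le> t powr \<eta> * e t" using T[OF t(2)] by simp
        also have "\<dots> \<le> t powr (1 / 2) * e t" using t \<eta> e by (intro mult_right_mono powr_mono) auto
        also have "\<dots> = sqrt t * e t" using t by (simp add: powr_half_sqrt)
        finally have "r * sqrt t \<le> sqrt t * e t * sqrt t" using t by (intro mult_right_mono) auto
        also have "\<dots> = t * e t" using t by simp
        finally show ?case .
      qed
    qed
  qed (use g \<psi>_deriv h_\<psi> \<psi>_top T0 in auto)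
  then show ?thesis by blast
qed

lemma regular_inverse_of_R_class:
  assumes "h \<in> R_class" "\<And>x. 0 < x \<Longrightarrow> (g has_real_derivative h x) (at x)" "\<And>b. bdd_above (h ` {0<..b})"
  shows "\<exists>\<psi>' X0 T0. regular_inverse g h (gen_inverse h) \<psi>' X0 T0"
  using assms regular_inverse_of_R_beta regular_inverse_of_R_infinity unfolding R_class_def by blast

section \<open>The conditional density\<close>

lemma residual_mean_at_top:
  assumes a: "filterlim a at_top sequentially"
  shows "filterlim (\<lambda>n. residual_mean a y n i) at_top sequentially"
proof -
  let ?S = "\<Sum>j=1..i. y j"
  have "filterlim (\<lambda>n. - \<bar>?S\<bar> + a n) at_top sequentially"
    by (rule filterlim_tendsto_add_at_top[OF tendsto_const a])
  then show ?thesis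
  proof (rule filterlim_at_top_mono)
    show "\<forall>\<^sub>F n in sequentially. - \<bar>?S\<bar> + a n \<le> residual_mean a y n i"
      using eventually_ge_at_top[of "Suc i"] a[unfolded filterlim_at_top, rule_format, of 0]
    proof eventually_elim
      case (elim n)
      define d where "d = real n - real i"
      have d: "1 \<le> d" "d \<le> real n" using elim(1) by (auto simp: d_def)
      have "d * a n \<le> real n * a n" using d elim(2) by (intro mult_right_mono)
      moreover have "\<bar>?S\<bar> * 1 \<le> \<bar>?S\<bar> * d" using d by (intro mult_left_mono) auto
      ultimately have "(- \<bar>?S\<bar> + a n) * d \<le> real n * a n - ?S" by (simp add: algebra_simps)
      then show ?case using d unfolding residual_mean_def d_def[symmetric] by (simp add: pos_le_divide_eq)
    qed
  qed
qed

text \<open>Subtracting the defining equations gives (m_i - m_k)(n - i) = (s_k - s_i) - (k - i) m_k.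
  Eventually n - i is at least n/2 and m_k at least 1, so the constant absorbs both terms.\<close>

lemma residual_mean_close:
  assumes a: "filterlim a at_top sequentially" and i: "i \<le> k"
  shows "\<exists>K. \<forall>\<^sub>F n in sequentially.
    \<bar>residual_mean a y n i - residual_mean a y n k\<bar> \<le> K * residual_mean a y n k / real n"
proof -
  define S where "S j = (\<Sum>l=1..j. y l)" for j
  define K where "K = 2 * (\<bar>S k - S i\<bar> + real k)"
  have "\<forall>\<^sub>F n in sequentially. \<bar>residual_mean a y n i - residual_mean a y n k\<bar> \<le> K * residual_mean a y n k / real n"
    using eventually_ge_at_top[of "2 * k + 1"] residual_mean_at_top[OF a, of y k, unfolded filterlim_at_top, rule_format, of 1]
  proof eventually_elim
    case (elim n)
    define m m' where "m = residual_mean a y n k" and "m' = residual_mean a y n i"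
    have n: "0 < real n - real k" "real n / 2 \<le> real n - real i" "0 < real n" using elim(1) i by auto
    have e1: "m * (real n - real k) = real n * a n - S k" and e2: "m' * (real n - real i) = real n * a n - S i"
      using n by (simp_all add: m_def m'_def residual_mean_def S_def)
    have "(m' - m) * (real n - real i) = (S k - S i) - (real k - real i) * m"
      using e1 e2 by (simp add: algebra_simps)
    also have "\<bar>\<dots>\<bar> \<le> \<bar>S k - S i\<bar> + \<bar>(real k - real i) * m\<bar>" by (rule abs_triangle_ineq4)
    also have "\<dots> \<le> \<bar>S k - S i\<bar> * m + real k * m"
      using elim(2) i by (intro add_mono) (auto simp: m_def abs_mult mult_right_mono intro: mult_le_cancel_left1[THEN iffD2])
    also have "\<dots> = K / 2 * m" by (simp add: K_def algebra_simps)
    finally have *: "\<bar>m' - m\<bar> * (real n - real i) \<le> K / 2 * m" using n by (simp add: abs_mult)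
    have "\<bar>m' - m\<bar> * (real n / 2) \<le> \<bar>m' - m\<bar> * (real n - real i)" using n by (intro mult_left_mono) auto
    with * have "\<bar>m' - m\<bar> * (real n / 2) \<le> K / 2 * m" by simp
    then have "\<bar>m' - m\<bar> \<le> K * m / real n" using n by (simp add: field_simps)
    then show ?case by (simp add: m_def m'_def)
  qed
  then show ?thesis by blast
qed

section \<open>Tilted mean, its inversion, and the final asymptotics\<close>

context laplace_density
begin

text \<open>Mean and variance of the rescaled density are exactly these two quotients, so both
  limits are moment convergence in \<open>gaussian_limit\<close>, transferred to
  \<open>at_top\<close> through arbitrary sequences.\<close>

lemma
  shows tilted_mean_asymptotic: "((\<lambda>t. (tilted_mean p t - \<psi> t) / \<sigma> t) \<longlongrightarrow> 0) at_top"
    and tilted_variance_asymptotic: "((\<lambda>t. tilted_variance t / \<psi>' t) \<longlongrightarrow> 1) at_top"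
proof -
  obtain C T where T: "T0 \<le> T"
    and G: "\<And>t :: nat \<Rightarrow> real. (\<And>n. T \<le> t n) \<Longrightarrow> filterlim t at_top sequentially \<Longrightarrow>
      gaussian_limit (\<lambda>n. rescaled (t n) (\<psi> (t n)) (\<sigma> (t n))) C"
    using gaussian_limit_rescaled by metis
  have "(\<lambda>n. (tilted_mean p (t n) - \<psi> (t n)) / \<sigma> (t n)) \<longlonglongrightarrow> 0 \<and> (\<lambda>n. tilted_variance (t n) / \<psi>' (t n)) \<longlonglongrightarrow> 1"
    if lim: "filterlim t at_top sequentially" for t :: "nat \<Rightarrow> real"
  proof -
    \<comment> \<open>\<open>gaussian_limit\<close> constrains every index, so the sequence is cut
      off below at \<open>T\<close>, which alters only finitely many terms.\<close>
    define t' where "t' n = max T (t n)" for n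
    have t': "T \<le> t' n" "T0 \<le> t' n" for n using T by (auto simp: t'_def)
    have ev: "\<forall>\<^sub>F n in sequentially. t' n = t n"
      using lim[unfolded filterlim_at_top, rule_format, of T] by eventually_elim (simp add: t'_def)
    have lim': "filterlim t' at_top sequentially"
      using lim by (rule filterlim_at_top_mono) (simp add: t'_def)
    interpret G: gaussian_limit "\<lambda>n. rescaled (t' n) (\<psi> (t' n)) (\<sigma> (t' n))" C by (rule G[OF t'(1) lim'])
    have m: "G.mean = (\<lambda>n. (tilted_mean p (t' n) - \<psi> (t' n)) / \<sigma> (t' n))"
      by (simp add: fun_eq_iff G.mean_def integral_rescaled_id[OF \<sigma>_pos[OF t'(2)]])
    have v: "G.var = (\<lambda>n. tilted_variance (t' n) / \<psi>' (t' n))"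
      by (simp add: fun_eq_iff G.var_def m integral_rescaled_variance[OF \<sigma>_pos[OF t'(2)]] \<sigma>_sq[OF t'(2)])
    have eqs: "\<forall>\<^sub>F n in sequentially. (tilted_mean p (t' n) - \<psi> (t' n)) / \<sigma> (t' n) = (tilted_mean p (t n) - \<psi> (t n)) / \<sigma> (t n)"
      "\<forall>\<^sub>F n in sequentially. tilted_variance (t' n) / \<psi>' (t' n) = tilted_variance (t n) / \<psi>' (t n)"
      using ev by (eventually_elim, simp)+
    show ?thesis
      using Lim_transform_eventually[OF G.mean_tendsto[unfolded m] eqs(1)]
        Lim_transform_eventually[OF G.var_tendsto[unfolded v] eqs(2)] ..
  qed
  then show "((\<lambda>t. (tilted_mean p t - \<psi> t) / \<sigma> t) \<longlongrightarrow> 0) at_top" "((\<lambda>t. tilted_variance t / \<psi>' t) \<longlongrightarrow> 1) at_top"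
    by (blast intro: tendsto_at_topI_sequentially)+
qed

text \<open>The mean eventually exceeds \<psi>(t) - \<sigma>(t), a scaled point.\<close>

lemma tilted_mean_at_top: "filterlim (tilted_mean p) at_top at_top"
proof (rule filterlim_at_top_mono[OF scaled_point_top[of "- 1"]])
  have "\<forall>\<^sub>F t in at_top. - 1 < (tilted_mean p t - \<psi> t) / \<sigma> t"
    using order_tendstoD(1)[OF tilted_mean_asymptotic, of "- 1"] by simp
  then show "\<forall>\<^sub>F t in at_top. \<psi> t + \<sigma> t * - 1 \<le> tilted_mean p t"
    using eventually_ge_at_top[of T0]
  proof eventually_elim
    case (elim t)
    then show ?case using \<sigma>_pos[OF elim(2)] by (simp add: field_simps)
  qed
qed

lemma tilted_mean_tilt:
  assumes "tilted_mean p 0 \<le> m"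
  shows "tilted_mean p (tilt p m) = m"
proof -
  obtain t where t: "0 \<le> t" "m \<le> tilted_mean p t"
    using eventually_conj[OF eventually_ge_at_top[of 0] tilted_mean_at_top[unfolded filterlim_at_top, rule_format, of m]]
      eventually_happens by fastforce
  have "isCont (tilted_mean p) s" for s using DERIV_isCont[OF tilted_mean_has_derivative] .
  then obtain s where "tilted_mean p s = m"
    using IVT[of "tilted_mean p" 0 m t] assms t by auto
  then show ?thesis using tilt_tilted_mean[of s] by simp
qed

lemma tilt_at_top: "filterlim (tilt p) at_top at_top"
  unfolding filterlim_at_top
proof
  fix K
  show "\<forall>\<^sub>F m in at_top. K \<le> tilt p m"
    using eventually_ge_at_top[of "tilted_mean p 0"] eventually_ge_at_top[of "tilted_mean p K"]
    by eventually_elim (metis tilted_mean_tilt strict_mono_less_eq[OF strict_mono_tilted_mean])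
qed

text \<open>Two losses of a factor 2: the variance against \<psi>' at the same point, and \<psi>'
  across the window.\<close>

lemma tilted_variance_ge:
  "\<forall>\<^sub>F t in at_top. \<forall>s. \<bar>s - t\<bar> \<le> 1 / \<sigma> t \<longrightarrow> \<psi>' t / 4 \<le> tilted_variance s"
proof -
  have "\<forall>\<^sub>F t in at_top. 1 / 2 < tilted_variance t / \<psi>' t"
    using order_tendstoD(1)[OF tilted_variance_asymptotic, of "1 / 2"] by simp
  then obtain T where T: "\<And>t. T \<le> t \<Longrightarrow> 1 / 2 < tilted_variance t / \<psi>' t"
    unfolding eventually_at_top_linorder by blast
  have half: "0 < (1 / 2 :: real)" by simp
  show ?thesis
    using \<psi>'_near[OF half, of 1] eventually_ge_at_top[of "2 * T"]
  proof eventually_elim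
    case (elim t)
    show ?case
    proof (intro allI impI)
      fix s assume "\<bar>s - t\<bar> \<le> 1 / \<sigma> t"
      then have s: "T0 \<le> s" "t / 2 \<le> s" "\<bar>\<psi>' s - \<psi>' t\<bar> \<le> 1 / 2 * \<psi>' t" using elim(1) by auto
      have "1 / 2 < tilted_variance s / \<psi>' s" by (rule T) (use s(2) elim(2) in linarith)
      then have "\<psi>' s / 2 < tilted_variance s" using \<psi>'_pos[OF s(1)] by (simp add: field_simps)
      then show "\<psi>' t / 4 \<le> tilted_variance s" using s(3) by linarith
    qed
  qed
qed

text \<open>Over the window of radius \<open>1 / \<sigma> t\<close> the mean has slope at least
  \<open>\<psi>' t / 4\<close>, hence moves by at least \<open>\<sigma> t / 4\<close> before either
  edge. A smaller displacement of the mean thus keeps \<open>s\<close> inside, where the slope bound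
  can be inverted.\<close>

lemma tilt_stable:
  "\<forall>\<^sub>F t in at_top. \<forall>s. \<bar>tilted_mean p s - tilted_mean p t\<bar> < \<sigma> t / 4 \<longrightarrow>
     \<bar>s - t\<bar> * \<psi>' t \<le> 4 * \<bar>tilted_mean p s - tilted_mean p t\<bar>"
  using tilted_variance_ge eventually_ge_at_top[of T0]
proof eventually_elim
  case (elim t)
  let ?m = "tilted_mean p"
  have s0: "0 < \<sigma> t" by (rule \<sigma>_pos[OF elim(2)])
  have sq: "\<psi>' t * (1 / \<sigma> t) = \<sigma> t" using s0 by (simp add: \<sigma>_sq[OF elim(2), symmetric] power2_eq_square)
  then have sq4: "\<psi>' t / 4 * (1 / \<sigma> t) = \<sigma> t / 4" by simp
  have grow: "\<psi>' t / 4 * (v - u) \<le> ?m v - ?m u" if "u \<le> v" "\<bar>u - t\<bar> \<le> 1 / \<sigma> t" "\<bar>v - t\<bar> \<le> 1 / \<sigma> t" for u v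
  proof (cases "u < v")
    case True
    obtain z where z: "u < z" "z < v" "?m v - ?m u = (v - u) * tilted_variance z"
      using MVT2[OF True, of ?m tilted_variance] tilted_mean_has_derivative by blast
    have "\<bar>z - t\<bar> \<le> 1 / \<sigma> t" using z that by linarith
    then have "(v - u) * (\<psi>' t / 4) \<le> (v - u) * tilted_variance z" using elim(1) True by (intro mult_left_mono) auto
    then show ?thesis unfolding z(3) by (simp add: mult.commute)
  qed (use that in simp)
  have mono: "?m u \<le> ?m v" if "u \<le> v" for u v using strict_mono_less_eq[OF strict_mono_tilted_mean] that by simp
  show ?case
  proof (intro allI impI)
    fix s assume d: "\<bar>?m s - ?m t\<bar> < \<sigma> t / 4"
    have s1: "s \<le> t + 1 / \<sigma> t"
    proof (rule ccontr)
      assume "\<not> s \<le> t + 1 / \<sigma> t"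
      then have "?m (t + 1 / \<sigma> t) \<le> ?m s" by (intro mono) simp
      moreover have "\<psi>' t / 4 * (1 / \<sigma> t) \<le> ?m (t + 1 / \<sigma> t) - ?m t" using grow[of t "t + 1 / \<sigma> t"] s0 by simp
      ultimately show False using d unfolding sq4 by linarith
    qed
    have s2: "t - 1 / \<sigma> t \<le> s"
    proof (rule ccontr)
      assume "\<not> t - 1 / \<sigma> t \<le> s"
      then have "?m s \<le> ?m (t - 1 / \<sigma> t)" by (intro mono) simp
      moreover have "\<psi>' t / 4 * (1 / \<sigma> t) \<le> ?m t - ?m (t - 1 / \<sigma> t)" using grow[of "t - 1 / \<sigma> t" t] s0 by simp
      ultimately show False using d unfolding sq4 by linarith
    qed
    have st: "\<bar>s - t\<bar> \<le> 1 / \<sigma> t" using s1 s2 by linarith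
    have tt: "\<bar>t - t\<bar> \<le> 1 / \<sigma> t" using s0 by simp
    show "\<bar>s - t\<bar> * \<psi>' t \<le> 4 * \<bar>?m s - ?m t\<bar>"
    proof (cases "t \<le> s")
      case True
      have "(s - t) * \<psi>' t \<le> 4 * (?m s - ?m t)" using grow[OF True tt st] by (simp add: mult.commute)
      also have "\<dots> \<le> 4 * \<bar>?m s - ?m t\<bar>" by (intro mult_left_mono abs_ge_self) simp
      finally show ?thesis using True by simp
    next
      case False
      then have "s \<le> t" by simp
      have "(t - s) * \<psi>' t \<le> 4 * (?m t - ?m s)" using grow[OF \<open>s \<le> t\<close> st tt] by (simp add: mult.commute)
      also have "\<dots> \<le> 4 * \<bar>?m s - ?m t\<bar>" using abs_ge_minus_self[of "?m s - ?m t"] by (intro mult_left_mono) simp_all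
      finally show ?thesis using False by simp
    qed
  qed
qed

text \<open>\<open>tilt_stable\<close> bounds s - t by a multiple of m/(n \<psi>'), with m the
  tilted mean at \<open>t\<close>. Multiplied by m this is the square of the quantity in
  \<open>small\<close>. The extra factor m is what the second claim needs, since m is the order of
  the derivative of \<open>ln (mgf p)\<close> between \<open>t\<close> and \<open>s\<close>.\<close>

lemma tilt_perturbation:
  fixes s t :: "nat \<Rightarrow> real"
  assumes t: "filterlim t at_top sequentially"
    and small: "(\<lambda>n. tilted_mean p (t n) / (\<sigma> (t n) * sqrt (real n))) \<longlonglongrightarrow> 0"
    and close: "\<forall>\<^sub>F n in sequentially. \<bar>tilted_mean p (s n) - tilted_mean p (t n)\<bar> \<le> K * tilted_mean p (t n) / real n"
  shows "(\<lambda>n. s n - t n) \<longlonglongrightarrow> 0" "(\<lambda>n. ln (mgf p (s n)) - ln (mgf p (t n))) \<longlonglongrightarrow> 0"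
proof -
  let ?m = "tilted_mean p"
  let ?z = "\<lambda>n. ?m (t n) / (\<sigma> (t n) * sqrt (real n))"
  define K1 where "K1 = \<bar>K\<bar> + 1"
  have K1: "0 < K1" "K \<le> K1" by (auto simp: K1_def)
  have m_top: "filterlim (\<lambda>n. ?m (t n)) at_top sequentially"
    by (rule filterlim_compose[OF tilted_mean_at_top t])
  have ev_m: "\<forall>\<^sub>F n in sequentially. 1 \<le> ?m (t n)" using m_top by (simp add: filterlim_at_top)
  have ev_T: "\<forall>\<^sub>F n in sequentially. T0 \<le> t n" using t by (simp add: filterlim_at_top)
  \<comment> \<open>Just small enough that K1 m/n lies below \<sigma>/4, the range of
    \<open>tilt_stable\<close>.\<close>
  have ev_z: "\<forall>\<^sub>F n in sequentially. ?z n < 1 / (4 * K1)"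
    using order_tendstoD(2)[OF small, of "1 / (4 * K1)"] K1 by simp
  have ev_stable: "\<forall>\<^sub>F n in sequentially. \<forall>s. \<bar>?m s - ?m (t n)\<bar> < \<sigma> (t n) / 4 \<longrightarrow>
     \<bar>s - t n\<bar> * \<psi>' (t n) \<le> 4 * \<bar>?m s - ?m (t n)\<bar>"
    using filterlim_iff[THEN iffD1, OF t, rule_format, OF tilt_stable] .
  have main: "\<forall>\<^sub>F n in sequentially. ?m (t n) * \<bar>s n - t n\<bar> \<le> 4 * K1 * (?z n)\<^sup>2 \<and> 1 \<le> ?m (t n) \<and>
      \<bar>?m (s n) - ?m (t n)\<bar> \<le> K1 * ?m (t n)"
    using ev_m ev_T ev_z ev_stable close eventually_ge_at_top[of 1]
  proof eventually_elim
    case (elim n)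
    define m where "m = ?m (t n)"
    define r where "r = sqrt (real n)"
    have n: "1 \<le> real n" using elim(6) by simp
    have r: "1 \<le> r" "r * r = real n" using n by (auto simp: r_def)
    have s0: "0 < \<sigma> (t n)" by (rule \<sigma>_pos[OF elim(2)])
    have m1: "1 \<le> m" using elim(1) by (simp add: m_def)
    have "K * m / real n \<le> K1 * m / real n" using K1 m1 n by (intro divide_right_mono mult_right_mono) auto
    then have d: "\<bar>?m (s n) - m\<bar> \<le> K1 * m / real n" using elim(5) by (simp add: m_def)
    have z: "m / (\<sigma> (t n) * r) < 1 / (4 * K1)" using elim(3) by (simp add: m_def r_def)
    have "K1 * m / real n = K1 * \<sigma> (t n) / r * (m / (\<sigma> (t n) * r))"
      using s0 r by (simp add: field_simps flip: r(2))
    also have "\<dots> < K1 * \<sigma> (t n) / r * (1 / (4 * K1))"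
      using z K1 s0 r by (intro mult_strict_left_mono) auto
    also have "\<dots> = \<sigma> (t n) / 4 / r" using K1 by simp
    also have "\<dots> \<le> \<sigma> (t n) / 4 / 1" using r s0 by (intro divide_left_mono) auto
    finally have "\<bar>?m (s n) - m\<bar> < \<sigma> (t n) / 4" using d by linarith
    then have "\<bar>s n - t n\<bar> * \<psi>' (t n) \<le> 4 * \<bar>?m (s n) - m\<bar>" using elim(4) by (simp add: m_def)
    also have "\<dots> \<le> 4 * (K1 * m / real n)" using d by simp
    finally have "\<bar>s n - t n\<bar> * (\<sigma> (t n))\<^sup>2 \<le> 4 * (K1 * m / real n)" unfolding \<sigma>_sq[OF elim(2)] .
    then have "\<bar>s n - t n\<bar> \<le> 4 * (K1 * m / real n) / (\<sigma> (t n))\<^sup>2" using s0 by (subst pos_le_divide_eq) simp_all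
    then have "m * \<bar>s n - t n\<bar> \<le> m * (4 * (K1 * m / real n) / (\<sigma> (t n))\<^sup>2)" using m1 by (intro mult_left_mono) auto
    also have "\<dots> = 4 * K1 * (m / (\<sigma> (t n) * r))\<^sup>2"
      using r by (simp add: power2_eq_square field_simps flip: r(2))
    finally have 1: "m * \<bar>s n - t n\<bar> \<le> 4 * K1 * (m / (\<sigma> (t n) * r))\<^sup>2" .
    have "K1 * m / real n \<le> K1 * m / 1" using n K1 m1 by (intro divide_left_mono) auto
    then have "\<bar>?m (s n) - m\<bar> \<le> K1 * m" using d by simp
    with 1 m1 show ?case by (simp add: m_def r_def)
  qed
  have bound0: "(\<lambda>n. 4 * K1 * (?z n)\<^sup>2) \<longlonglongrightarrow> 0"
    using tendsto_mult_right_zero[OF tendsto_power[OF small, of 2, unfolded zero_power2], of "4 * K1"] .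
  show "(\<lambda>n. s n - t n) \<longlonglongrightarrow> 0"
  proof (rule Lim_null_comparison[OF _ bound0])
    show "\<forall>\<^sub>F n in sequentially. norm (s n - t n) \<le> 4 * K1 * (?z n)\<^sup>2"
      using main
    proof eventually_elim
      case (elim n)
      have "1 * \<bar>s n - t n\<bar> \<le> ?m (t n) * \<bar>s n - t n\<bar>" using elim by (intro mult_right_mono) auto
      then show ?case using elim by simp
    qed
  qed
  have bound1: "(\<lambda>n. (1 + K1) * (4 * K1 * (?z n)\<^sup>2)) \<longlonglongrightarrow> 0"
    by (rule tendsto_mult_right_zero[OF bound0])
  show "(\<lambda>n. ln (mgf p (s n)) - ln (mgf p (t n))) \<longlonglongrightarrow> 0"
  proof (rule Lim_null_comparison[OF _ bound1])
    show "\<forall>\<^sub>F n in sequentially. norm (ln (mgf p (s n)) - ln (mgf p (t n))) \<le> (1 + K1) * (4 * K1 * (?z n)\<^sup>2)"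
      using main
    proof eventually_elim
      case (elim n)
      have "norm (ln (mgf p (s n)) - ln (mgf p (t n))) \<le> (1 + K1) * ?m (t n) * norm (s n - t n)"
      proof (rule field_differentiable_bound[where S = "closed_segment (t n) (s n)" and f' = ?m])
        fix v assume v: "v \<in> closed_segment (t n) (s n)"
        show "((\<lambda>v. ln (mgf p v)) has_field_derivative ?m v) (at v within closed_segment (t n) (s n))"
          by (rule has_field_derivative_at_within[OF ln_mgf_has_derivative])
        \<comment> \<open>Monotonicity puts intermediate means between the end values, and
          \<open>main\<close> bounds that at \<open>s n\<close> by a multiple of that at
          \<open>t n\<close>.\<close>
        have "min (?m (t n)) (?m (s n)) \<le> ?m v \<and> ?m v \<le> max (?m (t n)) (?m (s n))"
          using v strict_mono_less_eq[OF strict_mono_tilted_mean]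
          by (auto simp: closed_segment_eq_real_ivl min_le_iff_disj le_max_iff_disj split: if_splits)
        then show "norm (?m v) \<le> (1 + K1) * ?m (t n)"
          using elim K1 by (auto simp: abs_le_iff algebra_simps min_def max_def split: if_splits)
      qed auto
      also have "\<dots> = (1 + K1) * (?m (t n) * \<bar>s n - t n\<bar>)" by simp
      also have "\<dots> \<le> (1 + K1) * (4 * K1 * (?z n)\<^sup>2)" using elim K1 by (intro mult_left_mono) auto
      finally show ?case .
    qed
  qed
qed

text \<open>Both densities in the quotient are written with the same tilt \<open>t n\<close>.
  Dividing leaves exp(t s_k)/mgf^k times the ratio \<open>F1 n / F2 n\<close> of tilted densities;
  the first factor is split among the coordinates and corrected by the \<open>L i n\<close>.\<close>

lemma conditional_density_asymptotic:
  fixes M :: "'a measure" and X :: "nat \<Rightarrow> 'a \<Rightarrow> real" and a :: "nat \<Rightarrow> real" and y :: "nat \<Rightarrow> real"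
  assumes M: "prob_space M"
    and ind: "prob_space.indep_vars M (\<lambda>_. borel) X {1..}"
    and X: "\<And>i. 1 \<le> i \<Longrightarrow> distributed M lborel (X i) (\<lambda>x. ennreal (p x))"
    and a: "filterlim a at_top sequentially"
    and cond: "(\<lambda>n. (\<psi> (tilt p (residual_mean a y n k)))\<^sup>2 / sqrt (real n * \<psi>' (tilt p (residual_mean a y n k)))) \<longlonglongrightarrow> 0"
  shows "\<exists>\<epsilon>. \<epsilon> \<longlonglongrightarrow> 0 \<and> (\<forall>\<^sub>F n in sequentially. cond_density M X p k n y (real n * a n) =
       (\<Prod>i=0..<k. tilted_density p (residual_mean a y n i) (y (i + 1))) * (1 + \<epsilon> n))"
proof -
  let ?m = "tilted_mean p"
  let ?r = "residual_mean a y"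
  define S where "S j = (\<Sum>l=1..j. y l)" for j
  define m where "m n = ?r n k" for n
  define t where "t n = tilt p (m n)" for n
  let ?s = "\<lambda>n. \<sigma> (t n) * sqrt (real n)"
  let ?F = "\<lambda>t j. inverse_char (\<lambda>\<tau>. tilted_char t \<tau> ^ j)"
  have m_top: "filterlim m at_top sequentially"
    unfolding m_def[abs_def] by (rule residual_mean_at_top[OF a])
  have t_top: "filterlim t at_top sequentially"
    unfolding t_def[abs_def] by (rule filterlim_compose[OF tilt_at_top m_top])
  have mean_res: "\<forall>\<^sub>F n in sequentially. ?m (tilt p (?r n i)) = ?r n i" for i
    using residual_mean_at_top[OF a, of y i, unfolded filterlim_at_top, rule_format, of "?m 0"]
    by eventually_elim (rule tilted_mean_tilt)
  have mean_t: "\<forall>\<^sub>F n in sequentially. ?m (t n) = m n"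
    using mean_res[of k] by (simp add: t_def m_def)
  have ev_T: "\<forall>\<^sub>F n in sequentially. T0 \<le> t n" using t_top by (simp add: filterlim_at_top)
  have sqrt_top: "filterlim (\<lambda>n. sqrt (real n)) at_infinity sequentially"
    by (rule filterlim_at_top_imp_at_infinity[OF filterlim_compose[OF sqrt_at_top filterlim_real_sequentially]])

  \<comment> \<open>Eventually \<psi> is at least 1, hence at most its square.\<close>
  have \<psi>_small: "(\<lambda>n. \<psi> (t n) / ?s n) \<longlonglongrightarrow> 0"
  proof (rule Lim_null_comparison[OF _ cond])
    have "filterlim (\<lambda>n. \<psi> (t n)) at_top sequentially" by (rule filterlim_compose[OF \<psi>_top t_top])
    then have "\<forall>\<^sub>F n in sequentially. 1 \<le> \<psi> (t n)" by (simp add: filterlim_at_top)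
    then show "\<forall>\<^sub>F n in sequentially. norm (\<psi> (t n) / ?s n) \<le>
      (\<psi> (tilt p (?r n k)))\<^sup>2 / sqrt (real n * \<psi>' (tilt p (?r n k)))"
      using ev_T
    proof eventually_elim
      case (elim n)
      have "\<psi> (t n) / ?s n \<le> (\<psi> (t n))\<^sup>2 / ?s n"
        using elim \<sigma>_pos[OF elim(2)] by (intro divide_right_mono) (auto simp: power2_eq_square)
      then show ?case
        using elim \<sigma>_pos[OF elim(2)] by (simp add: t_def m_def \<sigma>_def real_sqrt_mult mult.commute)
    qed
  qed
  have mean_small: "(\<lambda>n. ?m (t n) / ?s n) \<longlonglongrightarrow> 0"
  proof -
    have "(\<lambda>n. \<psi> (t n) / ?s n + (?m (t n) - \<psi> (t n)) / \<sigma> (t n) / sqrt (real n)) \<longlonglongrightarrow> 0 + 0"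
      by (intro tendsto_add \<psi>_small tendsto_divide_0[OF filterlim_compose[OF tilted_mean_asymptotic t_top] sqrt_top])
    moreover have "\<psi> (t n) / ?s n + (?m (t n) - \<psi> (t n)) / \<sigma> (t n) / sqrt (real n) =
        ?m (t n) / ?s n" for n
      by (simp flip: add_divide_distrib)
    ultimately show ?thesis by simp
  qed
  have inv_small: "(\<lambda>n. 1 / ?s n) \<longlonglongrightarrow> 0"
  proof (rule Lim_null_comparison[OF _ mean_small])
    have "\<forall>\<^sub>F n in sequentially. 1 \<le> ?m (t n)"
      using filterlim_compose[OF tilted_mean_at_top t_top] by (simp add: filterlim_at_top)
    then show "\<forall>\<^sub>F n in sequentially. norm (1 / ?s n) \<le> ?m (t n) / ?s n"
      using ev_T
    proof eventually_elim
      case (elim n)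
      have "1 / ?s n \<le> ?m (t n) / ?s n"
        using elim \<sigma>_pos[OF elim(2)] by (intro divide_right_mono) auto
      then show ?case using \<sigma>_pos[OF elim(2)] by simp
    qed
  qed

  obtain C T where T: "T0 \<le> T"
    and G: "\<And>t :: nat \<Rightarrow> real. (\<And>n. T \<le> t n) \<Longrightarrow> filterlim t at_top sequentially \<Longrightarrow>
      gaussian_limit (\<lambda>n. rescaled (t n) (\<psi> (t n)) (\<sigma> (t n))) C"
    using gaussian_limit_rescaled by metis
  define t' where "t' n = max T (t n)" for n
  have t'_ge: "T \<le> t' n" "T0 \<le> t' n" for n using T by (auto simp: t'_def)
  have t'_eq: "\<forall>\<^sub>F n in sequentially. t' n = t n"
    using t_top[unfolded filterlim_at_top, rule_format, of T] by eventually_elim (simp add: t'_def)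
  have t'_top: "filterlim t' at_top sequentially"
    using t_top by (rule filterlim_at_top_mono) (simp add: t'_def)
  note local = inverse_char_tendsto[OF G[OF t'_ge(1) t'_top] \<sigma>_pos[OF t'_ge(2)]]

  define F1 where "F1 n = ?F (t n) (n - k) (real n * a n - S k)" for n
  define F2 where "F2 n = ?F (t n) n (real n * a n)" for n
  have m_eq: "\<forall>\<^sub>F n in sequentially. real (n - k) * ?m (t n) = real n * a n - S k \<and> k < n"
    using mean_t eventually_gt_at_top[of k]
  proof eventually_elim
    case (elim n)
    then show ?case by (simp add: m_def residual_mean_def S_def of_nat_diff)
  qed
  have D1: "(\<lambda>n. \<sigma> (t n) * sqrt (real (n - k)) * F1 n) \<longlonglongrightarrow> 1 / sqrt (2 * pi)"
  proof -
    \<comment> \<open>The definition of m_k places this target exactly at the tilted mean of the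
      remaining \<open>n - k\<close> summands.\<close>
    have "(\<lambda>n. (real n * a n - S k - real (n - k) * ?m (t' n)) / (\<sigma> (t' n) * sqrt (real (n - k)))) \<longlonglongrightarrow> 0"
    proof (rule tendsto_eventually)
      show "\<forall>\<^sub>F n in sequentially. (real n * a n - S k - real (n - k) * ?m (t' n)) / (\<sigma> (t' n) * sqrt (real (n - k))) = 0"
        using m_eq t'_eq
      proof eventually_elim
        case (elim n)
        then have "real n * a n - S k - real (n - k) * ?m (t' n) = 0" by (simp only: diff_self)
        then show ?case by simp
      qed
    qed
    from local[OF _ this]
    have "(\<lambda>n. \<sigma> (t' n) * sqrt (real (n - k)) * ?F (t' n) (n - k) (real n * a n - S k)) \<longlonglongrightarrow> 1 / sqrt (2 * pi)"
      using filterlim_minus_const_nat_at_top[of k] by simp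
    moreover have "\<forall>\<^sub>F n in sequentially. \<sigma> (t' n) * sqrt (real (n - k)) * ?F (t' n) (n - k) (real n * a n - S k)
       = \<sigma> (t n) * sqrt (real (n - k)) * F1 n"
      using t'_eq by eventually_elim (simp add: F1_def)
    ultimately show ?thesis by (rule Lim_transform_eventually)
  qed
  have D2: "(\<lambda>n. ?s n * F2 n) \<longlonglongrightarrow> 1 / sqrt (2 * pi)"
  proof -
    \<comment> \<open>For all \<open>n\<close> summands the target is off the mean by s_k - k m_k,
      which is negligible on the scale \<open>?s n\<close>.\<close>
    have "(\<lambda>n. S k * (1 / ?s n) - real k * (?m (t n) / ?s n)) \<longlonglongrightarrow> S k * 0 - real k * 0"
      by (intro tendsto_diff tendsto_mult tendsto_const inv_small mean_small)
    then have "(\<lambda>n. S k * (1 / ?s n) - real k * (?m (t n) / ?s n)) \<longlonglongrightarrow> 0" by simp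
    moreover have "\<forall>\<^sub>F n in sequentially. S k * (1 / ?s n) - real k * (?m (t n) / ?s n)
       = (real n * a n - real n * ?m (t' n)) / (\<sigma> (t' n) * sqrt (real n))"
      using m_eq t'_eq
    proof eventually_elim
      case (elim n)
      then have "real (n - k) = real n - real k" "real (n - k) * ?m (t n) = real n * a n - S k"
        by (auto simp: of_nat_diff)
      then have "S k - real k * ?m (t n) = real n * a n - real n * ?m (t n)"
        by (simp only:) (simp add: algebra_simps)
      then show ?case using elim(2) by (simp add: diff_divide_distrib[symmetric])
    qed
    ultimately have "(\<lambda>n. (real n * a n - real n * ?m (t' n)) / (\<sigma> (t' n) * sqrt (real n))) \<longlonglongrightarrow> 0"
      by (rule Lim_transform_eventually)
    from local[OF filterlim_ident this]
    have "(\<lambda>n. \<sigma> (t' n) * sqrt (real n) * ?F (t' n) n (real n * a n)) \<longlonglongrightarrow> 1 / sqrt (2 * pi)" .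
    moreover have "\<forall>\<^sub>F n in sequentially. \<sigma> (t' n) * sqrt (real n) * ?F (t' n) n (real n * a n)
       = ?s n * F2 n"
      using t'_eq by eventually_elim (simp add: F2_def)
    ultimately show ?thesis by (rule Lim_transform_eventually)
  qed
  have F_ratio: "(\<lambda>n. F1 n / F2 n) \<longlonglongrightarrow> 1"
  proof -
    have kn: "(\<lambda>n. real k / real n) \<longlonglongrightarrow> 0" by (rule lim_const_over_n)
    have "(\<lambda>n. sqrt (1 - real k / real n)) \<longlonglongrightarrow> sqrt (1 - 0)"
      by (intro tendsto_real_sqrt tendsto_diff tendsto_const kn)
    then have root: "(\<lambda>n. sqrt (1 - real k / real n)) \<longlonglongrightarrow> 1" by simp
    have "(\<lambda>n. (\<sigma> (t n) * sqrt (real (n - k)) * F1 n) / (?s n * F2 n) / sqrt (1 - real k / real n)) \<longlonglongrightarrow> (1 / sqrt (2 * pi)) / (1 / sqrt (2 * pi)) / 1"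
      by (intro tendsto_divide D1 D2 root) auto
    then have "(\<lambda>n. (\<sigma> (t n) * sqrt (real (n - k)) * F1 n) / (?s n * F2 n) / sqrt (1 - real k / real n)) \<longlonglongrightarrow> 1" by simp
    moreover have "\<forall>\<^sub>F n in sequentially. (\<sigma> (t n) * sqrt (real (n - k)) * F1 n) / (?s n * F2 n) / sqrt (1 - real k / real n) = F1 n / F2 n"
      using ev_T eventually_gt_at_top[of k]
    proof eventually_elim
      case (elim n)
      have "sqrt (real (n - k)) = sqrt (real n) * sqrt (1 - real k / real n)"
        using elim(2) by (simp add: real_sqrt_mult[symmetric] of_nat_diff right_diff_distrib)
      moreover have "0 < sqrt (1 - real k / real n)" "0 < sqrt (real n)" using elim(2) by simp_all
      ultimately show ?case using \<sigma>_pos[OF elim(1)] by simp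
    qed
    ultimately show ?thesis by (rule Lim_transform_eventually)
  qed

  define \<tau> where "\<tau> i n = tilt p (?r n i)" for i n
  \<comment> \<open>The factor that turns tilting by \<open>\<tau> i n\<close> into tilting by
    \<open>t n\<close> at \<open>y (i + 1)\<close>.\<close>
  define L where "L i n = exp ((t n - \<tau> i n) * y (i + 1)) * (mgf p (\<tau> i n) / mgf p (t n))" for i n
  have L_lim: "L i \<longlonglongrightarrow> 1" if i: "i < k" for i
  proof -
    obtain K where K: "\<forall>\<^sub>F n in sequentially. \<bar>?r n i - ?r n k\<bar> \<le> K * ?r n k / real n"
      using residual_mean_close[OF a, of i k y] i by auto
    have "\<forall>\<^sub>F n in sequentially. \<bar>?m (\<tau> i n) - ?m (t n)\<bar> \<le> K * ?m (t n) / real n"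
      using K mean_res[of i] mean_t by eventually_elim (simp add: \<tau>_def m_def)
    note pert = tilt_perturbation[OF t_top mean_small this]
    have "(\<lambda>n. exp (- (\<tau> i n - t n) * y (i + 1)) * exp (ln (mgf p (\<tau> i n)) - ln (mgf p (t n)))) \<longlonglongrightarrow> exp (- 0 * y (i + 1)) * exp 0"
      by (intro tendsto_mult tendsto_exp tendsto_minus tendsto_const pert)
    then show ?thesis
      by (simp add: L_def[abs_def] exp_diff mgf_pos)
  qed
  define Q where "Q n = F1 n / F2 n * (\<Prod>i=0..<k. L i n)" for n
  have "(\<lambda>n. F1 n / F2 n * (\<Prod>i=0..<k. L i n)) \<longlonglongrightarrow> 1 * (\<Prod>i=0..<k. 1)"
    by (intro tendsto_mult F_ratio tendsto_prod L_lim) simp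
  then have "(\<lambda>n. Q n - 1) \<longlonglongrightarrow> 1 - 1"
    unfolding Q_def[abs_def] by (intro tendsto_diff tendsto_const) simp
  then have Q_lim: "(\<lambda>n. Q n - 1) \<longlonglongrightarrow> 0" by simp

  have cond_eq: "\<forall>\<^sub>F n in sequentially. cond_density M X p k n y (real n * a n) =
       (\<Prod>i=0..<k. tilted_density p (?r n i) (y (i + 1))) * (1 + (Q n - 1))"
    \<comment> \<open>At least two summands must remain for \<open>cont_density_sum\<close> to apply
      to X_{k+1} + ... + X_n.\<close>
    using eventually_ge_at_top[of "k + 2"]
  proof eventually_elim
    case (elim n)
    define \<Phi> where "\<Phi> = mgf p (t n)"
    have \<Phi>: "0 < \<Phi>" unfolding \<Phi>_def by (rule mgf_pos)
    have dens: "cont_density M (\<lambda>\<omega>. \<Sum>i\<in>I. X i \<omega>) s = exp (- (t n * s)) * \<Phi> ^ card I * ?F (t n) (card I) s"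
      if "I \<subseteq> {1..}" "finite I" "2 \<le> card I" for I s
      unfolding \<Phi>_def using that X prob_space.indep_vars_subset[OF M ind]
      by (intro cont_density_sum[OF M]) auto
    have sum_y: "(\<Sum>i=1..k. y i) = (\<Sum>i=0..<k. y (i + 1))"
      using sum.shift_bounds_Suc_ivl[of y 0 k] by (simp add: atLeastLessThanSuc_atLeastAtMost)
    have prod_y: "(\<Prod>i=1..k. p (y i)) = (\<Prod>i=0..<k. p (y (i + 1)))"
      using prod.shift_bounds_Suc_ivl[of "\<lambda>i. p (y i)" 0 k] by (simp add: atLeastLessThanSuc_atLeastAtMost)
    have c1: "cont_density M (\<lambda>\<omega>. \<Sum>i=k+1..n. X i \<omega>) (real n * a n - S k) =
        exp (- (t n * (real n * a n - S k))) * \<Phi> ^ (n - k) * F1 n"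
      using elim by (subst dens) (auto simp: F1_def)
    have c2: "cont_density M (\<lambda>\<omega>. \<Sum>i=1..n. X i \<omega>) (real n * a n) = exp (- (t n * (real n * a n))) * \<Phi> ^ n * F2 n"
      using elim by (subst dens) (auto simp: F2_def)
    have "cond_density M X p k n y (real n * a n) =
      (\<Prod>i=1..k. p (y i)) * (exp (t n * S k) / \<Phi> ^ k * (F1 n / F2 n))"
    proof -
      have "\<Phi> ^ n = \<Phi> ^ (n - k) * \<Phi> ^ k" using elim by (simp flip: power_add)
      moreover have "exp (- (t n * (real n * a n - S k))) = exp (- (t n * (real n * a n))) * exp (t n * S k)"
        by (simp add: algebra_simps flip: exp_add)
      ultimately show ?thesis
        unfolding cond_density_def joint_density_def S_def[symmetric] c1 c2 using \<Phi> by simp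
    qed
    also have "exp (t n * S k) / \<Phi> ^ k = (\<Prod>i=0..<k. exp (t n * y (i + 1)) / \<Phi>)"
      unfolding S_def sum_y by (simp add: sum_distrib_left exp_sum prod_dividef)
    also have "(\<Prod>i=1..k. p (y i)) * ((\<Prod>i=0..<k. exp (t n * y (i + 1)) / \<Phi>) * (F1 n / F2 n))
      = (\<Prod>i=0..<k. p (y (i + 1)) * (exp (t n * y (i + 1)) / \<Phi>)) * (F1 n / F2 n)"
      unfolding prod_y prod.distrib by simp
    also have "(\<Prod>i=0..<k. p (y (i + 1)) * (exp (t n * y (i + 1)) / \<Phi>))
      = (\<Prod>i=0..<k. tilted_density p (?r n i) (y (i + 1)) * L i n)"
    proof (rule prod.cong[OF refl])
      fix i
      have "exp (t n * y (i + 1)) = exp (\<tau> i n * y (i + 1)) * exp ((t n - \<tau> i n) * y (i + 1))"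
        by (simp add: algebra_simps flip: exp_add)
      then show "p (y (i + 1)) * (exp (t n * y (i + 1)) / \<Phi>) = tilted_density p (?r n i) (y (i + 1)) * L i n"
        using mgf_pos[of "\<tau> i n"] by (simp add: tilted_density_def L_def \<Phi>_def flip: \<tau>_def)
    qed
    also have "\<dots> * (F1 n / F2 n) = (\<Prod>i=0..<k. tilted_density p (?r n i) (y (i + 1))) * (1 + (Q n - 1))"
      unfolding Q_def prod.distrib by simp
    finally show ?case .
  qed
  show ?thesis using Q_lim cond_eq by (intro exI[of _ "\<lambda>n. Q n - 1"]) simp
qed

end

theorem theorem5p1:
  fixes M :: "'a measure" and X :: "nat \<Rightarrow> 'a \<Rightarrow> real"
    and p g q h :: "real \<Rightarrow> real" and c \<theta> :: real
    and a :: "nat \<Rightarrow> real" and k :: nat and y :: "nat \<Rightarrow> real"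
  assumes "prob_space M"
    and "prob_space.indep_vars M (\<lambda>_. borel) X {1..}"
    and "\<And>i. 1 \<le> i \<Longrightarrow> distributed M lborel (X i) (\<lambda>x. ennreal (p x))"
    and "\<exists>B. \<forall>x. p x \<le> B"
    and "c > 0"
    and "\<And>x. 0 \<le> x \<Longrightarrow> p x = c * exp (- (g x - q x))"
    and "\<And>x. x < 0 \<Longrightarrow> p x = 0"
    and "\<And>x. 0 \<le> x \<Longrightarrow> g x > 0"
    and "filterlim (\<lambda>x. g x / x) at_top at_top"
    and "\<And>x. 0 < x \<Longrightarrow> (g has_real_derivative h x) (at x)"
    and "\<And>b. bdd_above (h ` {0<..b})"
    and "\<theta> > 0"
    and "\<forall>\<^sub>F x in at_top. \<forall>v\<ge>0. \<bar>v - x\<bar> < \<theta> * x \<longrightarrow> \<bar>q v\<bar> \<le> 1 / sqrt (x * h x)"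
    and "h \<in> R_class"
    and "filterlim a at_top sequentially"
    and "k \<ge> 1"
    and "(\<lambda>n. (gen_inverse h (tilt p (residual_mean a y n k)))\<^sup>2 /
           sqrt (real n * deriv (gen_inverse h) (tilt p (residual_mean a y n k)))) \<longlonglongrightarrow> 0"
  shows "\<exists>\<epsilon>. \<epsilon> \<longlonglongrightarrow> 0 \<and>
    (\<forall>\<^sub>F n in sequentially. cond_density M X p k n y (real n * a n) =
       (\<Prod>i=0..<k. tilted_density p (residual_mean a y n i) (y (i + 1))) * (1 + \<epsilon> n))"
proof -
  interpret prob_space M by (rule assms(1))
  note p_eq = assms(6) and p_neg = assms(7)
  obtain B where B: "\<And>x. p x \<le> B" using assms(4) by blast
  have p_nonneg: "0 \<le> p x" for x
    using p_eq[of x] p_neg[of x] \<open>c > 0\<close> by (cases "x < 0") auto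
  have p_measurable: "p \<in> borel_measurable borel"
  proof -
    have "(\<lambda>x. ennreal (p x)) \<in> borel_measurable borel"
      using assms(3)[of 1] by (simp add: distributed_def)
    then have "(\<lambda>x. enn2real (ennreal (p x))) \<in> borel_measurable borel"
      by (rule borel_measurable_enn2real)
    then show ?thesis by (simp add: p_nonneg)
  qed
  obtain \<psi>' X0 T0 where "regular_inverse g h (gen_inverse h) \<psi>' X0 T0"
    using regular_inverse_of_R_class[OF \<open>h \<in> R_class\<close> assms(10) assms(11)] by blast
  then interpret R: regular_inverse g h "gen_inverse h" \<psi>' X0 T0 .
  \<comment> \<open>The uniform bound is taken at the centre \<open>v = x\<close> of its
    window.\<close>
  have q_le: "\<forall>\<^sub>F x in at_top. \<bar>q x\<bar> \<le> 1 / sqrt (x * h x)"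
    using assms(13) eventually_gt_at_top[of 0] by eventually_elim (use \<open>\<theta> > 0\<close> in simp)
  have "filterlim (\<lambda>x. sqrt (x * h x)) at_top at_top"
    by (rule filterlim_compose[OF sqrt_at_top filterlim_at_top_mult_at_top[OF filterlim_ident R.h_top]])
  then have "((\<lambda>x. 1 / sqrt (x * h x)) \<longlongrightarrow> 0) at_top"
    by (intro tendsto_divide_0[OF tendsto_const] filterlim_at_top_imp_at_infinity)
  then have q_lim: "(q \<longlongrightarrow> 0) at_top"
    by (rule Lim_null_comparison[rotated]) (use q_le in simp)
  \<comment> \<open>Superlinear growth of \<open>g\<close> absorbs t x for large x; before that,
    \<open>p\<close> is at most \<open>B\<close> and exp(t x) is bounded.\<close>
  have tilt_bounded: "\<exists>B. \<forall>x. exp (t * x) * p x \<le> B" for t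
  proof -
    have "\<forall>\<^sub>F x in at_top. \<bar>q x\<bar> < 1" using tendstoD[OF q_lim, of 1] by simp
    moreover have "\<forall>\<^sub>F x in at_top. t \<le> g x / x" using assms(9) by (simp add: filterlim_at_top)
    ultimately have "\<forall>\<^sub>F x in at_top. \<bar>q x\<bar> < 1 \<and> t \<le> g x / x" by (rule eventually_conj)
    then obtain Z where Z: "\<And>x. Z \<le> x \<Longrightarrow> \<bar>q x\<bar> < 1 \<and> t \<le> g x / x"
      unfolding eventually_at_top_linorder by blast
    define Y where "Y = max Z 1"
    have B0: "0 \<le> B" using p_nonneg[of 0] B[of 0] by simp
    have "exp (t * x) * p x \<le> max (c * exp 1) (exp (\<bar>t\<bar> * Y) * B)" for x
    proof -
      consider "x < 0" | "0 \<le> x" "x < Y" | "Y \<le> x" by linarith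
      then show ?thesis
      proof cases
        case 1
        then show ?thesis using p_neg[of x] \<open>c > 0\<close> by (simp add: le_max_iff_disj)
      next
        case 2
        have "t * x \<le> \<bar>t\<bar> * Y" using 2 by (intro mult_mono) auto
        then have "exp (t * x) * p x \<le> exp (\<bar>t\<bar> * Y) * B" using B p_nonneg by (intro mult_mono) auto
        then show ?thesis by simp
      next
        case 3
        then have x: "0 < x" "Z \<le> x" by (auto simp: Y_def)
        have "t * x \<le> g x" using Z[OF x(2)] x(1) by (simp add: pos_le_divide_eq)
        then have "t * x + - (g x - q x) \<le> 1" using Z[OF x(2)] by linarith
        then have "c * exp (t * x + - (g x - q x)) \<le> c * exp 1" using \<open>c > 0\<close> by simp
        moreover have "exp (t * x) * p x = c * exp (t * x + - (g x - q x))"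
          using p_eq[of x] x by (simp only: exp_add) simp
        ultimately show ?thesis by simp
      qed
    qed
    then show ?thesis by blast
  qed
  interpret laplace_density p g h "gen_inverse h" \<psi>' X0 T0 q c B
  proof
    show "0 < p x" if "0 \<le> x" for x using p_eq[OF that] \<open>c > 0\<close> by simp
  qed (use p_measurable p_nonneg p_neg tilt_bounded \<open>c > 0\<close> p_eq B q_lim in auto)
  let ?t = "\<lambda>n. tilt p (residual_mean a y n k)"
  have "filterlim ?t at_top sequentially"
    by (rule filterlim_compose[OF tilt_at_top residual_mean_at_top[OF assms(15)]])
  then have "\<forall>\<^sub>F n in sequentially. T0 \<le> ?t n" by (simp add: filterlim_at_top)
  \<comment> \<open>\<open>deriv\<close> is known to equal \<psi>' from \<open>T0\<close> on, where
    the derivative has been shown to exist, and the tilts eventually lie there.\<close>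
  then have "\<forall>\<^sub>F n in sequentially. (gen_inverse h (?t n))\<^sup>2 / sqrt (real n * deriv (gen_inverse h) (?t n)) =
      (gen_inverse h (?t n))\<^sup>2 / sqrt (real n * \<psi>' (?t n))"
    by eventually_elim (simp add: DERIV_imp_deriv[OF R.\<psi>_deriv])
  note lim = Lim_transform_eventually[OF assms(17) this]
  show ?thesis
    by (rule conditional_density_asymptotic[OF assms(1-3) assms(15) lim])
qed

end
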